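(* Let $\mathcal{M}$ and $\tilde{\mathcal{M}}$ be Type $\mathcal{A}$ affine surfaces whose Ricci tensors have rank $1$. Assume that $\alpha(\mathcal{M})=\alpha(\tilde{\mathcal{M}})=\alpha$ and $\epsilon(\mathcal{M})=\epsilon(\tilde{\mathcal{M}})=\epsilon$. Write $\mathcal{M}\approx\tilde{\mathcal{M}}$ if $\mathcal{M}$ and $\tilde{\mathcal{M}}$ are locally affine isomorphic. \begin{enumerate} \item If $\alpha=16$, then $\mathcal{M}\approx\tilde{\mathcal{M}}$, $\mathfrak{K}(\mathcal{M})\approx A_{4,9}^0$, and $\mathcal{M}$ is also of Type $\mathcal{B}$. \item If $\alpha\in(0,16)$, then $\mathcal{M}\approx\tilde{\mathcal{M}}$, $\mathfrak{K}(\mathcal{M})\approx A_{4,12}$, and $\mathcal{M}$ is not of Type $\mathcal{B}$. \item If $\alpha\notin[0,16]$, then $\mathcal{M}\approx\tilde{\mathcal{M}}$, $\mathfrak{K}(\mathcal{M})\approx A_2\oplus A_2$, and $\mathcal{M}$ is also of Type $\mathcal{B}$. \item Assume $\alpha=0$. \begin{enumerate} \item If $\epsilon<0$, then $\mathcal{M}\approx\tilde{\mathcal{M}}$, $\mathfrak{K}(\mathcal{M})\approx A_2\oplus A_2$, and $\mathcal{M}$ is also of Type $\mathcal{B}$. \item If $\epsilon>0$, then $\mathcal{M}\approx\tilde{\mathcal{M}}$, $\mathfrak{K}(\mathcal{M})\approx A_{4,12}$, and $\mathcal{M}$ is not of Type $\mathcal{B}$. \end{enumerate} \end{enumerate}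
   Context: An affine surface is a pair $\mathcal{M}=(M,\nabla)$ with $\nabla$ a torsion-free connection on a smooth surface $M$; $\nabla_{\partial_i}\partial_j=\Gamma_{ij}{}^k\partial_k$. It is locally homogeneous if for any two points there is a germ of a diffeomorphism preserving $\nabla$ and taking one point to the other. $\mathcal{M}$ is of Type $\mathcal{A}$ (resp. Type $\mathcal{B}$) if it is locally homogeneous, not flat, and there are local coordinates $(x^1,x^2)$ near each point in which all $\Gamma_{ij}{}^k$ are constant (resp. $\Gamma_{ij}{}^k=(x^1)^{-1}C_{ij}{}^k$ with $C_{ij}{}^k=C_{ji}{}^k$ constant). Ricci tensor: $\rho(\xi_1,\xi_2)=\operatorname{Tr}\{\xi_3\mapsto R(\xi_3,\xi_1)\xi_2\}$ with $R(\xi_1,\xi_2)=\nabla_{\xi_1}\nabla_{\xi_2}-\nabla_{\xi_2}\nabla_{\xi_1}-\nabla_{[\xi_1,\xi_2]}$; it is symmetric for Type $\mathcal{A}$ surfaces. Invariants: if $\mathcal{M}$ is Type $\mathcal{A}$ with $\operatorname{Rank}\{\rho\}=1$, choose a point $P$ and $X\in T_PM$ with $\rho(X,X)\ne0$ and set $\alpha(\mathcal{M}):=\{\nabla\rho(X,X;X)\}^2\cdot\rho(X,X)^{-3}$ and $\epsilon(\mathcal{M}):=\operatorname{Sign}\{\rho(X,X)\}=\pm1$; these do not depend on the choices. A vector field $X$ is affine Killing if $\mathcal{L}_X\nabla=0$. Here $\mathfrak{K}(\mathcal{M})$ denotes the Lie algebra of affine Killing vector fields, understood locally (germs at a point of $M$;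 up to isomorphism this does not depend on the point), and $\mathfrak{K}(\mathcal{M})\approx\cdot$ denotes isomorphism of real Lie algebras. Lie algebras (basis $e_1,\dots,e_4$, unlisted brackets zero): $A_2\oplus A_2$: $[e_1,e_2]=e_2$, $[e_3,e_4]=e_4$. $A_{4,9}^0$: $[e_2,e_3]=e_1$, $[e_1,e_4]=e_1$, $[e_2,e_4]=e_2$. $A_{4,12}$: $[e_1,e_3]=e_1$, $[e_2,e_3]=e_2$, $[e_1,e_4]=-e_2$, $[e_2,e_4]=e_1$. *)

theory Defs
  imports "HOL-Analysis.Analysis"
begin

section \<open>Smooth maps between open sets\<close>

text \<open>
  Both predicates are meant for open \<open>S\<close>. On finite-dimensional spaces
  \<open>k_differentiable_on k S f\<close> says that all partial derivatives of \<open>f\<close> up to order \<open>k\<close>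
  exist and are continuous on \<open>S\<close>.
\<close>

primrec k_differentiable_on ::
  "nat \<Rightarrow> 'a::real_normed_vector set \<Rightarrow> ('a \<Rightarrow> 'b::real_normed_vector) \<Rightarrow> bool" where
  "k_differentiable_on 0 S f \<longleftrightarrow> continuous_on S f"
| "k_differentiable_on (Suc k) S f \<longleftrightarrow>
     (\<forall>x\<in>S. f differentiable (at x)) \<and>
     (\<forall>v. k_differentiable_on k S (\<lambda>x. frechet_derivative f (at x) v))"

definition smooth_on ::
  "'a::real_normed_vector set \<Rightarrow> ('a \<Rightarrow> 'b::real_normed_vector) \<Rightarrow> bool" where
  "smooth_on S f \<longleftrightarrow> (\<forall>k. k_differentiable_on k S f)"


section \<open>Connections in a coordinate domain of the plane\<close>

text \<open>
  Vector fields are given by their components with respect to the coordinate frame, and a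
  connection by its Christoffel symbols: \<open>G x $ i $ j $ k\<close> is \<open>\<Gamma>\<^sub>i\<^sub>j\<^sup>k(x)\<close>, so that the vector
  \<open>G x $ i $ j\<close> is \<open>\<nabla>\<^sub>\<partial>\<^sub>i \<partial>\<^sub>j\<close> at \<open>x\<close>. All operators below evaluate at interior points
  of the domain only.
\<close>

type_synonym field2 = "real^2 \<Rightarrow> real^2"
type_synonym christoffel2 = "real^2 \<Rightarrow> real^2^2^2"

definition covd :: "christoffel2 \<Rightarrow> field2 \<Rightarrow> field2 \<Rightarrow> field2" where
  "covd G X Y x = frechet_derivative Y (at x) (X x) +
     (\<Sum>i\<in>UNIV. \<Sum>j\<in>UNIV. (X x $ i * Y x $ j) *\<^sub>R (G x $ i $ j))"

definition vf_bracket :: "field2 \<Rightarrow> field2 \<Rightarrow> field2" where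
  "vf_bracket X Y x =
     frechet_derivative Y (at x) (X x) - frechet_derivative X (at x) (Y x)"

definition torsion_free_on :: "(real^2) set \<Rightarrow> christoffel2 \<Rightarrow> bool" where
  "torsion_free_on V G \<longleftrightarrow>
     (\<forall>X Y. smooth_on V X \<longrightarrow> smooth_on V Y \<longrightarrow>
        (\<forall>x\<in>V. covd G X Y x - covd G Y X x = vf_bracket X Y x))"

definition curv :: "christoffel2 \<Rightarrow> field2 \<Rightarrow> field2 \<Rightarrow> field2 \<Rightarrow> field2" where
  "curv G X Y Z x =
     covd G X (covd G Y Z) x - covd G Y (covd G X Z) x - covd G (vf_bracket X Y) Z x"

text \<open>
  Curvature and the derivative of the Ricci tensor are tensorial, so their values on tangent
  vectors are computed by extending these vectors to fields with constant components.
\<close>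

definition curv_at :: "christoffel2 \<Rightarrow> real^2 \<Rightarrow> real^2 \<Rightarrow> real^2 \<Rightarrow> real^2 \<Rightarrow> real^2" where
  "curv_at G x u v w = curv G (\<lambda>_. u) (\<lambda>_. v) (\<lambda>_. w) x"

definition ricci :: "christoffel2 \<Rightarrow> real^2 \<Rightarrow> real^2 \<Rightarrow> real^2 \<Rightarrow> real" where
  "ricci G x u v = trace (matrix (\<lambda>w. curv_at G x w u v))"

definition ricci_matrix :: "christoffel2 \<Rightarrow> real^2 \<Rightarrow> real^2^2" where
  "ricci_matrix G x = (\<chi> i j. ricci G x (axis i 1) (axis j 1))"

text \<open>\<open>nabla_ricci G Y Z X\<close> is \<open>\<nabla>\<rho>(Y, Z; X)\<close>: the last argument is the direction of
  differentiation.\<close>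

definition nabla_ricci :: "christoffel2 \<Rightarrow> field2 \<Rightarrow> field2 \<Rightarrow> field2 \<Rightarrow> real^2 \<Rightarrow> real" where
  "nabla_ricci G Y Z X x =
     frechet_derivative (\<lambda>y. ricci G y (Y y) (Z y)) (at x) (X x)
     - ricci G x (covd G X Y x) (Z x) - ricci G x (Y x) (covd G X Z x)"

definition nabla_ricci_at :: "christoffel2 \<Rightarrow> real^2 \<Rightarrow> real^2 \<Rightarrow> real^2 \<Rightarrow> real^2 \<Rightarrow> real" where
  "nabla_ricci_at G x u v w = nabla_ricci G (\<lambda>_. u) (\<lambda>_. v) (\<lambda>_. w) x"

text \<open>\<open>lie_conn G X Y Z\<close> is \<open>(\<L>\<^sub>X \<nabla>)(Y, Z)\<close>.\<close>

definition lie_conn :: "christoffel2 \<Rightarrow> field2 \<Rightarrow> field2 \<Rightarrow> field2 \<Rightarrow> field2" where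
  "lie_conn G X Y Z x =
     vf_bracket X (covd G Y Z) x - covd G (vf_bracket X Y) Z x - covd G Y (vf_bracket X Z) x"

text \<open>
  For a diffeomorphism \<open>t\<close> from \<open>V\<close> onto \<open>t ` V\<close>, the fields \<open>X'\<close> and \<open>Y'\<close> are the push-forwards
  of \<open>X\<close> and \<open>Y\<close>; the condition reads \<open>\<nabla>'\<^bsub>t\<^sub>*X\<^esub> t\<^sub>*Y = t\<^sub>* (\<nabla>\<^sub>X Y)\<close>.
\<close>

definition preserves_connection ::
  "(real^2) set \<Rightarrow> field2 \<Rightarrow> christoffel2 \<Rightarrow> christoffel2 \<Rightarrow> bool" where
  "preserves_connection V t G G' \<longleftrightarrow>
     (\<forall>X Y X' Y'. smooth_on V X \<longrightarrow> smooth_on V Y \<longrightarrow>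
        smooth_on (t ` V) X' \<longrightarrow> smooth_on (t ` V) Y' \<longrightarrow>
        (\<forall>x\<in>V. X' (t x) = frechet_derivative t (at x) (X x)) \<longrightarrow>
        (\<forall>x\<in>V. Y' (t x) = frechet_derivative t (at x) (Y x)) \<longrightarrow>
        (\<forall>x\<in>V. covd G' X' Y' (t x) = frechet_derivative t (at x) (covd G X Y x)))"


section \<open>Affine surfaces\<close>

text \<open>
  A chart is a pair of an open coordinate domain and a coordinate map; only the values of the
  map on the domain matter.
\<close>

type_synonym 'a chart = "'a set \<times> ('a \<Rightarrow> real^2)"

definition is_chart :: "'a::topological_space chart \<Rightarrow> bool" where
  "is_chart c \<longleftrightarrow> open (fst c) \<and> open (snd c ` fst c) \<and>
     homeomorphism (fst c) (snd c ` fst c) (snd c) (inv_into (fst c) (snd c))"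

definition chart_inv :: "'a chart \<Rightarrow> real^2 \<Rightarrow> 'a" where
  "chart_inv c = inv_into (fst c) (snd c)"

definition chart_image :: "'a chart \<Rightarrow> 'a set \<Rightarrow> (real^2) set" where
  "chart_image c U = snd c ` (fst c \<inter> U)"

text \<open>The coordinate representation of a map; for the identity this is the change of
  coordinates from \<open>c\<close> to \<open>d\<close>.\<close>

definition coord_rep :: "'a chart \<Rightarrow> 'b chart \<Rightarrow> ('a \<Rightarrow> 'b) \<Rightarrow> real^2 \<Rightarrow> real^2" where
  "coord_rep c d f = snd d \<circ> f \<circ> chart_inv c"

definition compatible :: "'a chart \<Rightarrow> 'a chart \<Rightarrow> bool" where
  "compatible c d \<longleftrightarrow> smooth_on (chart_image c (fst d)) (coord_rep c d id) \<and>
     smooth_on (chart_image d (fst c)) (coord_rep d c id)"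

definition maximal_atlas :: "'a::topological_space chart set \<Rightarrow> bool" where
  "maximal_atlas A \<longleftrightarrow> (\<forall>c\<in>A. is_chart c) \<and> (\<forall>c\<in>A. \<forall>d\<in>A. compatible c d) \<and>
     (\<forall>c. is_chart c \<and> (\<forall>d\<in>A. compatible c d) \<longrightarrow> c \<in> A)"

text \<open>
  The smooth structure is a maximal atlas, so that its elements are exactly the local coordinate
  systems of the surface. The connection assigns to every local coordinate system its
  Christoffel symbols, as a function of the coordinates; that they describe one connection is
  expressed by coordinate changes preserving them. The underlying manifold is the union
  of the chart domains, an open subset of the (Hausdorff, second countable) point type.
\<close>

record 'a surface =
  charts :: "'a chart set"
  gam :: "'a chart \<Rightarrow> christoffel2"

definition points :: "'a surface \<Rightarrow> 'a set" where
  "points M = \<Union> (fst ` charts M)"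

definition affine_surface ::
  "'a::{t2_space, second_countable_topology} surface \<Rightarrow> bool" where
  "affine_surface M \<longleftrightarrow> maximal_atlas (charts M) \<and>
     (\<forall>c\<in>charts M. smooth_on (chart_image c UNIV) (gam M c) \<and>
                   torsion_free_on (chart_image c UNIV) (gam M c)) \<and>
     (\<forall>c\<in>charts M. \<forall>d\<in>charts M.
        preserves_connection (chart_image c (fst d)) (coord_rep c d id) (gam M c) (gam M d))"


section \<open>Local affine isomorphisms and homogeneity\<close>

definition smooth_map :: "'a surface \<Rightarrow> 'b surface \<Rightarrow> 'a set \<Rightarrow> ('a \<Rightarrow> 'b) \<Rightarrow> bool" where
  "smooth_map M N U f \<longleftrightarrow> (\<forall>c\<in>charts M. \<forall>d\<in>charts N.
     smooth_on (chart_image c (U \<inter> f -` fst d)) (coord_rep c d f))"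

definition diffeo ::
  "'a::topological_space surface \<Rightarrow> 'b::topological_space surface \<Rightarrow> 'a set \<Rightarrow> ('a \<Rightarrow> 'b) \<Rightarrow> bool"
  where
  "diffeo M N U f \<longleftrightarrow>
     open U \<and> U \<subseteq> points M \<and> open (f ` U) \<and> f ` U \<subseteq> points N \<and>
     homeomorphism U (f ` U) f (inv_into U f) \<and>
     smooth_map M N U f \<and> smooth_map N M (f ` U) (inv_into U f)"

definition affine_diffeo ::
  "'a::topological_space surface \<Rightarrow> 'b::topological_space surface \<Rightarrow> 'a set \<Rightarrow> ('a \<Rightarrow> 'b) \<Rightarrow> bool"
  where
  "affine_diffeo M N U f \<longleftrightarrow> diffeo M N U f \<and> (\<forall>c\<in>charts M. \<forall>d\<in>charts N.
     preserves_connection (chart_image c (U \<inter> f -` fst d)) (coord_rep c d f) (gam M c) (gam N d))"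

definition locally_homogeneous :: "'a::topological_space surface \<Rightarrow> bool" where
  "locally_homogeneous M \<longleftrightarrow> (\<forall>P\<in>points M. \<forall>Q\<in>points M.
     \<exists>U f. P \<in> U \<and> affine_diffeo M M U f \<and> f P = Q)"

text \<open>For locally homogeneous surfaces it makes no difference whether the base points below are
  arbitrary or chosen.\<close>

definition locally_affine_isomorphic ::
  "'a::topological_space surface \<Rightarrow> 'b::topological_space surface \<Rightarrow> bool" where
  "locally_affine_isomorphic M N \<longleftrightarrow> (\<forall>P\<in>points M. \<forall>Q\<in>points N.
     \<exists>U f. P \<in> U \<and> affine_diffeo M N U f \<and> f P = Q)"


section \<open>Types and invariants\<close>

definition flat :: "'a surface \<Rightarrow> bool" where
  "flat M \<longleftrightarrow> (\<forall>c\<in>charts M. \<forall>x\<in>chart_image c UNIV. \<forall>u v w. curv_at (gam M c) x u v w = 0)"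

definition type_A :: "'a::topological_space surface \<Rightarrow> bool" where
  "type_A M \<longleftrightarrow> locally_homogeneous M \<and> \<not> flat M \<and>
     (\<forall>P\<in>points M. \<exists>c\<in>charts M. P \<in> fst c \<and>
        (\<exists>C. \<forall>x\<in>chart_image c UNIV. gam M c x = C))"

definition type_B :: "'a::topological_space surface \<Rightarrow> bool" where
  "type_B M \<longleftrightarrow> locally_homogeneous M \<and> \<not> flat M \<and>
     (\<forall>P\<in>points M. \<exists>c\<in>charts M. P \<in> fst c \<and>
        (\<exists>C. (\<forall>i j. C $ i $ j = C $ j $ i) \<and>
             (\<forall>x\<in>chart_image c UNIV. x $ 1 \<noteq> 0 \<and> gam M c x = inverse (x $ 1) *\<^sub>R C)))"

definition ricci_rank :: "'a surface \<Rightarrow> nat \<Rightarrow> bool" where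
  "ricci_rank M r \<longleftrightarrow>
     (\<forall>c\<in>charts M. \<forall>x\<in>chart_image c UNIV. rank (ricci_matrix (gam M c) x) = r)"

text \<open>
  A choice of a point \<open>P\<close>, a chart \<open>c\<close> around \<open>P\<close>, and the components \<open>v\<close> in \<open>c\<close> of a tangent vector
  at \<open>P\<close> on which the Ricci tensor does not vanish. The invariants below do not depend on it
  if the surface is of Type A with Ricci tensor of rank 1.
\<close>

definition ricci_witness :: "'a surface \<Rightarrow> 'a \<times> 'a chart \<times> (real^2)" where
  "ricci_witness M = (SOME (P, c, v). c \<in> charts M \<and> P \<in> fst c \<and> ricci (gam M c) (snd c P) v v \<noteq> 0)"

definition alpha_inv :: "'a surface \<Rightarrow> real" where
  "alpha_inv M = (case ricci_witness M of (P, c, v) \<Rightarrow>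
     (nabla_ricci_at (gam M c) (snd c P) v v v)\<^sup>2 * inverse (ricci (gam M c) (snd c P) v v ^ 3))"

definition eps_inv :: "'a surface \<Rightarrow> real" where
  "eps_inv M = (case ricci_witness M of (P, c, v) \<Rightarrow> sgn (ricci (gam M c) (snd c P) v v))"


section \<open>Real Lie algebras\<close>

record 'v lie_alg =
  lie_carrier :: "'v set"
  lie_add :: "'v \<Rightarrow> 'v \<Rightarrow> 'v"
  lie_scale :: "real \<Rightarrow> 'v \<Rightarrow> 'v"
  lie_bracket :: "'v \<Rightarrow> 'v \<Rightarrow> 'v"

definition lie_isomorphic :: "'v lie_alg \<Rightarrow> 'w lie_alg \<Rightarrow> bool" where
  "lie_isomorphic L K \<longleftrightarrow> (\<exists>h. bij_betw h (lie_carrier L) (lie_carrier K) \<and>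
     (\<forall>a\<in>lie_carrier L. \<forall>b\<in>lie_carrier L.
        h (lie_add L a b) = lie_add K (h a) (h b) \<and>
        h (lie_bracket L a b) = lie_bracket K (h a) (h b)) \<and>
     (\<forall>r. \<forall>a\<in>lie_carrier L. h (lie_scale L r a) = lie_scale K r (h a)))"

abbreviation basis4 :: "4 \<Rightarrow> real^4" where
  "basis4 i \<equiv> axis i 1"

text \<open>
  The bracket on \<open>\<real>\<^sup>4\<close> with \<open>[e\<^sub>i, e\<^sub>j] = B i j\<close> and \<open>[e\<^sub>j, e\<^sub>i] = - B i j\<close> for all listed pairs; \<open>B\<close> must be
  zero on unlisted pairs, and of \<open>(i, j)\<close> and \<open>(j, i)\<close> at most one may be listed.
\<close>

definition lie_of_table :: "(4 \<Rightarrow> 4 \<Rightarrow> real^4) \<Rightarrow> (real^4) lie_alg" where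
  "lie_of_table B = \<lparr>lie_carrier = UNIV, lie_add = (+), lie_scale = (*\<^sub>R),
     lie_bracket = (\<lambda>x y. \<Sum>i\<in>UNIV. \<Sum>j\<in>UNIV. (x $ i * y $ j - x $ j * y $ i) *\<^sub>R B i j)\<rparr>"

definition A2_A2 :: "(real^4) lie_alg" where
  "A2_A2 = lie_of_table (\<lambda>i j.
     if i = 1 \<and> j = 2 then basis4 2
     else if i = 3 \<and> j = 4 then basis4 4
     else 0)"

definition A4_9_0 :: "(real^4) lie_alg" where
  "A4_9_0 = lie_of_table (\<lambda>i j.
     if i = 2 \<and> j = 3 then basis4 1
     else if i = 1 \<and> j = 4 then basis4 1
     else if i = 2 \<and> j = 4 then basis4 2
     else 0)"

definition A4_12 :: "(real^4) lie_alg" where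
  "A4_12 = lie_of_table (\<lambda>i j.
     if i = 1 \<and> j = 3 then basis4 1
     else if i = 2 \<and> j = 3 then basis4 2
     else if i = 1 \<and> j = 4 then - basis4 2
     else if i = 2 \<and> j = 4 then basis4 1
     else 0)"


section \<open>Germs of affine Killing vector fields\<close>

text \<open>
  A tangent vector is represented by its components in all charts around its base point; the
  components in all other charts are set to 0 so that the representation is unique.
\<close>

type_synonym 'a vfield = "'a \<Rightarrow> 'a chart \<Rightarrow> real^2"

definition tangent_space :: "'a surface \<Rightarrow> 'a \<Rightarrow> ('a chart \<Rightarrow> real^2) set" where
  "tangent_space M P = {v.
     (\<forall>c. \<not> (c \<in> charts M \<and> P \<in> fst c) \<longrightarrow> v c = 0) \<and>
     (\<forall>c\<in>charts M. \<forall>d\<in>charts M. P \<in> fst c \<and> P \<in> fst d \<longrightarrow>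
        v d = frechet_derivative (coord_rep c d id) (at (snd c P)) (v c))}"

definition vf_rep :: "'a chart \<Rightarrow> 'a vfield \<Rightarrow> field2" where
  "vf_rep c X x = X (chart_inv c x) c"

definition smooth_vector_field_on :: "'a::topological_space surface \<Rightarrow> 'a set \<Rightarrow> 'a vfield \<Rightarrow> bool"
  where
  "smooth_vector_field_on M U X \<longleftrightarrow> open U \<and> U \<subseteq> points M \<and>
     (\<forall>P\<in>U. X P \<in> tangent_space M P) \<and>
     (\<forall>c\<in>charts M. smooth_on (chart_image c U) (vf_rep c X))"

definition affine_killing_on :: "'a::topological_space surface \<Rightarrow> 'a set \<Rightarrow> 'a vfield \<Rightarrow> bool" where
  "affine_killing_on M U X \<longleftrightarrow> smooth_vector_field_on M U X \<and>
     (\<forall>c\<in>charts M. \<forall>Y Z. smooth_on (chart_image c U) Y \<longrightarrow> smooth_on (chart_image c U) Z \<longrightarrow>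
        (\<forall>x\<in>chart_image c U. lie_conn (gam M c) (vf_rep c X) Y Z x = 0))"

definition germ :: "'a::topological_space \<Rightarrow> 'a vfield \<Rightarrow> 'a vfield set" where
  "germ P X = {Y. eventually (\<lambda>Q. Y Q = X Q) (nhds P)}"

definition germ_repr :: "'a vfield set \<Rightarrow> 'a vfield" where
  "germ_repr g = (SOME X. X \<in> g)"

definition vfield_bracket :: "'a surface \<Rightarrow> 'a vfield \<Rightarrow> 'a vfield \<Rightarrow> 'a vfield" where
  "vfield_bracket M X Y P c =
     (if c \<in> charts M \<and> P \<in> fst c then vf_bracket (vf_rep c X) (vf_rep c Y) (snd c P) else 0)"

text \<open>All operations are local, hence do not depend on the chosen representatives.\<close>

definition killing_algebra :: "'a::topological_space surface \<Rightarrow> 'a \<Rightarrow> 'a vfield set lie_alg" where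
  "killing_algebra M P = \<lparr>
     lie_carrier = germ P ` {X. \<exists>U. P \<in> U \<and> affine_killing_on M U X},
     lie_add = (\<lambda>g h. germ P (\<lambda>Q c. germ_repr g Q c + germ_repr h Q c)),
     lie_scale = (\<lambda>r g. germ P (\<lambda>Q c. r *\<^sub>R germ_repr g Q c)),
     lie_bracket = (\<lambda>g h. germ P (vfield_bracket M (germ_repr g) (germ_repr h)))\<rparr>"

definition killing_isomorphic :: "'a::topological_space surface \<Rightarrow> 'v lie_alg \<Rightarrow> bool" where
  "killing_isomorphic M L \<longleftrightarrow> (\<forall>P\<in>points M. lie_isomorphic (killing_algebra M P) L)"

end

theory Submission
  imports Defs
begin

text \<open>
  In a Type A chart, linear coordinates with \<open>\<partial>\<^sub>1\<close> in the kernel of the Ricci tensor make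
  \<open>\<Gamma>\<^sub>1\<^sub>1\<^sup>2 = \<Gamma>\<^sub>1\<^sub>2\<^sup>2 = 0\<close> and \<open>\<rho> = \<epsilon> dx\<^sup>2 \<otimes> dx\<^sup>2\<close>. The geodesic equations then reduce to a second order linear
  ordinary differential equation with constant coefficients for a function of \<open>x\<^sup>1\<close>, with \<open>x\<^sup>2\<close> as independent
  variable, and a normalisation turns it into \<open>u'' = \<kappa> u\<close>: near every point, the surface is the model
  \<open>\<Gamma>\<^sub>1\<^sub>2\<^sup>1 = d/2\<close>, \<open>\<Gamma>\<^sub>2\<^sub>2\<^sup>1 = - \<kappa> x\<^sup>1\<close>, \<open>\<Gamma>\<^sub>2\<^sub>2\<^sup>2 = d\<close>, where \<open>d\<^sup>2 = \<alpha> \<epsilon> / 4\<close> and \<open>\<kappa> = d\<^sup>2 / 4 - \<epsilon> = \<epsilon> (\<alpha> - 16) / 16\<close>. Its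
  affine Killing fields are spanned by \<open>\<partial>\<^sub>2\<close>, \<open>x\<^sup>1 \<partial>\<^sub>1\<close> and the \<open>f(x\<^sup>2) \<partial>\<^sub>1\<close> with \<open>f'' = \<kappa> f\<close>, so that the sign of \<open>\<kappa>\<close> decides
  both the Lie algebra and the existence of Type B coordinates.
\<close>

section \<open>Smooth maps\<close>

text \<open>With \<open>x\<^sup>2\<close> as parameter, the geodesics of the normalised connection
  satisfy \<open>x1'' = - a x1'^2 - p x1' - c\<close> with \<open>p = 2 b - d\<close>. The quadratic
  term disappears for \<open>E = (exp (a x1) - 1) / a\<close>, the constant after subtracting a
  particular solution \<open>h\<close>, and the first order term after multiplication by
  \<open>exp (p x2 / 2)\<close>. What is left is \<open>\<kappa> = p\<^sup>2 / 4 - a c = d\<^sup>2 /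
  4 - \<rho>\<^sub>2\<^sub>2\<close>, so \<open>a\<close>, \<open>b\<close>, \<open>c\<close>
  survive only through the normalised value \<open>\<rho>\<^sub>2\<^sub>2 = \<epsilon>\<close>. The
  number \<open>d\<close> is seen by \<open>\<nabla>\<rho>(X, X; X) = - 2 d \<epsilon>
  (X\<^sup>2)\<^sup>3\<close>, which gives \<open>\<alpha> = 4 d\<^sup>2 \<epsilon>\<close>; its
  sign is fixed by passing from \<open>x\<close> to \<open>- x\<close>. The prescribed point always
  receives coordinates 0. The identity in two such model charts is therefore a local isomorphism
  between any two given points. The definitions quantify over all charts of a maximal atlas and over
  all fields, whereas the computations live in one chart. The bridges are the pointwise law
  \<open>transforms\<close>, the naturality of the Ricci tensor and of the Killing operator, and
  \<open>new_chart\<close>, which makes a coordinate change into a member of the atlas.\<close>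

abbreviation fd :: "('a::real_normed_vector \<Rightarrow> 'b::real_normed_vector) \<Rightarrow> 'a \<Rightarrow> 'a \<Rightarrow> 'b" where
  "fd f x \<equiv> frechet_derivative f (at x)"

lemma fd_eqI: "(f has_derivative f') (at x) \<Longrightarrow> fd f x = f'"
  using frechet_derivative_at by metis

text \<open>Differentiability is not assumed: \<open>frechet_derivative\<close> is a choice among
  the derivatives of a map, and maps that agree near the point have the same ones.\<close>

lemma fd_cong:
  assumes "open S" "x \<in> S" "\<And>y. y \<in> S \<Longrightarrow> f y = g y"
  shows "fd f x = fd g x" and "f differentiable (at x) \<longleftrightarrow> g differentiable (at x)"
proof -
  have *: "(f has_derivative f') (at x) \<longleftrightarrow> (g has_derivative f') (at x)" for f'
    using assms has_derivative_transform_within_open by (metis (no_types, lifting))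
  show "fd f x = fd g x" "f differentiable (at x) \<longleftrightarrow> g differentiable (at x)"
    unfolding frechet_derivative_def differentiable_def by (simp_all add: *)
qed

lemma k_differentiable_cong:
  assumes "open S" "\<And>x. x \<in> S \<Longrightarrow> f x = g x"
  shows "k_differentiable_on k S f \<longleftrightarrow> k_differentiable_on k S g"
  using assms(2)
proof (induction k arbitrary: f g)
  case 0
  then show ?case by (simp cong: continuous_on_cong)
next
  case (Suc k)
  have "fd f x = fd g x" if "x \<in> S" for x
    using fd_cong[OF assms(1) that] Suc.prems by blast
  then have "k_differentiable_on k S (\<lambda>x. fd f x v) \<longleftrightarrow> k_differentiable_on k S (\<lambda>x. fd g x v)" for v
    by (intro Suc.IH) simp
  moreover have "(\<forall>x\<in>S. f differentiable (at x)) \<longleftrightarrow> (\<forall>x\<in>S. g differentiable (at x))"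
    using fd_cong(2)[OF assms(1), of _ f g] Suc.prems by blast
  ultimately show ?case by simp
qed

lemma k_differentiable_subset:
  "k_differentiable_on k S f \<Longrightarrow> T \<subseteq> S \<Longrightarrow> k_differentiable_on k T f"
proof (induction k arbitrary: f)
  case 0
  then show ?case by (auto intro: continuous_on_subset)
qed auto

lemma k_differentiable_Suc_imp:
  "k_differentiable_on (Suc k) S f \<Longrightarrow> k_differentiable_on k S f"
proof (induction k arbitrary: f)
  case 0
  then show ?case
    by (simp add: continuous_at_imp_continuous_on differentiable_imp_continuous_within)
next
  case (Suc k)
  then show ?case by (metis k_differentiable_on.simps(2))
qed

lemma k_differentiable_const: "k_differentiable_on k S (\<lambda>x. c)"
  by (induction k arbitrary: c) simp_all

lemma k_differentiable_linear_compose: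
  assumes "bounded_linear L"
  shows "open S \<Longrightarrow> k_differentiable_on k S f \<Longrightarrow> k_differentiable_on k S (\<lambda>x. L (f x))"
proof (induction k arbitrary: f)
  case 0
  then show ?case using assms by (simp add: bounded_linear.continuous_on)
next
  case (Suc k)
  have d: "((\<lambda>x. L (f x)) has_derivative (\<lambda>v. L (fd f x v))) (at x)" if "x \<in> S" for x
    using Suc.prems that by (intro bounded_linear.has_derivative[OF assms]) (simp flip: frechet_derivative_works)
  have "k_differentiable_on k S (\<lambda>x. L (fd f x v))" for v
    using Suc.prems by (intro Suc.IH) simp_all
  moreover have "fd (\<lambda>x. L (f x)) x v = L (fd f x v)" if "x \<in> S" for x v
    using fd_eqI[OF d[OF that]] by simp
  ultimately have "k_differentiable_on k S (\<lambda>x. fd (\<lambda>x. L (f x)) x v)" for v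
    using k_differentiable_cong[OF \<open>open S\<close>, of "\<lambda>x. fd (\<lambda>x. L (f x)) x v" "\<lambda>x. L (fd f x v)" k] by simp
  then show ?case using d by (auto simp: differentiable_def)
qed

lemma k_differentiable_add:
  assumes S: "open S"
  shows "k_differentiable_on k S f \<Longrightarrow> k_differentiable_on k S g \<Longrightarrow> k_differentiable_on k S (\<lambda>x. f x + g x)"
proof (induction k arbitrary: f g)
  case 0
  then show ?case by (simp add: continuous_on_add)
next
  case (Suc k)
  have d: "((\<lambda>x. f x + g x) has_derivative (\<lambda>v. fd f x v + fd g x v)) (at x)" if "x \<in> S" for x
    using Suc.prems that by (intro has_derivative_add) (simp_all flip: frechet_derivative_works)
  have "k_differentiable_on k S (\<lambda>x. fd f x v + fd g x v)" for v
    using Suc.prems by (intro Suc.IH) simp_all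
  moreover have "fd (\<lambda>x. f x + g x) x v = fd f x v + fd g x v" if "x \<in> S" for x v
    using fd_eqI[OF d[OF that]] by simp
  ultimately have "k_differentiable_on k S (\<lambda>x. fd (\<lambda>x. f x + g x) x v)" for v
    using k_differentiable_cong[OF \<open>open S\<close>, of "\<lambda>x. fd (\<lambda>x. f x + g x) x v" "\<lambda>x. fd f x v + fd g x v" k]
    by simp
  then show ?case using d by (auto simp: differentiable_def)
qed

lemma k_differentiable_bilinear:
  assumes "bounded_bilinear B"
  shows "open S \<Longrightarrow> k_differentiable_on k S f \<Longrightarrow> k_differentiable_on k S g \<Longrightarrow>
     k_differentiable_on k S (\<lambda>x. B (f x) (g x))"
proof (induction k arbitrary: f g)
  case 0
  then show ?case using assms by (simp add: bounded_bilinear.continuous_on)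
next
  case (Suc k)
  have d: "((\<lambda>x. B (f x) (g x)) has_derivative (\<lambda>v. B (f x) (fd g x v) + B (fd f x v) (g x))) (at x)"
    if "x \<in> S" for x
    using Suc.prems that by (intro bounded_bilinear.FDERIV[OF assms]) (simp_all flip: frechet_derivative_works)
  have "k_differentiable_on k S (\<lambda>x. B (f x) (fd g x v) + B (fd f x v) (g x))" for v
    using Suc.prems k_differentiable_Suc_imp[OF Suc.prems(2)] k_differentiable_Suc_imp[OF Suc.prems(3)]
    by (intro k_differentiable_add Suc.IH) simp_all
  moreover have "fd (\<lambda>x. B (f x) (g x)) x v = B (f x) (fd g x v) + B (fd f x v) (g x)" if "x \<in> S" for x v
    using fd_eqI[OF d[OF that]] by simp
  ultimately have "k_differentiable_on k S (\<lambda>x. fd (\<lambda>x. B (f x) (g x)) x v)" for v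
    using k_differentiable_cong[OF \<open>open S\<close>, of "\<lambda>x. fd (\<lambda>x. B (f x) (g x)) x v"
      "\<lambda>x. B (f x) (fd g x v) + B (fd f x v) (g x)" k] by simp
  then show ?case using d by (auto simp: differentiable_def)
qed

lemma k_differentiable_sum:
  assumes "open S" "\<And>i. i \<in> I \<Longrightarrow> k_differentiable_on k S (f i)"
  shows "k_differentiable_on k S (\<lambda>x. \<Sum>i\<in>I. f i x)"
  using assms(2) by (induction I rule: infinite_finite_induct)
    (simp_all add: k_differentiable_const k_differentiable_add[OF assms(1)])

lemma linear_sum_Basis:
  fixes L :: "'a::euclidean_space \<Rightarrow> 'b::real_vector"
  assumes "linear L"
  shows "L v = (\<Sum>b\<in>Basis. (v \<bullet> b) *\<^sub>R L b)"
proof -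
  have "L v = L (\<Sum>b\<in>Basis. (v \<bullet> b) *\<^sub>R b)" by (simp add: euclidean_representation)
  also have "\<dots> = (\<Sum>b\<in>Basis. (v \<bullet> b) *\<^sub>R L b)"
    by (simp add: linear_sum[OF assms] linear_cmul[OF assms])
  finally show ?thesis .
qed

text \<open>The chain rule produces \<open>fd g (f x)\<close> in a direction that varies with
  \<open>x\<close>, while the induction hypothesis speaks of fixed directions. Expanding the
  direction in the basis of the intermediate space separates the two, which is why that space is
  Euclidean.\<close>

lemma k_differentiable_compose:
  fixes f :: "'a::real_normed_vector \<Rightarrow> 'b::euclidean_space" and g :: "'b \<Rightarrow> 'c::real_normed_vector"
  assumes S: "open S" and T: "open T"
  shows "k_differentiable_on k S f \<Longrightarrow> k_differentiable_on k T g \<Longrightarrow> f ` S \<subseteq> T \<Longrightarrow>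
     k_differentiable_on k S (\<lambda>x. g (f x))"
proof (induction k arbitrary: g)
  case 0
  then show ?case using continuous_on_compose2 by auto
next
  case (Suc k)
  have d: "((\<lambda>x. g (f x)) has_derivative (\<lambda>v. fd g (f x) (fd f x v))) (at x)" if "x \<in> S" for x
    using Suc.prems that by (rule_tac has_derivative_compose[of f]) (auto simp flip: frechet_derivative_works)
  have "k_differentiable_on k S (\<lambda>x. \<Sum>b\<in>Basis. (fd f x v \<bullet> b) *\<^sub>R fd g (f x) b)" for v
  proof (intro k_differentiable_sum S k_differentiable_bilinear[OF bounded_bilinear_scaleR S])
    fix b :: 'b
    show "k_differentiable_on k S (\<lambda>x. fd f x v \<bullet> b)"
      using Suc.prems by (intro k_differentiable_linear_compose[OF bounded_linear_inner_left S]) simp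
    show "k_differentiable_on k S (\<lambda>x. fd g (f x) b)"
      using Suc.prems k_differentiable_Suc_imp[OF Suc.prems(1)] by (rule_tac Suc.IH) simp_all
  qed
  moreover have "fd (\<lambda>x. g (f x)) x v = (\<Sum>b\<in>Basis. (fd f x v \<bullet> b) *\<^sub>R fd g (f x) b)" if "x \<in> S" for x v
  proof -
    have "linear (fd g (f x))" using Suc.prems that by (auto intro!: linear_frechet_derivative)
    from linear_sum_Basis[OF this, of "fd f x v"] show ?thesis by (simp only: fd_eqI[OF d[OF that]])
  qed
  ultimately have "k_differentiable_on k S (\<lambda>x. fd (\<lambda>x. g (f x)) x v)" for v
    using k_differentiable_cong[OF S, of "\<lambda>x. fd (\<lambda>x. g (f x)) x v"
       "\<lambda>x. \<Sum>b\<in>Basis. (fd f x v \<bullet> b) *\<^sub>R fd g (f x) b" k] by simp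
  then show ?case using d by (auto simp: differentiable_def)
qed

lemma smooth_cong:
  "open S \<Longrightarrow> (\<And>x. x \<in> S \<Longrightarrow> f x = g x) \<Longrightarrow> smooth_on S f \<longleftrightarrow> smooth_on S g"
  unfolding smooth_on_def using k_differentiable_cong by blast

lemma smooth_subset: "smooth_on S f \<Longrightarrow> T \<subseteq> S \<Longrightarrow> smooth_on T f"
  unfolding smooth_on_def using k_differentiable_subset by blast

lemma smooth_const: "smooth_on S (\<lambda>x. c)"
  by (simp add: smooth_on_def k_differentiable_const)

lemma smooth_ident: "smooth_on S (\<lambda>x. x)"
  unfolding smooth_on_def
proof
  fix k show "k_differentiable_on k S (\<lambda>x. x)"
    by (cases k) (simp_all add: k_differentiable_const)
qed

lemma smooth_linear_compose:
  "bounded_linear L \<Longrightarrow> open S \<Longrightarrow> smooth_on S f \<Longrightarrow> smooth_on S (\<lambda>x. L (f x))"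
  by (simp add: smooth_on_def k_differentiable_linear_compose)

lemma smooth_bilinear:
  "bounded_bilinear B \<Longrightarrow> open S \<Longrightarrow> smooth_on S f \<Longrightarrow> smooth_on S g \<Longrightarrow> smooth_on S (\<lambda>x. B (f x) (g x))"
  by (simp add: smooth_on_def k_differentiable_bilinear)

lemma smooth_add:
  "open S \<Longrightarrow> smooth_on S f \<Longrightarrow> smooth_on S g \<Longrightarrow> smooth_on S (\<lambda>x. f x + g x)"
  by (simp add: smooth_on_def k_differentiable_add)

lemma smooth_sum:
  "open S \<Longrightarrow> (\<And>i. i \<in> I \<Longrightarrow> smooth_on S (f i)) \<Longrightarrow> smooth_on S (\<lambda>x. \<Sum>i\<in>I. f i x)"
  by (simp add: smooth_on_def k_differentiable_sum)

lemma smooth_compose: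
  fixes f :: "'a::real_normed_vector \<Rightarrow> 'b::euclidean_space"
  shows "open S \<Longrightarrow> open T \<Longrightarrow> smooth_on S f \<Longrightarrow> smooth_on T g \<Longrightarrow> f ` S \<subseteq> T \<Longrightarrow> smooth_on S (\<lambda>x. g (f x))"
  unfolding smooth_on_def using k_differentiable_compose by metis

lemmas smooth_scaleR = smooth_bilinear[OF bounded_bilinear_scaleR]
lemmas smooth_mult = smooth_bilinear[OF bounded_bilinear_mult]
lemmas smooth_minus = smooth_linear_compose[OF bounded_linear_minus[OF bounded_linear_ident]]
lemmas smooth_vec_nth = smooth_linear_compose[OF bounded_linear_vec_nth]

lemma smooth_diff:
  "open S \<Longrightarrow> smooth_on S f \<Longrightarrow> smooth_on S g \<Longrightarrow> smooth_on S (\<lambda>x. f x - g x)"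
  using smooth_add[of S f "\<lambda>x. - g x"] smooth_minus[of S g] by simp

lemma smooth_differentiable: "smooth_on S f \<Longrightarrow> x \<in> S \<Longrightarrow> f differentiable (at x)"
  unfolding smooth_on_def by (metis k_differentiable_on.simps(2))

lemma smooth_has_derivative: "smooth_on S f \<Longrightarrow> x \<in> S \<Longrightarrow> (f has_derivative fd f x) (at x)"
  using smooth_differentiable frechet_derivative_works by blast

lemma smooth_fd: "smooth_on S f \<Longrightarrow> smooth_on S (\<lambda>x. fd f x v)"
  unfolding smooth_on_def by (metis k_differentiable_on.simps(2))

lemma smooth_continuous: "smooth_on S f \<Longrightarrow> continuous_on S f"
  unfolding smooth_on_def by (metis k_differentiable_on.simps(1))

lemma smooth_linear: "smooth_on S f \<Longrightarrow> x \<in> S \<Longrightarrow> linear (fd f x)"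
  using smooth_differentiable linear_frechet_derivative by blast

lemma fd_smooth_compose:
  fixes f :: "'a::real_normed_vector \<Rightarrow> 'b::real_normed_vector"
  assumes "smooth_on S f" "smooth_on T g" "x \<in> S" "f x \<in> T"
  shows "fd (\<lambda>x. g (f x)) x v = fd g (f x) (fd f x v)"
  by (rule fun_cong[OF fd_eqI], rule has_derivative_compose[of f])
     (use assms smooth_has_derivative in auto)

section \<open>Smoothness of functions of one variable by induction along ordinary
  derivatives\<close>

lemma smooth_real_field_derivative:
  fixes f :: "real \<Rightarrow> real"
  assumes "open T" "\<And>x. x \<in> T \<Longrightarrow> (f has_real_derivative f' x) (at x)"
  shows "k_differentiable_on (Suc k) T f \<longleftrightarrow> k_differentiable_on k T f'"
proof -
  have d: "(f has_derivative (\<lambda>v. f' x * v)) (at x)" if "x \<in> T" for x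
    using assms(2)[OF that] by (simp add: has_field_derivative_def)
  have "k_differentiable_on k T (\<lambda>x. fd f x v) \<longleftrightarrow> k_differentiable_on k T (\<lambda>x. f' x * v)" for v
    using fd_eqI[OF d] by (intro k_differentiable_cong assms) simp
  moreover have "k_differentiable_on k T (\<lambda>x. f' x * v)" if "k_differentiable_on k T f'" for v
    using k_differentiable_bilinear[OF bounded_bilinear_mult assms(1) that k_differentiable_const] .
  moreover have "k_differentiable_on k T f'" if "\<And>v. k_differentiable_on k T (\<lambda>x. f' x * v)"
    using that[of 1] by simp
  ultimately show ?thesis using d by (auto simp: differentiable_def)
qed

lemma smooth_exp: "smooth_on T (exp :: real \<Rightarrow> real)"
proof -
  have "k_differentiable_on k UNIV (exp :: real \<Rightarrow> real)" for k
  proof (induction k)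
    case (Suc k)
    then show ?case
      by (subst smooth_real_field_derivative[where f' = exp]) (auto intro: DERIV_exp)
  qed (simp add: continuous_on_exp)
  then show ?thesis using smooth_subset[of UNIV] by (auto simp: smooth_on_def)
qed

lemma smooth_inverse: "smooth_on (- {0}) (inverse :: real \<Rightarrow> real)"
proof -
  have "k_differentiable_on k (- {0}) (inverse :: real \<Rightarrow> real)" for k
  proof (induction k)
    case 0
    show ?case by (auto intro!: continuous_intros)
  next
    case (Suc k)
    have "k_differentiable_on k (- {0}) (\<lambda>x::real. (- 1) * (inverse x * inverse x))"
      by (intro k_differentiable_bilinear[OF bounded_bilinear_mult] k_differentiable_const Suc) auto
    then show ?case
      by (subst smooth_real_field_derivative[where f' = "\<lambda>x. (- 1) * (inverse x * inverse x)"])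
         (auto intro!: derivative_eq_intros)
  qed
  then show ?thesis by (simp add: smooth_on_def)
qed

lemma smooth_ln: "smooth_on {0<..} (ln :: real \<Rightarrow> real)"
proof -
  have *: "k_differentiable_on k {0<..} (inverse :: real \<Rightarrow> real)" for k
    using smooth_inverse k_differentiable_subset[of k "-{0}" inverse "{0<..}"] by (auto simp: smooth_on_def)
  have "k_differentiable_on (Suc k) {0<..} (ln :: real \<Rightarrow> real)" for k
    by (subst smooth_real_field_derivative[where f' = inverse])
       (auto simp: * intro!: derivative_eq_intros simp flip: inverse_eq_divide)
  then show ?thesis unfolding smooth_on_def using k_differentiable_Suc_imp by blast
qed

text \<open>Up to the factor \<open>\<kappa>\<close> each function is the derivative of the other,
  so their orders of differentiability rise together.\<close>

lemma smooth_oscillator: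
  fixes C S :: "real \<Rightarrow> real"
  assumes "\<And>y. (C has_real_derivative \<kappa> * S y) (at y)" "\<And>y. (S has_real_derivative C y) (at y)"
  shows "smooth_on UNIV C" "smooth_on UNIV S"
proof -
  have "k_differentiable_on k UNIV C \<and> k_differentiable_on k UNIV S" for k
  proof (induction k)
    case 0
    show ?case using assms by (auto intro!: continuous_at_imp_continuous_on DERIV_isCont)
  next
    case (Suc k)
    have "k_differentiable_on k UNIV (\<lambda>y. \<kappa> * S y)"
      using Suc by (intro k_differentiable_bilinear[OF bounded_bilinear_mult] k_differentiable_const) auto
    then show ?case
      using smooth_real_field_derivative[OF open_UNIV, of C "\<lambda>y. \<kappa> * S y" k]
        smooth_real_field_derivative[OF open_UNIV, of S C k] assms Suc by blast
  qed
  then show "smooth_on UNIV C" "smooth_on UNIV S" by (auto simp: smooth_on_def)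
qed

text \<open>Mixed derivatives agree because both are limits of the same second difference quotient.\<close>

lemma second_difference_mvt:
  fixes f :: "'a::real_normed_vector \<Rightarrow> real"
  assumes sm: "smooth_on S f" and h: "h > 0"
    and S: "\<And>s t. 0 \<le> s \<Longrightarrow> s \<le> h \<Longrightarrow> 0 \<le> t \<Longrightarrow> t \<le> h \<Longrightarrow> x + s *\<^sub>R u + t *\<^sub>R v \<in> S"
  shows "\<exists>s t. 0 < s \<and> s < h \<and> 0 < t \<and> t < h \<and>
    f (x + h *\<^sub>R u + h *\<^sub>R v) - f (x + h *\<^sub>R u) - f (x + h *\<^sub>R v) + f x =
    h * (h * fd (\<lambda>y. fd f y u) (x + s *\<^sub>R u + t *\<^sub>R v) v)"
proof -
  let ?p = "\<lambda>s. f (x + s *\<^sub>R u + h *\<^sub>R v) - f (x + s *\<^sub>R u)"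
  have line: "((\<lambda>s. g (z + s *\<^sub>R w)) has_real_derivative fd g (z + s *\<^sub>R w) w) (at s)"
    if "smooth_on S g" "z + s *\<^sub>R w \<in> S" for g :: "'a \<Rightarrow> real" and z w s
  proof -
    have "((\<lambda>s. g (z + s *\<^sub>R w)) has_derivative (\<lambda>r. fd g (z + s *\<^sub>R w) (r *\<^sub>R w))) (at s)"
      by (rule has_derivative_compose[of "\<lambda>s. z + s *\<^sub>R w"])
         (auto intro!: derivative_eq_intros smooth_has_derivative that)
    then show ?thesis
      using linear_cmul[OF smooth_linear[OF that]]
      by (simp add: has_field_derivative_def mult_commute_abs)
  qed
  have dp: "(?p has_real_derivative fd f (x + s *\<^sub>R u + h *\<^sub>R v) u - fd f (x + s *\<^sub>R u) u) (at s)"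
    if "0 \<le> s" "s \<le> h" for s
  proof (rule DERIV_diff)
    show "((\<lambda>s. f (x + s *\<^sub>R u + h *\<^sub>R v)) has_real_derivative fd f (x + s *\<^sub>R u + h *\<^sub>R v) u) (at s)"
      using line[OF sm, of "x + h *\<^sub>R v" s u] S[of s h] that h by (simp add: add_ac)
    show "((\<lambda>s. f (x + s *\<^sub>R u)) has_real_derivative fd f (x + s *\<^sub>R u) u) (at s)"
      using line[OF sm, of "x" s u] S[of s 0] that h by simp
  qed
  from MVT2[OF h dp] obtain s where s: "0 < s" "s < h"
    "?p h - ?p 0 = (h - 0) * (fd f (x + s *\<^sub>R u + h *\<^sub>R v) u - fd f (x + s *\<^sub>R u) u)"
    by blast
  have dq: "((\<lambda>t. fd f (x + s *\<^sub>R u + t *\<^sub>R v) u) has_real_derivative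
     fd (\<lambda>y. fd f y u) (x + s *\<^sub>R u + t *\<^sub>R v) v) (at t)" if "0 \<le> t" "t \<le> h" for t
    using line[OF smooth_fd[OF sm], of "x + s *\<^sub>R u" t v u] S[of s t] that s by simp
  from MVT2[OF h dq] obtain t where t: "0 < t" "t < h"
    "fd f (x + s *\<^sub>R u + h *\<^sub>R v) u - fd f (x + s *\<^sub>R u + 0 *\<^sub>R v) u =
       (h - 0) * fd (\<lambda>y. fd f y u) (x + s *\<^sub>R u + t *\<^sub>R v) v"
    by blast
  show ?thesis
    by (rule exI[of _ s], rule exI[of _ t]) (use s t in simp)
qed

lemma fd_commute_real:
  fixes f :: "'a::real_normed_vector \<Rightarrow> real"
  assumes S: "open S" and sm: "smooth_on S f" and x: "x \<in> S"
  shows "fd (\<lambda>y. fd f y u) x v = fd (\<lambda>y. fd f y v) x u"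
proof -
  let ?A = "\<lambda>y. fd (\<lambda>y. fd f y u) y v" and ?B = "\<lambda>y. fd (\<lambda>y. fd f y v) y u"
  have cont: "isCont (\<lambda>y. fd (\<lambda>y. fd f y a) y b) x" for a b
    using smooth_continuous[OF smooth_fd[OF smooth_fd[OF sm]]] x by (simp add: continuous_on_eq_continuous_at[OF S])
  have close: "\<bar>?A x - ?B x\<bar> < e + e" if "e > 0" for e
  proof -
    from cont[of u v] that obtain d1 where d1: "d1 > 0" "\<And>y. dist y x < d1 \<Longrightarrow> dist (?A y) (?A x) < e"
      unfolding continuous_at_eps_delta by metis
    from cont[of v u] that obtain d2 where d2: "d2 > 0" "\<And>y. dist y x < d2 \<Longrightarrow> dist (?B y) (?B x) < e"
      unfolding continuous_at_eps_delta by metis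
    note d = d1(1) d2(1) d1(2) d2(2)
    obtain d3 where d3: "d3 > 0" "\<And>y. dist y x < d3 \<Longrightarrow> y \<in> S"
      using S x open_dist by blast
    define r where "r = min d1 (min d2 d3)"
    \<comment> \<open>Every \<open>x + s u + t v\<close> with \<open>s, t \<le> h\<close> then stays
      within \<open>r\<close> of \<open>x\<close>; the summand 1 keeps the denominator
      positive.\<close>
    define h where "h = r / (2 * (norm u + norm v + 1))"
    have n: "norm u + norm v + 1 > 0" by (simp add: add_nonneg_pos)
    have r: "r > 0" using d d3 by (simp add: r_def)
    then have h: "h > 0" unfolding h_def using n by (intro divide_pos_pos) auto
    have near: "dist (x + s *\<^sub>R a + t *\<^sub>R b) x < r"
      if "0 \<le> s" "s \<le> h" "0 \<le> t" "t \<le> h" "norm a + norm b = norm u + norm v" for s t a b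
    proof -
      have "dist (x + s *\<^sub>R a + t *\<^sub>R b) x \<le> s * norm a + t * norm b"
        using norm_triangle_ineq[of "s *\<^sub>R a" "t *\<^sub>R b"] that by (simp add: dist_norm algebra_simps)
      also have "\<dots> \<le> h * norm a + h * norm b"
        using that by (intro add_mono mult_right_mono) auto
      also have "\<dots> = h * (norm u + norm v)" using that(5) by (metis distrib_left)
      also have "\<dots> < h * (2 * (norm u + norm v + 1))"
        using h by (intro mult_strict_left_mono) (simp_all add: add_nonneg_pos)
      also have "\<dots> = r" unfolding h_def using n by simp
      finally show ?thesis .
    qed
    have inS: "x + s *\<^sub>R a + t *\<^sub>R b \<in> S"
      if "0 \<le> s" "s \<le> h" "0 \<le> t" "t \<le> h" "norm a + norm b = norm u + norm v" for s t a b
      using near[OF that] d3(2) by (simp add: r_def)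
    have "\<exists>s t. 0 < s \<and> s < h \<and> 0 < t \<and> t < h \<and>
        f (x + h *\<^sub>R u + h *\<^sub>R v) - f (x + h *\<^sub>R u) - f (x + h *\<^sub>R v) + f x =
        h * (h * ?A (x + s *\<^sub>R u + t *\<^sub>R v))"
      by (rule second_difference_mvt[OF sm h]) (rule inS, simp_all)
    then obtain s t where 1: "0 < s" "s < h" "0 < t" "t < h"
      "f (x + h *\<^sub>R u + h *\<^sub>R v) - f (x + h *\<^sub>R u) - f (x + h *\<^sub>R v) + f x =
        h * (h * ?A (x + s *\<^sub>R u + t *\<^sub>R v))"
      by blast
    have "\<exists>s t. 0 < s \<and> s < h \<and> 0 < t \<and> t < h \<and>
        f (x + h *\<^sub>R v + h *\<^sub>R u) - f (x + h *\<^sub>R v) - f (x + h *\<^sub>R u) + f x =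
        h * (h * ?B (x + s *\<^sub>R v + t *\<^sub>R u))"
      by (rule second_difference_mvt[OF sm h]) (rule inS, simp_all add: add.commute)
    then obtain s' t' where 2: "0 < s'" "s' < h" "0 < t'" "t' < h"
      "f (x + h *\<^sub>R v + h *\<^sub>R u) - f (x + h *\<^sub>R v) - f (x + h *\<^sub>R u) + f x =
        h * (h * ?B (x + s' *\<^sub>R v + t' *\<^sub>R u))"
      by blast
    have "f (x + h *\<^sub>R v + h *\<^sub>R u) = f (x + h *\<^sub>R u + h *\<^sub>R v)" by (simp add: add_ac)
    then have "h * (h * ?A (x + s *\<^sub>R u + t *\<^sub>R v)) = h * (h * ?B (x + s' *\<^sub>R v + t' *\<^sub>R u))"
      using 1(5) 2(5) by linarith
    then have eq: "?A (x + s *\<^sub>R u + t *\<^sub>R v) = ?B (x + s' *\<^sub>R v + t' *\<^sub>R u)"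
      using h by simp
    have "dist (?A (x + s *\<^sub>R u + t *\<^sub>R v)) (?A x) < e"
      using near[of s t u v] 1 d(3) by (simp add: r_def)
    moreover have "dist (?B (x + s' *\<^sub>R v + t' *\<^sub>R u)) (?B x) < e"
      using near[of s' t' v u] 2 d(4) by (simp add: r_def)
    ultimately show ?thesis using eq by (simp add: dist_real_def)
  qed
  show ?thesis
  proof (rule ccontr)
    assume "?A x \<noteq> ?B x"
    then show False using close[of "\<bar>?A x - ?B x\<bar> / 2"] by simp
  qed
qed

lemma fd_commute:
  fixes f :: "'a::real_normed_vector \<Rightarrow> 'b::euclidean_space"
  assumes S: "open S" and sm: "smooth_on S f" and x: "x \<in> S"
  shows "fd (\<lambda>y. fd f y u) x v = fd (\<lambda>y. fd f y v) x u"
proof (rule euclidean_eqI)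
  fix b :: 'b
  have inner: "fd (\<lambda>y. g y \<bullet> b) y w = fd g y w \<bullet> b" if "smooth_on S g" "y \<in> S" for g :: "'a \<Rightarrow> 'b" and y w
    by (rule fun_cong[OF fd_eqI], rule bounded_linear.has_derivative[OF bounded_linear_inner_left])
       (rule smooth_has_derivative[OF that])
  have "fd (\<lambda>y. fd f y w) x w' \<bullet> b = fd (\<lambda>y. fd (\<lambda>z. f z \<bullet> b) y w) x w'" for w w'
    using inner[OF smooth_fd[OF sm] x] fd_cong(1)[OF S x, of "\<lambda>y. fd (\<lambda>z. f z \<bullet> b) y w" "\<lambda>y. fd f y w \<bullet> b"]
      inner[OF sm] by simp
  then show "fd (\<lambda>y. fd f y u) x v \<bullet> b = fd (\<lambda>y. fd f y v) x u \<bullet> b"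
    using fd_commute_real[OF S smooth_linear_compose[OF bounded_linear_inner_left S sm] x] by simp
qed

section \<open>Connections and diffeomorphisms of plane domains\<close>

abbreviation fd2 :: "('a::real_normed_vector \<Rightarrow> 'b::real_normed_vector) \<Rightarrow> 'a \<Rightarrow> 'a \<Rightarrow> 'a \<Rightarrow> 'b" where
  "fd2 f x u v \<equiv> fd (\<lambda>y. fd f y v) x u"

lemma fd_scaled_sum:
  fixes f :: "'a::euclidean_space \<Rightarrow> 'b::real_normed_vector"
  assumes "smooth_on V f" "x \<in> V"
  shows "fd f x v = (\<Sum>b\<in>Basis. (v \<bullet> b) *\<^sub>R fd f x b)"
  by (rule linear_sum_Basis) (rule smooth_linear[OF assms])

text \<open>Smoothness gives the differentiability of \<open>fd r\<close> only in each fixed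
  direction, not as an operator-valued map. The moving direction \<open>Y y\<close> is therefore
  expanded in the basis, differentiated by the product rule, and reassembled with the linearity of
  \<open>fd2\<close> in its last argument.\<close>

lemma has_derivative_fd_along:
  fixes r :: "'b::euclidean_space \<Rightarrow> 'c::real_normed_vector" and t :: "'a::real_normed_vector \<Rightarrow> 'b"
  assumes V: "open V" "smooth_on V t" "x \<in> V" and W: "open W" "smooth_on W r" "t ` V \<subseteq> W"
    and Y: "(Y has_derivative Y') (at x)"
  shows "((\<lambda>y. fd r (t y) (Y y)) has_derivative
    (\<lambda>h. fd2 r (t x) (fd t x h) (Y x) + fd r (t x) (Y' h))) (at x)"
proof -
  have tx: "t x \<in> W" using V W by auto
  have c: "((\<lambda>y. fd r (t y) b) has_derivative (\<lambda>h. fd2 r (t x) (fd t x h) b)) (at x)" for b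
    by (rule has_derivative_compose[of t])
       (auto intro!: smooth_has_derivative[OF V(2,3)] smooth_has_derivative[OF smooth_fd[OF W(2)] tx])
  have s: "((\<lambda>y. \<Sum>b\<in>Basis. (y \<bullet> b) *\<^sub>R g b) has_derivative (\<lambda>h. \<Sum>b\<in>Basis. (h \<bullet> b) *\<^sub>R g b)) (at z)"
    for g :: "'b \<Rightarrow> 'c" and z :: 'b
    by (auto intro!: derivative_eq_intros)
  have fd2: "fd2 r (t x) k v = (\<Sum>b\<in>Basis. (v \<bullet> b) *\<^sub>R fd2 r (t x) k b)" for k v
  proof -
    have "((\<lambda>z. \<Sum>b\<in>Basis. (v \<bullet> b) *\<^sub>R fd r z b) has_derivative
        (\<lambda>k. \<Sum>b\<in>Basis. (v \<bullet> b) *\<^sub>R fd2 r (t x) k b)) (at (t x))"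
      by (intro has_derivative_sum has_derivative_scaleR_right smooth_has_derivative[OF smooth_fd[OF W(2)] tx])
    then have "((\<lambda>z. fd r z v) has_derivative (\<lambda>k. \<Sum>b\<in>Basis. (v \<bullet> b) *\<^sub>R fd2 r (t x) k b)) (at (t x))"
      by (rule has_derivative_transform_within_open[OF _ W(1) tx]) (rule fd_scaled_sum[OF W(2), symmetric])
    from fd_eqI[OF this] show ?thesis by simp
  qed
  have "((\<lambda>y. \<Sum>b\<in>Basis. (Y y \<bullet> b) *\<^sub>R fd r (t y) b) has_derivative
    (\<lambda>h. \<Sum>b\<in>Basis. (Y x \<bullet> b) *\<^sub>R fd2 r (t x) (fd t x h) b + (Y' h \<bullet> b) *\<^sub>R fd r (t x) b)) (at x)"
    by (intro has_derivative_sum has_derivative_scaleR has_derivative_inner_left Y c)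
  then have "((\<lambda>y. fd r (t y) (Y y)) has_derivative
    (\<lambda>h. \<Sum>b\<in>Basis. (Y x \<bullet> b) *\<^sub>R fd2 r (t x) (fd t x h) b + (Y' h \<bullet> b) *\<^sub>R fd r (t x) b)) (at x)"
    by (rule has_derivative_transform_within_open[OF _ V(1,3)])
       (rule fd_scaled_sum[OF W(2), symmetric], use W(3) in auto)
  moreover have "(\<Sum>b\<in>Basis. (Y x \<bullet> b) *\<^sub>R fd2 r (t x) (fd t x h) b + (Y' h \<bullet> b) *\<^sub>R fd r (t x) b) =
      fd2 r (t x) (fd t x h) (Y x) + fd r (t x) (Y' h)" for h
    by (simp only: sum.distrib fd2[symmetric] fd_scaled_sum[OF W(2) tx, symmetric])
  ultimately show ?thesis by simp
qed

lemma has_derivative_fd_along_ident: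
  fixes f :: "'a::euclidean_space \<Rightarrow> 'b::real_normed_vector"
  assumes "open V" "smooth_on V f" "x \<in> V" "(Y has_derivative Y') (at x)"
  shows "((\<lambda>y. fd f y (Y y)) has_derivative (\<lambda>h. fd2 f x h (Y x) + fd f x (Y' h))) (at x)"
  using has_derivative_fd_along[OF assms(1) smooth_ident assms(3) assms(1,2) _ assms(4)] by simp

lemma smooth_fd_along:
  fixes r :: "'b::euclidean_space \<Rightarrow> 'c::real_normed_vector" and t :: "'a::real_normed_vector \<Rightarrow> 'b"
  assumes "open V" "smooth_on V t" "open W" "smooth_on W r" "t ` V \<subseteq> W" "smooth_on V Y"
  shows "smooth_on V (\<lambda>y. fd r (t y) (Y y))"
proof -
  have "smooth_on V (\<lambda>y. \<Sum>b\<in>Basis. (Y y \<bullet> b) *\<^sub>R fd r (t y) b)"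
    by (rule smooth_sum[OF assms(1)], rule smooth_scaleR[OF assms(1)],
        rule smooth_linear_compose[OF bounded_linear_inner_left assms(1,6)],
        rule smooth_compose[OF assms(1,3,2) smooth_fd[OF assms(4)] assms(5)])
  then show ?thesis
    by (subst smooth_cong[OF assms(1)]) (rule fd_scaled_sum[OF assms(4)], use assms(5) in auto)
qed

lemma smooth_fd_along_ident:
  fixes f :: "'a::euclidean_space \<Rightarrow> 'b::real_normed_vector"
  assumes "open V" "smooth_on V f" "smooth_on V Y"
  shows "smooth_on V (\<lambda>y. fd f y (Y y))"
  using smooth_fd_along[OF assms(1) smooth_ident assms(1,2) _ assms(3)] by simp

definition christ :: "real^2^2^2 \<Rightarrow> real^2 \<Rightarrow> real^2 \<Rightarrow> real^2" where
  "christ A u v = (\<Sum>i\<in>UNIV. \<Sum>j\<in>UNIV. (u $ i * v $ j) *\<^sub>R (A $ i $ j))"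

lemma covd_christ: "covd G X Y x = fd Y x (X x) + christ (G x) (X x) (Y x)"
  by (simp add: covd_def christ_def)

lemma christ_simps:
  "christ (A + B) u v = christ A u v + christ B u v"
  "christ A (u + w) v = christ A u v + christ A w v"
  "christ A u (v + w) = christ A u v + christ A u w"
  "christ (A - B) u v = christ A u v - christ B u v"
  "christ A (u - w) v = christ A u v - christ A w v"
  "christ A u (v - w) = christ A u v - christ A u w"
  "christ A (- u) v = - christ A u v"
  "christ A u (- v) = - christ A u v"
  "christ 0 u v = 0" "christ A 0 v = 0" "christ A u 0 = 0"
  "christ (r *\<^sub>R A) u v = r *\<^sub>R christ A u v"
  "christ A (r *\<^sub>R u) v = r *\<^sub>R christ A u v"
  "christ A u (r *\<^sub>R v) = r *\<^sub>R christ A u v"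
  by (simp_all add: christ_def sum_2 vec_eq_iff algebra_simps)

lemma christ_axis: "christ A (axis i 1) (axis j 1) = A $ i $ j"
  using exhaust_2[of i] exhaust_2[of j] by (auto simp: christ_def sum_2 axis_def)

lemma has_derivative_christ:
  assumes "(G has_derivative G') (at x)" "(Y has_derivative Y') (at x)" "(Z has_derivative Z') (at x)"
  shows "((\<lambda>x. christ (G x) (Y x) (Z x)) has_derivative
    (\<lambda>h. christ (G' h) (Y x) (Z x) + christ (G x) (Y' h) (Z x) + christ (G x) (Y x) (Z' h))) (at x)"
proof -
  have n: "((\<lambda>x. f x $ i) has_derivative (\<lambda>h. f' h $ i)) (at x)" if "(f has_derivative f') (at x)"
    for f f' :: "_ \<Rightarrow> 'c::euclidean_space^2" and i
    using that by (rule bounded_linear.has_derivative[OF bounded_linear_vec_nth])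
  have n1: "((\<lambda>x. f x $ i) has_derivative (\<lambda>h. f' h $ i)) (at x)" if "(f has_derivative f') (at x)"
    for f f' :: "_ \<Rightarrow> real^2" and i
    using that by (rule bounded_linear.has_derivative[OF bounded_linear_vec_nth])
  have "((\<lambda>x. christ (G x) (Y x) (Z x)) has_derivative
    (\<lambda>h. \<Sum>i\<in>UNIV. \<Sum>j\<in>UNIV. (Y x $ i * Z x $ j) *\<^sub>R (G' h $ i $ j) +
       (Y x $ i * Z' h $ j + Y' h $ i * Z x $ j) *\<^sub>R (G x $ i $ j))) (at x)"
    unfolding christ_def
    by (intro has_derivative_sum has_derivative_scaleR has_derivative_mult n n1 assms)
  then show ?thesis
    by (rule has_derivative_eq_rhs) (simp add: christ_def fun_eq_iff sum.distrib scaleR_add_left algebra_simps)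
qed

lemma smooth_christ:
  assumes V: "open V" and "smooth_on V G" "smooth_on V Y" "smooth_on V Z"
  shows "smooth_on V (\<lambda>x. christ (G x) (Y x) (Z x))"
  unfolding christ_def
  by (intro smooth_sum smooth_scaleR smooth_mult smooth_vec_nth assms)

lemma smooth_covd:
  assumes "open V" "smooth_on V G" "smooth_on V X" "smooth_on V Y"
  shows "smooth_on V (covd G X Y)"
  unfolding covd_christ[abs_def]
  by (intro smooth_add smooth_christ smooth_fd_along_ident assms)

lemma smooth_vf_bracket:
  assumes "open V" "smooth_on V X" "smooth_on V Y"
  shows "smooth_on V (vf_bracket X Y)"
  unfolding vf_bracket_def[abs_def]
  by (intro smooth_diff smooth_fd_along_ident assms)

definition sym_on :: "(real^2) set \<Rightarrow> christoffel2 \<Rightarrow> bool" where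
  "sym_on V G \<longleftrightarrow> (\<forall>x\<in>V. \<forall>u v. christ (G x) u v = christ (G x) v u)"

text \<open>On fields with constant components the bracket and the derivative terms vanish, and the
  torsion is the antisymmetric part of the Christoffel symbols.\<close>

lemma torsion_free_sym: "torsion_free_on V G \<Longrightarrow> sym_on V G"
  unfolding torsion_free_on_def sym_on_def
proof safe
  fix x u v
  assume *: "\<forall>X Y. smooth_on V X \<longrightarrow> smooth_on V Y \<longrightarrow>
     (\<forall>x\<in>V. covd G X Y x - covd G Y X x = vf_bracket X Y x)" and "x \<in> V"
  then show "christ (G x) u v = christ (G x) v u"
    using *[rule_format, OF smooth_const[of V u] smooth_const[of V v]]
    by (simp add: covd_christ vf_bracket_def)
qed

section \<open>Diffeomorphisms of plane domains and the transformation law\<close>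

definition pdiff :: "(real^2) set \<Rightarrow> field2 \<Rightarrow> field2 \<Rightarrow> bool" where
  "pdiff V t s \<longleftrightarrow> open V \<and> open (t ` V) \<and> smooth_on V t \<and> smooth_on (t ` V) s \<and> (\<forall>x\<in>V. s (t x) = x)"

lemma pdiffD:
  assumes "pdiff V t s"
  shows "open V" "open (t ` V)" "smooth_on V t" "smooth_on (t ` V) s" "x \<in> V \<Longrightarrow> s (t x) = x"
    "y \<in> t ` V \<Longrightarrow> t (s y) = y" "s ` t ` V = V" "y \<in> t ` V \<Longrightarrow> s y \<in> V"
  using assms by (force simp: pdiff_def)+

lemma pdiff_sym:
  assumes "pdiff V t s"
  shows "pdiff (t ` V) s t"
  unfolding pdiff_def pdiffD(7)[OF assms]
  by (intro conjI ballI pdiffD[OF assms])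

lemma pdiff_fd_inv:
  assumes "pdiff V t s" "x \<in> V"
  shows "fd s (t x) (fd t x v) = v"
proof -
  note p = pdiffD[OF assms(1)]
  have "fd (\<lambda>x. s (t x)) x v = fd s (t x) (fd t x v)"
    by (rule fd_smooth_compose[OF p(3,4)]) (use assms in auto)
  moreover have "fd (\<lambda>x. s (t x)) x = fd (\<lambda>x. x) x"
    by (rule fd_cong(1)[OF p(1) assms(2)]) (rule p(5))
  ultimately show ?thesis by simp
qed

lemma pdiff_fd_inv':
  assumes "pdiff V t s" "y \<in> t ` V"
  shows "fd t (s y) (fd s y w) = w"
  using pdiff_fd_inv[OF pdiff_sym[OF assms(1)] assms(2)] .

definition related :: "(real^2) set \<Rightarrow> field2 \<Rightarrow> field2 \<Rightarrow> field2 \<Rightarrow> bool" where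
  "related V t X X' \<longleftrightarrow> (\<forall>x\<in>V. X' (t x) = fd t x (X x))"

definition push :: "field2 \<Rightarrow> field2 \<Rightarrow> field2 \<Rightarrow> field2" where
  "push t s X y = fd t (s y) (X (s y))"

lemma related_push: "pdiff V t s \<Longrightarrow> related V t X (push t s X)"
  by (simp add: related_def push_def pdiffD(5))

lemma smooth_push:
  assumes "pdiff V t s" "smooth_on V X"
  shows "smooth_on (t ` V) (push t s X)"
proof -
  note p = pdiffD[OF assms(1)]
  have "smooth_on (t ` V) (\<lambda>y. X (s y))"
    by (rule smooth_compose[OF p(2,1,4) assms(2)]) (simp add: p(7))
  then show ?thesis
    unfolding push_def[abs_def] by (intro smooth_fd_along[OF p(2,4,1,3)]) (simp_all add: p(7))
qed

text \<open>This is the derivative of \<open>Y' (t x) = fd t x (Y x)\<close>. The second derivative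
  of \<open>t\<close> is the non-tensorial term: it cancels in brackets and is absorbed by the
  Christoffel symbols in covariant derivatives.\<close>

lemma related_fd:
  assumes p: "pdiff V t s" and Y: "smooth_on V Y" "smooth_on (t ` V) Y'" "related V t Y Y'" and x: "x \<in> V"
  shows "fd Y' (t x) (fd t x h) = fd2 t x h (Y x) + fd t x (fd Y x h)"
proof -
  note p = pdiffD[OF p]
  have "fd Y' (t x) (fd t x h) = fd (\<lambda>x. Y' (t x)) x h"
    by (rule fd_smooth_compose[OF p(3) Y(2) x, symmetric]) (use x in auto)
  also have "\<dots> = fd (\<lambda>x. fd t x (Y x)) x h"
    by (rule fun_cong[OF fd_cong(1)[OF p(1) x]]) (use Y(3) in \<open>simp add: related_def\<close>)
  also have "\<dots> = fd2 t x h (Y x) + fd t x (fd Y x h)"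
    by (rule fun_cong[OF fd_eqI]) (rule has_derivative_fd_along_ident[OF p(1,3) x smooth_has_derivative[OF Y(1) x]])
  finally show ?thesis .
qed

text \<open>The second derivatives of \<open>t\<close> enter the two halves of the bracket
  symmetrically and cancel.\<close>

lemma related_vf_bracket:
  assumes p: "pdiff V t s" and X: "smooth_on V X" "smooth_on (t ` V) X'" "related V t X X'"
    and Y: "smooth_on V Y" "smooth_on (t ` V) Y'" "related V t Y Y'"
  shows "related V t (vf_bracket X Y) (vf_bracket X' Y')"
  unfolding related_def
proof
  fix x assume x: "x \<in> V"
  note pd = pdiffD[OF p]
  have r: "X' (t x) = fd t x (X x)" "Y' (t x) = fd t x (Y x)" using X(3) Y(3) x by (auto simp: related_def)
  have "fd2 t x (X x) (Y x) = fd2 t x (Y x) (X x)" by (rule fd_commute[OF pd(1,3) x])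
  then show "vf_bracket X' Y' (t x) = fd t x (vf_bracket X Y x)"
    unfolding vf_bracket_def r related_fd[OF p X x] related_fd[OF p Y x]
    by (simp add: linear_diff[OF smooth_linear[OF pd(3) x]])
qed

text \<open>The classical transformation law of Christoffel symbols, stated on tangent vectors so
  that fields no longer occur.\<close>

definition transforms :: "(real^2) set \<Rightarrow> field2 \<Rightarrow> christoffel2 \<Rightarrow> christoffel2 \<Rightarrow> bool" where
  "transforms V t G G' \<longleftrightarrow> (\<forall>x\<in>V. \<forall>u v.
     fd2 t x u v + christ (G' (t x)) (fd t x u) (fd t x v) = fd t x (christ (G x) u v))"

lemma transforms_subset: "transforms V t G G' \<Longrightarrow> W \<subseteq> V \<Longrightarrow> transforms W t G G'"
  by (auto simp: transforms_def)

lemma related_covd: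
  assumes p: "pdiff V t s" and tr: "transforms V t G G'" and X: "related V t X X'"
    and Y: "smooth_on V Y" "smooth_on (t ` V) Y'" "related V t Y Y'"
  shows "related V t (covd G X Y) (covd G' X' Y')"
  unfolding related_def
proof
  fix x assume x: "x \<in> V"
  have r: "X' (t x) = fd t x (X x)" "Y' (t x) = fd t x (Y x)" using X(1) Y(3) x by (auto simp: related_def)
  have "fd2 t x (X x) (Y x) + christ (G' (t x)) (fd t x (X x)) (fd t x (Y x)) = fd t x (christ (G x) (X x) (Y x))"
    using tr x by (simp add: transforms_def)
  then show "covd G' X' Y' (t x) = fd t x (covd G X Y x)"
    unfolding covd_christ r related_fd[OF p Y x]
    by (simp add: linear_add[OF smooth_linear[OF pdiffD(3)[OF p] x]] algebra_simps)
qed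

text \<open>Fields with constant components and their push-forwards already detect the law at every
  point; conversely, the law is exactly the non-tensorial part of the identity for arbitrary related
  fields.\<close>

lemma preserves_connection_iff_tl:
  assumes p: "pdiff V t s"
  shows "preserves_connection V t G G' \<longleftrightarrow> transforms V t G G'"
proof
  assume *: "preserves_connection V t G G'"
  show "transforms V t G G'"
    unfolding transforms_def
  proof (intro ballI allI)
    fix x u v assume x: "x \<in> V"
    let ?X = "(\<lambda>_. u) :: field2" and ?Y = "(\<lambda>_. v) :: field2"
    have s: "smooth_on (t ` V) (push t s (\<lambda>_. w))" for w by (rule smooth_push[OF p smooth_const])
    have r: "related V t (\<lambda>_. w) (push t s (\<lambda>_. w))" for w by (rule related_push[OF p])
    have "covd G' (push t s ?X) (push t s ?Y) (t x) = fd t x (covd G ?X ?Y x)"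
      using *[unfolded preserves_connection_def] smooth_const[of V u] smooth_const[of V v] s r x
      unfolding related_def by blast
    moreover have "fd (push t s ?Y) (t x) (fd t x u) = fd2 t x u v"
      using related_fd[OF p smooth_const s r x, of v u] linear_0[OF smooth_linear[OF pdiffD(3)[OF p] x]] by simp
    moreover have "push t s ?X (t x) = fd t x u" "push t s ?Y (t x) = fd t x v"
      using r x by (auto simp: related_def)
    ultimately show "fd2 t x u v + christ (G' (t x)) (fd t x u) (fd t x v) = fd t x (christ (G x) u v)"
      by (simp add: covd_christ)
  qed
next
  assume *: "transforms V t G G'"
  show "preserves_connection V t G G'"
    unfolding preserves_connection_def
    using related_covd[OF p *] unfolding related_def by blast
qed

lemma transforms_compose:
  assumes V: "open V" "smooth_on V t" and W: "open W" "smooth_on W r" "t ` V \<subseteq> W"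
    and t: "transforms V t G G'" and r: "transforms W r G' G''"
  shows "transforms V (\<lambda>x. r (t x)) G G''"
  unfolding transforms_def
proof (intro ballI allI)
  fix x u v assume x: "x \<in> V"
  have c: "fd (\<lambda>x. r (t x)) y w = fd r (t y) (fd t y w)" if "y \<in> V" for y w
    by (rule fd_smooth_compose[OF V(2) W(2) that]) (use that W in auto)
  have "fd2 (\<lambda>x. r (t x)) x u v = fd (\<lambda>y. fd r (t y) (fd t y v)) x u"
    by (rule fun_cong[OF fd_cong(1)[OF V(1) x]]) (rule c)
  also have "\<dots> = fd2 r (t x) (fd t x u) (fd t x v) + fd r (t x) (fd2 t x u v)"
    by (rule fun_cong[OF fd_eqI], rule has_derivative_fd_along[OF V x W])
       (rule smooth_has_derivative[OF smooth_fd[OF V(2)] x])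
  finally have 1: "fd2 (\<lambda>x. r (t x)) x u v = \<dots>" .
  have tx: "t x \<in> W" using x W by auto
  have "fd t x (christ (G x) u v) = fd2 t x u v + christ (G' (t x)) (fd t x u) (fd t x v)"
    using t x by (simp add: transforms_def)
  moreover have "fd r (t x) (christ (G' (t x)) (fd t x u) (fd t x v)) =
      fd2 r (t x) (fd t x u) (fd t x v) + christ (G'' (r (t x))) (fd r (t x) (fd t x u)) (fd r (t x) (fd t x v))"
    using r tx by (simp add: transforms_def)
  ultimately show "fd2 (\<lambda>x. r (t x)) x u v +
     christ (G'' (r (t x))) (fd (\<lambda>x. r (t x)) x u) (fd (\<lambda>x. r (t x)) x v) =
     fd (\<lambda>x. r (t x)) x (christ (G x) u v)"
    by (simp add: 1 c[OF x] linear_add[OF smooth_linear[OF W(2) tx]])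
qed

lemma transforms_cong:
  assumes "open V" "\<And>x. x \<in> V \<Longrightarrow> t x = t' x" "\<And>x. x \<in> V \<Longrightarrow> G x = H x" "\<And>x. x \<in> V \<Longrightarrow> G' (t x) = H' (t x)"
  shows "transforms V t G G' \<longleftrightarrow> transforms V t' H H'"
proof -
  have 1: "fd t x = fd t' x" if "x \<in> V" for x using fd_cong(1)[OF assms(1) that assms(2)] .
  have 2: "fd2 t x u v = fd2 t' x u v" if "x \<in> V" for x u v
    by (rule fun_cong[OF fd_cong(1)[OF assms(1) that]]) (simp add: 1)
  show ?thesis by (simp add: transforms_def 1 2 assms(2,3,4)[symmetric] cong: ball_cong)
qed

text \<open>As \<open>fd t\<close> is onto, the law determines the Christoffel symbols on the
  target. This identifies the symbols that a surface assigns to a newly built chart.\<close>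

lemma transforms_unique:
  assumes p: "pdiff V t s" and "transforms V t G G'" "transforms V t G H" and y: "y \<in> t ` V"
  shows "G' y = H y"
proof -
  have "christ (G' y) a b = christ (H y) a b" for a b
  proof -
    have "christ (G' (t (s y))) (fd t (s y) (fd s y a)) (fd t (s y) (fd s y b)) =
        christ (H (t (s y))) (fd t (s y) (fd s y a)) (fd t (s y) (fd s y b))"
      using assms(2,3) pdiffD(8)[OF p y] unfolding transforms_def by (metis add_left_cancel)
    then show ?thesis by (simp add: pdiffD(6)[OF p y] pdiff_fd_inv'[OF p y])
  qed
  then have "christ (G' y) (axis i 1) (axis j 1) = christ (H y) (axis i 1) (axis j 1)" for i j by blast
  then show ?thesis by (simp add: vec_eq_iff christ_axis)
qed

section \<open>Curvature and Killing operator\<close>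

text \<open>The coordinate formula for the curvature; the bracket term is absent because the
  arguments stand for fields with constant components.\<close>

definition curvt :: "christoffel2 \<Rightarrow> real^2 \<Rightarrow> real^2 \<Rightarrow> real^2 \<Rightarrow> real^2 \<Rightarrow> real^2" where
  "curvt G x u v w = christ (fd G x u) v w - christ (fd G x v) u w
     + christ (G x) u (christ (G x) v w) - christ (G x) v (christ (G x) u w)"

lemma curv_at_eq:
  assumes "open V" "smooth_on V G" "x \<in> V"
  shows "curv_at G x u v w = curvt G x u v w"
proof -
  have d: "fd (\<lambda>y. christ (G y) a b) x h = christ (fd G x h) a b" for a b h
    by (rule fun_cong[OF fd_eqI], rule has_derivative_eq_rhs,
        rule has_derivative_christ[OF smooth_has_derivative[OF assms(2,3)] has_derivative_const has_derivative_const])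
       (simp add: christ_simps)
  show ?thesis
    by (simp add: curv_at_def curv_def covd_christ[abs_def] vf_bracket_def[abs_def] d curvt_def christ_simps)
qed

lemma curvt_linear:
  assumes "linear (fd G x)"
  shows "linear (\<lambda>u. curvt G x u v w)" "linear (\<lambda>v. curvt G x u v w)" "linear (\<lambda>w. curvt G x u v w)"
  by (auto intro!: linearI
    simp: curvt_def christ_simps linear_add[OF assms] linear_cmul[OF assms] algebra_simps)

text \<open>The transformation law differentiated in the direction \<open>a\<close>. Third
  derivatives of \<open>t\<close> appear only in the first summand, where they are
  symmetric.\<close>

lemma transforms_derivative:
  assumes p: "pdiff V t s" and tr: "transforms V t G G'" and G: "smooth_on V G" "smooth_on (t ` V) G'" and x: "x \<in> V"
  shows "fd (\<lambda>y. fd2 t y u v) x a + christ (fd G' (t x) (fd t x a)) (fd t x u) (fd t x v)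
      + christ (G' (t x)) (fd2 t x a u) (fd t x v) + christ (G' (t x)) (fd t x u) (fd2 t x a v)
    = fd2 t x a (christ (G x) u v) + fd t x (christ (fd G x a) u v)"
proof -
  note pd = pdiffD[OF p]
  have dt: "((\<lambda>y. fd t y w) has_derivative (\<lambda>h. fd2 t x h w)) (at x)" for w
    by (rule smooth_has_derivative[OF smooth_fd[OF pd(3)] x])
  have dG': "((\<lambda>y. G' (t y)) has_derivative (\<lambda>h. fd G' (t x) (fd t x h))) (at x)"
    by (rule has_derivative_compose[of t])
       (auto intro: smooth_has_derivative[OF pd(3) x] smooth_has_derivative[OF G(2)] x)
  have 1: "((\<lambda>y. fd2 t y u v + christ (G' (t y)) (fd t y u) (fd t y v)) has_derivative
     (\<lambda>a. fd (\<lambda>y. fd2 t y u v) x a + (christ (fd G' (t x) (fd t x a)) (fd t x u) (fd t x v)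
      + christ (G' (t x)) (fd2 t x a u) (fd t x v) + christ (G' (t x)) (fd t x u) (fd2 t x a v)))) (at x)"
    by (intro has_derivative_add has_derivative_christ dG' dt
        smooth_has_derivative[OF smooth_fd[OF smooth_fd[OF pd(3)]] x])
  have 2: "((\<lambda>y. fd t y (christ (G y) u v)) has_derivative
     (\<lambda>a. fd2 t x a (christ (G x) u v) + fd t x (christ (fd G x a) u v + christ (G x) 0 v + christ (G x) u 0))) (at x)"
    by (intro has_derivative_fd_along_ident[OF pd(1,3) x] has_derivative_christ has_derivative_const
        smooth_has_derivative[OF G(1) x])
  have 3: "((\<lambda>y. fd t y (christ (G y) u v)) has_derivative
     (\<lambda>a. fd (\<lambda>y. fd2 t y u v) x a + (christ (fd G' (t x) (fd t x a)) (fd t x u) (fd t x v)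
      + christ (G' (t x)) (fd2 t x a u) (fd t x v) + christ (G' (t x)) (fd t x u) (fd2 t x a v)))) (at x)"
    by (rule has_derivative_transform_within_open[OF 1 pd(1) x]) (use tr in \<open>simp add: transforms_def\<close>)
  from has_derivative_unique[OF 2 3] show ?thesis
    by (auto simp: christ_simps fun_eq_iff algebra_simps)
qed

text \<open>Antisymmetrising the differentiated law in \<open>a\<close> and \<open>u\<close> removes
  the third derivatives of \<open>t\<close>; the law itself, used as \<open>h\<close>, balances the
  second derivatives.\<close>

lemma curvt_natural:
  assumes p: "pdiff V t s" and tr: "transforms V t G G'" and G: "smooth_on V G" "smooth_on (t ` V) G'" and x: "x \<in> V"
  shows "curvt G' (t x) (fd t x a) (fd t x u) (fd t x v) = fd t x (curvt G x a u v)"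
proof -
  note pd = pdiffD[OF p]
  note L = smooth_linear[OF pd(3) x]
  have h: "fd t x (christ (G x) b c) = fd2 t x b c + christ (G' (t x)) (fd t x b) (fd t x c)" for b c
    using tr x by (simp add: transforms_def)
  have sym: "fd2 t x a u = fd2 t x u a" by (rule fd_commute[OF pd(1,3) x])
  have T: "fd (\<lambda>y. fd2 t y u v) x a = fd (\<lambda>y. fd2 t y a v) x u"
    by (rule fd_commute[OF pd(1) smooth_fd[OF pd(3)] x])
  show ?thesis
    unfolding vec_eq_iff
  proof
    fix i
    show "curvt G' (t x) (fd t x a) (fd t x u) (fd t x v) $ i = fd t x (curvt G x a u v) $ i"
      using arg_cong[OF transforms_derivative[OF p tr G x, of v u a], of "\<lambda>z. z $ i"]
        arg_cong[OF transforms_derivative[OF p tr G x, of v a u], of "\<lambda>z. z $ i"]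
      unfolding curvt_def linear_add[OF L] linear_diff[OF L] h christ_simps sym T
        vector_add_component vector_minus_component
      by linarith
  qed
qed

lemma ricci_curvt:
  assumes "open V" "smooth_on V G" "x \<in> V"
  shows "ricci G x u v = (\<Sum>k\<in>UNIV. curvt G x (axis k 1) u v $ k)"
  by (simp add: ricci_def trace_def matrix_def curv_at_eq[OF assms])

lemma ricci_linear:
  assumes "open V" "smooth_on V G" "x \<in> V"
  shows "linear (\<lambda>u. ricci G x u v)" "linear (\<lambda>v. ricci G x u v)"
proof -
  note l = curvt_linear(2,3)[OF smooth_linear[OF assms(2,3)]]
  show "linear (\<lambda>u. ricci G x u v)" "linear (\<lambda>v. ricci G x u v)"
    by (auto intro!: linearI simp: ricci_curvt[OF assms] linear_add[OF l(1)] linear_add[OF l(2)]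
        linear_cmul[OF l(1)] linear_cmul[OF l(2)] sum.distrib sum_distrib_left)
qed

lemma smooth_ricci:
  assumes V: "open V" and G: "smooth_on V G"
  shows "smooth_on V (\<lambda>x. ricci G x u v)"
proof -
  have "smooth_on V (\<lambda>x. \<Sum>k\<in>UNIV. curvt G x (axis k 1) u v $ k)"
    unfolding curvt_def
    by (intro smooth_sum smooth_vec_nth smooth_add smooth_diff smooth_christ smooth_fd G V smooth_const)
  then show ?thesis by (subst smooth_cong[OF V]) (rule ricci_curvt[OF V G])
qed

text \<open>By naturality of the curvature the two endomorphisms are conjugate under
  \<open>fd t x\<close>, and conjugate endomorphisms have equal traces.\<close>

lemma ricci_natural:
  assumes p: "pdiff V t s" and tr: "transforms V t G G'" and G: "smooth_on V G" "smooth_on (t ` V) G'" and x: "x \<in> V"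
  shows "ricci G' (t x) (fd t x u) (fd t x v) = ricci G x u v"
proof -
  note pd = pdiffD[OF p]
  have tx: "t x \<in> t ` V" using x by simp
  let ?L = "fd t x" and ?M = "fd s (t x)"
  let ?A = "\<lambda>w. curvt G x w u v" and ?B = "\<lambda>w. curvt G' (t x) w (?L u) (?L v)"
  have lin: "linear ?L" "linear ?M" "linear ?A" "linear ?B"
    using smooth_linear[OF pd(3) x] smooth_linear[OF pd(4) tx] curvt_linear(1) smooth_linear[OF G(1) x]
      smooth_linear[OF G(2) tx] by blast+
  have inv1: "?M (?L w) = w" for w by (rule pdiff_fd_inv[OF p x])
  have inv2: "?L (?M w) = w" for w using pdiff_fd_inv'[OF p tx] pd(5)[OF x] by simp
  have "?B = (?L \<circ> ?A) \<circ> ?M"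
    by (simp add: fun_eq_iff flip: curvt_natural[OF p tr G x]) (simp add: inv2)
  then have "trace (matrix ?B) = trace (matrix (?L \<circ> ?A) ** matrix ?M)"
    using lin by (simp add: matrix_compose linear_compose)
  also have "\<dots> = trace (matrix ?M ** matrix (?L \<circ> ?A))" by (rule trace_mul_sym)
  also have "\<dots> = trace (matrix (?M \<circ> (?L \<circ> ?A)))"
    using lin by (subst matrix_compose) (auto intro: linear_compose)
  also have "?M \<circ> (?L \<circ> ?A) = ?A" by (simp add: fun_eq_iff inv1)
  finally show ?thesis
    by (simp add: ricci_def curv_at_eq[OF pd(2) G(2) tx] curv_at_eq[OF pd(1) G(1) x])
qed

lemma vec2_expand: "(v::real^2) = v $ 1 *\<^sub>R axis 1 1 + v $ 2 *\<^sub>R axis 2 1"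
  by (simp add: vec_eq_iff forall_2 axis_def)

lemma ricci_expand:
  assumes "open V" "smooth_on V G" "x \<in> V"
  shows "ricci G x a b = (\<Sum>i\<in>UNIV. \<Sum>j\<in>UNIV. (a $ i * b $ j) * ricci G x (axis i 1) (axis j 1))"
proof -
  note l = ricci_linear[OF assms]
  have "ricci G x a b = (\<Sum>i\<in>UNIV. a $ i * ricci G x (axis i 1) b)" for b
    by (subst vec2_expand[of a]) (simp add: linear_add[OF l(1)] linear_cmul[OF l(1)] sum_2)
  moreover have "ricci G x c b = (\<Sum>j\<in>UNIV. b $ j * ricci G x c (axis j 1))" for c
    by (subst vec2_expand[of b]) (simp add: linear_add[OF l(2)] linear_cmul[OF l(2)] sum_2)
  ultimately show ?thesis by (simp add: sum_2 algebra_simps)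
qed

lemma nabla_ricci_at_eq:
  "nabla_ricci_at G x u v w = fd (\<lambda>y. ricci G y u v) x w
     - ricci G x (christ (G x) w u) v - ricci G x u (christ (G x) w v)"
  by (simp add: nabla_ricci_at_def nabla_ricci_def covd_christ)

text \<open>Differentiating the invariance of the Ricci tensor along \<open>w\<close> also hits the
  arguments \<open>fd t y u\<close> and \<open>fd t y v\<close>. The resulting second derivatives of
  \<open>t\<close> are rewritten by the transformation law and become the two Christoffel
  corrections. Components \<open>R i j\<close> are used because base point and arguments vary at
  once.\<close>

lemma nabla_ricci_natural:
  assumes p: "pdiff V t s" and tr: "transforms V t G G'" and G: "smooth_on V G" "smooth_on (t ` V) G'" and x: "x \<in> V"
  shows "nabla_ricci_at G' (t x) (fd t x u) (fd t x v) (fd t x w) = nabla_ricci_at G x u v w"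
proof -
  note pd = pdiffD[OF p]
  have tx: "t x \<in> t ` V" using x by simp
  define R where "R i j z = ricci G' z (axis i 1) (axis j 1)" for i j z
  have R: "smooth_on (t ` V) (R i j)" for i j
    unfolding R_def[abs_def] by (rule smooth_ricci[OF pd(2) G(2)])
  have dR: "((\<lambda>y. R i j (t y)) has_derivative (\<lambda>h. fd (R i j) (t x) (fd t x h))) (at x)" for i j
    by (rule has_derivative_compose[of t])
       (auto intro: smooth_has_derivative[OF pd(3) x] smooth_has_derivative[OF R tx])
  have dt: "((\<lambda>y. fd t y a $ i) has_derivative (\<lambda>h. fd2 t x h a $ i)) (at x)" for a i
    by (rule bounded_linear.has_derivative[OF bounded_linear_vec_nth])
       (rule smooth_has_derivative[OF smooth_fd[OF pd(3)] x])
  have e: "ricci G' z a b = (\<Sum>i\<in>UNIV. \<Sum>j\<in>UNIV. (a $ i * b $ j) * R i j z)" if "z \<in> t ` V" for z a b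
    unfolding R_def by (rule ricci_expand[OF pd(2) G(2) that])
  have "((\<lambda>y. \<Sum>i\<in>UNIV. \<Sum>j\<in>UNIV. (fd t y u $ i * fd t y v $ j) * R i j (t y)) has_derivative
    (\<lambda>h. \<Sum>i\<in>UNIV. \<Sum>j\<in>UNIV. (fd t x u $ i * fd t x v $ j) * fd (R i j) (t x) (fd t x h) +
       (fd t x u $ i * fd2 t x h v $ j + fd2 t x h u $ i * fd t x v $ j) * R i j (t x))) (at x)"
    by (intro has_derivative_sum has_derivative_mult dR dt)
  then have "((\<lambda>y. ricci G y u v) has_derivative
    (\<lambda>h. \<Sum>i\<in>UNIV. \<Sum>j\<in>UNIV. (fd t x u $ i * fd t x v $ j) * fd (R i j) (t x) (fd t x h) +
       (fd t x u $ i * fd2 t x h v $ j + fd2 t x h u $ i * fd t x v $ j) * R i j (t x))) (at x)"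
    by (rule has_derivative_transform_within_open[OF _ pd(1) x])
       (use ricci_natural[OF p tr G] e in simp)
  from fd_eqI[OF this]
  have 1: "fd (\<lambda>y. ricci G y u v) x w = (\<Sum>i\<in>UNIV. \<Sum>j\<in>UNIV. (fd t x u $ i * fd t x v $ j) * fd (R i j) (t x) (fd t x w))
     + ricci G' (t x) (fd t x u) (fd2 t x w v) + ricci G' (t x) (fd2 t x w u) (fd t x v)"
    by (simp add: e[OF tx] sum.distrib distrib_right)
  have "((\<lambda>z. \<Sum>i\<in>UNIV. \<Sum>j\<in>UNIV. (a $ i * b $ j) * R i j z) has_derivative
    (\<lambda>h. \<Sum>i\<in>UNIV. \<Sum>j\<in>UNIV. (a $ i * b $ j) * fd (R i j) (t x) h)) (at (t x))" for a b :: "real^2"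
    by (intro has_derivative_sum has_derivative_mult_right smooth_has_derivative[OF R tx])
  then have "((\<lambda>z. ricci G' z a b) has_derivative
    (\<lambda>h. \<Sum>i\<in>UNIV. \<Sum>j\<in>UNIV. (a $ i * b $ j) * fd (R i j) (t x) h)) (at (t x))" for a b
    by (rule has_derivative_transform_within_open[OF _ pd(2) tx]) (use e in simp)
  from fd_eqI[OF this] have 2: "fd (\<lambda>z. ricci G' z a b) (t x) h =
     (\<Sum>i\<in>UNIV. \<Sum>j\<in>UNIV. (a $ i * b $ j) * fd (R i j) (t x) h)" for a b h by simp
  have h: "fd2 t x b c = fd t x (christ (G x) b c) - christ (G' (t x)) (fd t x b) (fd t x c)" for b c
    using tr x by (simp add: transforms_def algebra_simps)
  show ?thesis
    unfolding nabla_ricci_at_eq 1 2 h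
      linear_diff[OF ricci_linear(1)[OF pd(2) G(2) tx]] linear_diff[OF ricci_linear(2)[OF pd(2) G(2) tx]]
      ricci_natural[OF p tr G x]
    by simp
qed

section \<open>The Lie derivative of a connection\<close>

definition kill :: "christoffel2 \<Rightarrow> field2 \<Rightarrow> real^2 \<Rightarrow> real^2 \<Rightarrow> real^2 \<Rightarrow> real^2" where
  "kill G X x u v = fd2 X x u v + christ (fd G x (X x)) u v + christ (G x) (fd X x u) v
     + christ (G x) u (fd X x v) - fd X x (christ (G x) u v)"

text \<open>All derivatives of \<open>Y\<close> and \<open>Z\<close> cancel, the second ones of
  \<open>Z\<close> by symmetry. The Killing condition is thus tensorial and can be tested on
  constant components.\<close>

lemma lie_conn_kill:
  assumes V: "open V" and G: "smooth_on V G" and X: "smooth_on V X" and Y: "smooth_on V Y"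
    and Z: "smooth_on V Z" and x: "x \<in> V"
  shows "lie_conn G X Y Z x = kill G X x (Y x) (Z x)"
proof -
  note L = smooth_linear[OF X x] smooth_linear[OF Y x] smooth_linear[OF Z x]
  have 1: "fd (covd G Y Z) x h = fd2 Z x h (Y x) + fd Z x (fd Y x h) + (christ (fd G x h) (Y x) (Z x)
     + christ (G x) (fd Y x h) (Z x) + christ (G x) (Y x) (fd Z x h))" for h
    unfolding covd_christ[abs_def]
    by (rule fun_cong[OF fd_eqI]) (intro has_derivative_add has_derivative_fd_along_ident[OF V Z x]
        has_derivative_christ smooth_has_derivative[OF _ x] Y Z G)
  have 2: "fd (vf_bracket X Z) x h = (fd2 Z x h (X x) + fd Z x (fd X x h)) - (fd2 X x h (Z x) + fd X x (fd Z x h))" for h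
    unfolding vf_bracket_def[abs_def]
    by (rule fun_cong[OF fd_eqI]) (intro has_derivative_diff has_derivative_fd_along_ident[OF V Z x]
        has_derivative_fd_along_ident[OF V X x] smooth_has_derivative[OF _ x] X Z)
  have c: "fd2 Z x (X x) (Y x) = fd2 Z x (Y x) (X x)" by (rule fd_commute[OF V Z x])
  show ?thesis
    unfolding lie_conn_def vf_bracket_def[of X "covd G Y Z"] covd_christ[of G "vf_bracket X Y"]
      covd_christ[of G Y "vf_bracket X Z"] 1 2 covd_christ kill_def c
    by (simp add: vf_bracket_def christ_simps linear_add[OF L(1)] linear_diff[OF L(3)] linear_diff[OF L(1)] algebra_simps)
qed

text \<open>No formula is transformed here: \<open>lie_conn\<close> is built from brackets and
  covariant derivatives, which respect related fields. The test fields \<open>?Y w\<close> on the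
  source are those related to the constant fields \<open>w\<close> on the target.\<close>

lemma kill_natural:
  assumes p: "pdiff V t s" and tr: "transforms V t G G'" and G: "smooth_on V G" "smooth_on (t ` V) G'"
    and X: "smooth_on V X" "smooth_on (t ` V) X'" "related V t X X'"
    and k: "\<And>x u v. x \<in> V \<Longrightarrow> kill G X x u v = 0" and y: "y \<in> t ` V"
  shows "kill G' X' y u v = 0"
proof -
  note pd = pdiffD[OF p]
  let ?Y = "\<lambda>w x. fd s (t x) w"
  have Y: "smooth_on V (?Y w)" for w
    by (rule smooth_compose[OF pd(1,2,3) smooth_fd[OF pd(4)]]) simp
  have rY: "related V t (?Y w) (\<lambda>_. w)" for w
    unfolding related_def using pdiff_fd_inv'[OF p imageI] pd(5) by metis
  note c = smooth_const[of "t ` V"]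
  have "related V t (lie_conn G X (?Y u) (?Y v)) (lie_conn G' X' (\<lambda>_. u) (\<lambda>_. v))"
  proof -
    have b: "related V t (vf_bracket X (?Y w)) (vf_bracket X' (\<lambda>_. w))" for w
      by (rule related_vf_bracket[OF p X Y c rY])
    have cv: "related V t (covd G (?Y u) (?Y v)) (covd G' (\<lambda>_. u) (\<lambda>_. v))"
      by (rule related_covd[OF p tr rY Y c rY])
    have 1: "related V t (vf_bracket X (covd G (?Y u) (?Y v))) (vf_bracket X' (covd G' (\<lambda>_. u) (\<lambda>_. v)))"
      by (rule related_vf_bracket[OF p X _ _ cv]) (intro smooth_covd pd G Y c)+
    have 2: "related V t (covd G (vf_bracket X (?Y u)) (?Y v)) (covd G' (vf_bracket X' (\<lambda>_. u)) (\<lambda>_. v))"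
      by (rule related_covd[OF p tr b Y c rY])
    have 3: "related V t (covd G (?Y u) (vf_bracket X (?Y v))) (covd G' (\<lambda>_. u) (vf_bracket X' (\<lambda>_. v)))"
      by (rule related_covd[OF p tr rY _ _ b]) (intro smooth_vf_bracket pd X Y c)+
    show ?thesis
      unfolding related_def
    proof
      fix x assume x: "x \<in> V"
      show "lie_conn G' X' (\<lambda>_. u) (\<lambda>_. v) (t x) = fd t x (lie_conn G X (?Y u) (?Y v) x)"
        using 1 2 3 x unfolding lie_conn_def related_def by (simp add: linear_diff[OF smooth_linear[OF pd(3) x]])
    qed
  qed
  moreover have "lie_conn G X (?Y u) (?Y v) (s y) = 0"
    using lie_conn_kill[OF pd(1) G(1) X(1) Y Y pd(8)[OF y]] k[OF pd(8)[OF y]] by simp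
  ultimately have "lie_conn G' X' (\<lambda>_. u) (\<lambda>_. v) (t (s y)) = 0"
    using pd(8)[OF y] linear_0[OF smooth_linear[OF pd(3) pd(8)[OF y]]] by (simp add: related_def)
  then show ?thesis
    using lie_conn_kill[OF pd(2) G(2) X(2) c c y, of u v] pd(6)[OF y] by simp
qed

section \<open>Charts\<close>

lemma pdiff_subset:
  assumes "pdiff V t s" "open W" "W \<subseteq> V"
  shows "pdiff W t s"
proof -
  note p = pdiffD[OF assms(1)]
  have "t ` W = t ` V \<inter> s -` W"
    using p(5,6,8) assms(3) by force
  then have "open (t ` W)"
    using continuous_open_preimage[OF smooth_continuous[OF p(4)] p(2) assms(2)] by simp
  then show ?thesis
    unfolding pdiff_def
    using assms p(5) smooth_subset[OF p(3)] smooth_subset[OF p(4) image_mono[OF assms(3)]] by (simp add: subset_iff)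
qed

lemma pdiff_cong:
  assumes "pdiff V t s" "\<And>x. x \<in> V \<Longrightarrow> t' x = t x" "\<And>y. y \<in> t ` V \<Longrightarrow> s' y = s y"
  shows "pdiff V t' s'"
proof -
  note p = pdiffD[OF assms(1)]
  have "t' ` V = t ` V" using assms(2) by (simp cong: image_cong_simp)
  moreover have "smooth_on V t'" using smooth_cong[OF p(1) assms(2)] p(3) by simp
  moreover have "smooth_on (t ` V) s'" using smooth_cong[OF p(2) assms(3)] p(4) by simp
  ultimately show ?thesis using p assms by (simp add: pdiff_def)
qed

lemma pdiff_compose:
  assumes t: "pdiff V t s" and r: "pdiff W r q" and sub: "t ` V \<subseteq> W"
  shows "pdiff V (\<lambda>x. r (t x)) (\<lambda>y. s (q y))"
proof -
  note pt = pdiffD[OF t] and pr = pdiffD[OF pdiff_subset[OF r pdiffD(2)[OF t] sub]]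
  have im: "(\<lambda>x. r (t x)) ` V = r ` t ` V" by (simp add: image_image)
  have "smooth_on V (\<lambda>x. r (t x))"
    by (rule smooth_compose[OF pt(1,2,3) pr(3)]) simp
  moreover have "smooth_on (r ` t ` V) (\<lambda>y. s (q y))"
    by (rule smooth_compose[OF pr(2) pt(2) pr(4) pt(4)]) (simp add: pr(7))
  ultimately show ?thesis
    unfolding pdiff_def im using pt pr by simp
qed

section \<open>Charts of a surface and their coordinate changes\<close>

lemma chart_image_iff: "x \<in> chart_image c U \<longleftrightarrow> (\<exists>P. P \<in> fst c \<and> P \<in> U \<and> snd c P = x)"
  by (auto simp: chart_image_def)

lemma is_chartD:
  assumes "is_chart c"
  shows "open (fst c)" "continuous_on (fst c) (snd c)" "continuous_on (chart_image c UNIV) (chart_inv c)"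
    "P \<in> fst c \<Longrightarrow> chart_inv c (snd c P) = P"
    "x \<in> chart_image c U \<Longrightarrow> snd c (chart_inv c x) = x"
    "x \<in> chart_image c U \<Longrightarrow> chart_inv c x \<in> fst c"
    "x \<in> chart_image c U \<Longrightarrow> chart_inv c x \<in> U"
    "P \<in> fst c \<Longrightarrow> snd c P \<in> chart_image c U \<longleftrightarrow> P \<in> U"
    "open (chart_image c UNIV)"
    "x \<in> chart_image c UNIV \<Longrightarrow> x \<in> chart_image c U \<longleftrightarrow> chart_inv c x \<in> U"
proof -
  have h: "homeomorphism (fst c) (snd c ` fst c) (snd c) (chart_inv c)"
    using assms by (simp add: is_chart_def chart_inv_def)
  show "open (fst c)" "open (chart_image c UNIV)" using assms by (auto simp: is_chart_def chart_image_def)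
  show "continuous_on (fst c) (snd c)" "continuous_on (chart_image c UNIV) (chart_inv c)"
    using h by (auto simp: homeomorphism_def chart_image_def)
  have inv: "chart_inv c (snd c P) = P" if "P \<in> fst c" for P
    using h that by (simp add: homeomorphism_def)
  show "P \<in> fst c \<Longrightarrow> chart_inv c (snd c P) = P" by (rule inv)
  show "x \<in> chart_image c U \<Longrightarrow> snd c (chart_inv c x) = x"
    "x \<in> chart_image c U \<Longrightarrow> chart_inv c x \<in> fst c"
    "x \<in> chart_image c U \<Longrightarrow> chart_inv c x \<in> U"
    by (auto simp: chart_image_def inv)
  show "P \<in> fst c \<Longrightarrow> snd c P \<in> chart_image c U \<longleftrightarrow> P \<in> U"
    unfolding chart_image_iff using inv by metis
  show "x \<in> chart_image c UNIV \<Longrightarrow> x \<in> chart_image c U \<longleftrightarrow> chart_inv c x \<in> U"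
    unfolding chart_image_iff using inv by metis
qed

lemma open_chart_image:
  assumes "is_chart c" "open U"
  shows "open (chart_image c U)"
proof -
  note p = is_chartD[OF assms(1)]
  have "chart_image c U = chart_image c UNIV \<inter> chart_inv c -` U"
    by (auto simp: chart_image_def p(4))
  then show ?thesis using continuous_open_preimage[OF p(3,9) assms(2)] by simp
qed

lemma open_chart_inv_image:
  assumes "is_chart c" "open W" "W \<subseteq> chart_image c UNIV"
  shows "open (chart_inv c ` W)" "chart_inv c ` W \<subseteq> fst c" "chart_image c (chart_inv c ` W) = W"
    "P \<in> chart_inv c ` W \<longleftrightarrow> P \<in> fst c \<and> snd c P \<in> W"
proof -
  note p = is_chartD[OF assms(1)]
  have iff: "P \<in> chart_inv c ` W \<longleftrightarrow> P \<in> fst c \<and> snd c P \<in> W" for P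
  proof
    assume "P \<in> chart_inv c ` W"
    then show "P \<in> fst c \<and> snd c P \<in> W" using p(5,6) assms(3) by auto
  next
    assume "P \<in> fst c \<and> snd c P \<in> W"
    then show "P \<in> chart_inv c ` W" using p(4)[of P] by force
  qed
  then have "chart_inv c ` W = fst c \<inter> snd c -` W" by auto
  then show "open (chart_inv c ` W)" using continuous_open_preimage[OF p(2,1) assms(2)] by simp
  show "chart_inv c ` W \<subseteq> fst c" "P \<in> chart_inv c ` W \<longleftrightarrow> P \<in> fst c \<and> snd c P \<in> W"
    using iff by auto
  show "chart_image c (chart_inv c ` W) = W"
  proof (intro set_eqI iffI)
    fix x assume "x \<in> W"
    then show "x \<in> chart_image c (chart_inv c ` W)" using p(10) assms(3) by blast
  qed (auto simp: chart_image_iff iff)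
qed

lemma affine_surfaceD:
  assumes "affine_surface M"
  shows "c \<in> charts M \<Longrightarrow> is_chart c"
    "c \<in> charts M \<Longrightarrow> d \<in> charts M \<Longrightarrow> smooth_on (chart_image c (fst d)) (coord_rep c d id)"
    "is_chart c \<Longrightarrow> (\<And>d. d \<in> charts M \<Longrightarrow> compatible c d) \<Longrightarrow> c \<in> charts M"
    "c \<in> charts M \<Longrightarrow> smooth_on (chart_image c UNIV) (gam M c)"
    "c \<in> charts M \<Longrightarrow> sym_on (chart_image c UNIV) (gam M c)"
    "c \<in> charts M \<Longrightarrow> d \<in> charts M \<Longrightarrow>
       preserves_connection (chart_image c (fst d)) (coord_rep c d id) (gam M c) (gam M d)"
  using assms torsion_free_sym unfolding affine_surface_def maximal_atlas_def compatible_def by blast+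

lemma coord_change_image:
  assumes "is_chart c" "is_chart d"
  shows "coord_rep c d id ` chart_image c (fst d) = chart_image d (fst c)"
    "x \<in> chart_image c (fst d) \<Longrightarrow> coord_rep d c id (coord_rep c d id x) = x"
  using is_chartD(4)[OF assms(1)] is_chartD(4)[OF assms(2)]
  by (auto simp: chart_image_def coord_rep_def image_iff)

lemma coord_change:
  assumes M: "affine_surface M" and c: "c \<in> charts M" and d: "d \<in> charts M"
  shows "pdiff (chart_image c (fst d)) (coord_rep c d id) (coord_rep d c id)"
    and "transforms (chart_image c (fst d)) (coord_rep c d id) (gam M c) (gam M d)"
proof -
  note a = affine_surfaceD[OF M]
  note ic = a(1)[OF c] and id = a(1)[OF d]
  show p: "pdiff (chart_image c (fst d)) (coord_rep c d id) (coord_rep d c id)"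
    unfolding pdiff_def coord_change_image(1)[OF ic id]
    using open_chart_image[OF ic is_chartD(1)[OF id]] open_chart_image[OF id is_chartD(1)[OF ic]]
      a(2)[OF c d] a(2)[OF d c] coord_change_image(2)[OF ic id] by blast
  show "transforms (chart_image c (fst d)) (coord_rep c d id) (gam M c) (gam M d)"
    using preserves_connection_iff_tl[OF p] a(6)[OF c d] by simp
qed

text \<open>Composing a chart with a plane diffeomorphism gives a chart compatible with the whole
  atlas, hence a member of it by maximality. Its Christoffel symbols are assigned by the surface,
  but the transformation law leaves only one possibility for them.\<close>

lemma new_chart:
  assumes M: "affine_surface M" and c: "c \<in> charts M" and F: "pdiff W F H"
    and W: "W \<subseteq> chart_image c UNIV" and tr: "transforms W F (gam M c) G"
  obtains c' where "c' \<in> charts M" "fst c' = chart_inv c ` W"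
    "\<And>P. P \<in> fst c' \<Longrightarrow> snd c' P = F (snd c P)" "chart_image c' UNIV = F ` W"
    "\<And>y. y \<in> F ` W \<Longrightarrow> gam M c' y = G y"
proof -
  define c' where "c' = (chart_inv c ` W, \<lambda>P. F (snd c P))"
  note a = affine_surfaceD[OF M] and f = pdiffD[OF F]
  note ic = a(1)[OF c]
  note p = is_chartD[OF ic] and w = open_chart_inv_image[OF ic f(1) W]
  have fst': "fst c' = chart_inv c ` W" and snd': "snd c' = (\<lambda>P. F (snd c P))" by (simp_all add: c'_def)
  have im': "snd c' ` fst c' = F ` W"
  proof -
    have "snd c ` fst c' = W" using w(3) w(2) unfolding fst' chart_image_def by (simp add: Int_absorb1)
    then show ?thesis unfolding snd' by (metis image_image)
  qed
  have inv': "inv_into (fst c') (snd c') y = chart_inv c (H y)" if y: "y \<in> F ` W" for y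
  proof -
    have "H y \<in> W" "F (H y) = y" using f(6,8) y by auto
    then have "chart_inv c (H y) \<in> fst c'" "snd c' (chart_inv c (H y)) = y"
      using p(5)[of "H y" UNIV] W by (auto simp: fst' snd')
    moreover have "inj_on (snd c') (fst c')"
    proof (rule inj_onI)
      fix P Q assume "P \<in> fst c'" "Q \<in> fst c'" "snd c' P = snd c' Q"
      then have "snd c P \<in> W" "snd c Q \<in> W" "F (snd c P) = F (snd c Q)" "P \<in> fst c" "Q \<in> fst c"
        using w(2,4) by (auto simp: fst' snd')
      then show "P = Q" using f(5) p(4) by metis
    qed
    ultimately show ?thesis by (metis inv_into_f_f)
  qed
  have dom: "P \<in> fst c' \<longleftrightarrow> P \<in> fst c \<and> snd c P \<in> W" for P using w(2,4) by (auto simp: fst')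
  have ic': "is_chart c'"
  proof -
    have "homeomorphism (fst c') (F ` W) (snd c') (inv_into (fst c') (snd c'))"
      unfolding homeomorphism_def
    proof (intro conjI ballI)
      show "snd c' ` fst c' = F ` W" by (rule im')
      show "continuous_on (fst c') (snd c')"
        unfolding snd'
        by (rule continuous_on_compose2[OF smooth_continuous[OF f(3)] continuous_on_subset[OF p(2)]])
           (auto simp: dom)
      show "inv_into (fst c') (snd c') ` F ` W = fst c'"
      proof -
        have "inv_into (fst c') (snd c') ` F ` W = (\<lambda>x. chart_inv c (H (F x))) ` W"
          unfolding image_image by (rule image_cong) (simp_all add: inv')
        also have "\<dots> = fst c'" unfolding fst' by (rule image_cong) (simp_all add: f(5))
        finally show ?thesis .
      qed
      have "continuous_on (F ` W) (\<lambda>y. chart_inv c (H y))"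
        by (rule continuous_on_compose2[OF p(3) smooth_continuous[OF f(4)]]) (use f(7) W in auto)
      then show "continuous_on (F ` W) (inv_into (fst c') (snd c'))"
        by (simp add: inv' cong: continuous_on_cong_simp)
    next
      fix P assume P: "P \<in> fst c'"
      then have *: "snd c' P \<in> F ` W" using im' by blast
      show "inv_into (fst c') (snd c') (snd c' P) = P"
        unfolding inv'[OF *] using P by (simp add: snd' dom f(5) p(4))
    next
      fix y assume "y \<in> F ` W" then show "snd c' (inv_into (fst c') (snd c') y) = y"
        using im' by (metis f_inv_into_f)
    qed
    moreover have "open (fst c')" unfolding fst' by (rule w(1))
    ultimately show ?thesis unfolding is_chart_def im' using f(2) by simp
  qed
  have sub: "chart_image c' (fst d) = F ` chart_image c (fst c' \<inter> fst d)" for d :: "'a chart"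
    using dom by (auto simp: chart_image_def snd' image_image)
  \<comment> \<open>On their common domain, changing between \<open>c'\<close> and \<open>d\<close>
    is changing between \<open>c\<close> and \<open>d\<close>, composed with \<open>H\<close> or
    \<open>F\<close>.\<close>
  have c'C: "c' \<in> charts M"
  proof (rule a(3)[OF ic'])
    fix d assume d: "d \<in> charts M"
    note id = a(1)[OF d]
    let ?V = "chart_image c (fst c' \<inter> fst d)"
    have V: "?V \<subseteq> W" "?V \<subseteq> chart_image c (fst d)" using dom by (auto simp: chart_image_def)
    have oV: "open ?V" by (rule open_chart_image[OF ic]) (use is_chartD(1)[OF ic'] is_chartD(1)[OF id] in auto)
    note g = pdiff_subset[OF F oV V(1)]
    have 1: "smooth_on (chart_image c' (fst d)) (\<lambda>y. coord_rep c d id (H y))"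
      unfolding sub
      by (rule smooth_compose[OF pdiffD(2)[OF g] oV pdiffD(4)[OF g] smooth_subset[OF a(2)[OF c d] V(2)]])
         (simp add: pdiffD(7)[OF g])
    have 2: "coord_rep c' d id y = coord_rep c d id (H y)" if "y \<in> chart_image c' (fst d)" for y
    proof -
      have "y \<in> F ` W" using that V(1) unfolding sub by blast
      from inv'[OF this] show ?thesis by (simp add: coord_rep_def chart_inv_def[of c'])
    qed
    have 3: "smooth_on (chart_image d (fst c')) (\<lambda>z. F (coord_rep d c id z))"
    proof (rule smooth_compose[OF open_chart_image[OF id is_chartD(1)[OF ic']] f(1) _ f(3)])
      show "smooth_on (chart_image d (fst c')) (coord_rep d c id)"
        by (rule smooth_subset[OF a(2)[OF d c]]) (auto simp: chart_image_def dom)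
      show "coord_rep d c id ` chart_image d (fst c') \<subseteq> W"
        by (auto simp: coord_rep_def is_chartD(4)[OF id] chart_image_def dom)
    qed
    have 4: "coord_rep d c' id z = F (coord_rep d c id z)" for z
      by (simp add: coord_rep_def snd')
    show "compatible c' d"
      unfolding compatible_def
      using 1 3 smooth_cong[OF open_chart_image[OF ic' is_chartD(1)[OF id]],
          where f = "coord_rep c' d id" and g = "\<lambda>y. coord_rep c d id (H y)"] 2
      by (simp add: 4[abs_def])
  qed
  have im: "chart_image c (fst c') = W" unfolding fst' by (rule w(3))
  have im'': "chart_image c' UNIV = F ` W" using im' by (simp add: chart_image_def)
  have cr: "coord_rep c c' id x = F x" if "x \<in> W" for x
    using that W p(5)[of x UNIV] by (auto simp: coord_rep_def snd')
  have "transforms W F (gam M c) (gam M c')"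
    using coord_change(2)[OF M c c'C] cr
      transforms_cong[OF f(1), where t = "coord_rep c c' id" and t' = F and G = "gam M c" and H = "gam M c"
        and G' = "gam M c'" and H' = "gam M c'"]
    by (simp add: im)
  then have "gam M c' y = G y" if "y \<in> F ` W" for y
    using transforms_unique[OF F _ tr that] by blast
  with c'C fst' snd' im'' show ?thesis using that by simp
qed

text \<open>The map \<open>f\<close> is the identity when read in \<open>c\<close> and
  \<open>d\<close>. Between arbitrary charts it is therefore the change from \<open>c1\<close> to
  \<open>c\<close> followed by the change from \<open>d\<close> to \<open>d1\<close>, and both
  preserve the connection.\<close>

lemma transition:
  assumes M: "affine_surface M" and N: "affine_surface N" and c: "c \<in> charts M" and d: "d \<in> charts N"
    and W: "open W" "W \<subseteq> chart_image c UNIV" "W \<subseteq> chart_image d UNIV"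
    and G: "\<And>x. x \<in> W \<Longrightarrow> gam M c x = gam N d x"
    and f: "\<And>P. P \<in> chart_inv c ` W \<Longrightarrow> f P = chart_inv d (snd c P)"
    and g: "\<And>Q. Q \<in> chart_inv d ` W \<Longrightarrow> g Q = chart_inv c (snd d Q)"
    and c1: "c1 \<in> charts M" and d1: "d1 \<in> charts N"
  defines "V \<equiv> chart_image c1 (chart_inv c ` W \<inter> f -` fst d1)"
  shows "pdiff V (coord_rep c1 d1 f) (coord_rep d1 c1 g)"
    and "transforms V (coord_rep c1 d1 f) (gam M c1) (gam N d1)"
proof -
  note am = affine_surfaceD[OF M] and an = affine_surfaceD[OF N]
  note pc = is_chartD[OF am(1)[OF c]] and pc1 = is_chartD[OF am(1)[OF c1]]
  note pd = is_chartD[OF an(1)[OF d]] and pd1 = is_chartD[OF an(1)[OF d1]]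
  note wc = open_chart_inv_image[OF am(1)[OF c] W(1,2)] and wd = open_chart_inv_image[OF an(1)[OF d] W(1,3)]
  let ?t = "coord_rep c1 c id" and ?r = "coord_rep d d1 id"
  let ?T = "chart_image c (fst c1)" and ?R = "chart_image d (fst d1)"
  have V: "x \<in> V \<longleftrightarrow> (\<exists>P. P \<in> fst c1 \<and> P \<in> fst c \<and> snd c P \<in> W \<and> chart_inv d (snd c P) \<in> fst d1 \<and> x = snd c1 P)" for x
    unfolding V_def chart_image_iff using f by (auto simp: wc(4))
  have oWR: "open (W \<inter> ?R)" using W(1) open_chart_image[OF an(1)[OF d] pd1(1)] by auto
  have WR: "z \<in> ?R \<longleftrightarrow> chart_inv d z \<in> fst d1" if "z \<in> W" for z
    using pd(10) that W(3) by blast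
  have oV: "open V"
  proof -
    have "V = chart_image c1 (chart_inv c ` (W \<inter> ?R))"
    proof (rule set_eqI)
      have sub: "W \<inter> ?R \<subseteq> chart_image c UNIV" using W(2) by blast
      fix x show "x \<in> V \<longleftrightarrow> x \<in> chart_image c1 (chart_inv c ` (W \<inter> ?R))"
        unfolding V chart_image_iff[of x c1] open_chart_inv_image(4)[OF am(1)[OF c] oWR sub]
        using WR by auto
    qed
    moreover have "open (chart_inv c ` (W \<inter> ?R))"
      by (rule open_chart_inv_image(1)[OF am(1)[OF c] oWR]) (use W(2) in auto)
    ultimately show ?thesis using open_chart_image[OF am(1)[OF c1]] by simp
  qed
  have sub: "V \<subseteq> chart_image c1 (fst c)" by (auto simp: V chart_image_def)
  have tV: "?t ` V \<subseteq> W \<inter> ?R"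
  proof
    fix z assume "z \<in> ?t ` V"
    then obtain x where x: "x \<in> V" "z = ?t x" by blast
    from x(1) obtain P where P: "P \<in> fst c1" "P \<in> fst c" "snd c P \<in> W" "chart_inv d (snd c P) \<in> fst d1" "x = snd c1 P"
      unfolding V by blast
    then have "z = snd c P" using x(2) by (simp add: coord_rep_def pc1(4))
    then show "z \<in> W \<inter> ?R" using P(3,4) WR by simp
  qed
  have p1: "pdiff V ?t (coord_rep c c1 id)"
    by (rule pdiff_subset[OF coord_change(1)[OF M c1 c] oV sub])
  have p2: "pdiff (W \<inter> ?R) ?r (coord_rep d1 d id)"
    by (rule pdiff_subset[OF coord_change(1)[OF N d d1] oWR]) auto
  have 1: "coord_rep c1 d1 f x = ?r (?t x)" if "x \<in> V" for x
  proof -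
    from that obtain P where P: "P \<in> fst c1" "P \<in> fst c" "snd c P \<in> W" "x = snd c1 P" unfolding V by blast
    then show ?thesis using f[of P] by (simp add: wc(4) coord_rep_def pc1(4))
  qed
  have 2: "coord_rep d1 c1 g y = coord_rep c c1 id (coord_rep d1 d id y)" if "y \<in> (\<lambda>x. ?r (?t x)) ` V" for y
  proof -
    from that obtain x where x: "x \<in> V" "y = ?r (?t x)" by blast
    have z: "?t x \<in> W" "?t x \<in> ?R" using tV x(1) by auto
    let ?Q = "chart_inv d (?t x)"
    have Q: "?Q \<in> fst d1" "?Q \<in> fst d" "snd d ?Q = ?t x" using pd(5,6,7)[OF z(2)] by auto
    then have "g ?Q = chart_inv c (?t x)" using g[of ?Q] z(1) by simp
    moreover have "chart_inv d1 y = ?Q" using x(2) pd1(4)[OF Q(1)] by (simp add: coord_rep_def)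
    ultimately show ?thesis using Q(3) by (simp add: coord_rep_def)
  qed
  show "pdiff V (coord_rep c1 d1 f) (coord_rep d1 c1 g)"
    by (rule pdiff_cong[OF pdiff_compose[OF p1 p2 tV]]) (use 1 2 in auto)
  have "transforms V ?t (gam M c1) (gam M c)"
    by (rule transforms_subset[OF coord_change(2)[OF M c1 c] sub])
  then have t1: "transforms V ?t (gam M c1) (gam N d)"
    using G tV
      transforms_cong[OF oV, where t = ?t and t' = ?t and G = "gam M c1" and H = "gam M c1" and G' = "gam M c" and H' = "gam N d"]
    by (auto simp: image_subset_iff)
  have "transforms V (\<lambda>x. ?r (?t x)) (gam M c1) (gam N d1)"
    by (rule transforms_compose[OF oV pdiffD(3)[OF p1] oWR pdiffD(3)[OF p2] tV t1])
       (rule transforms_subset[OF coord_change(2)[OF N d d1]], simp)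
  then show "transforms V (coord_rep c1 d1 f) (gam M c1) (gam N d1)"
    using 1 transforms_cong[OF oV, where t = "coord_rep c1 d1 f" and t' = "\<lambda>x. ?r (?t x)" and G = "gam M c1"
        and H = "gam M c1" and G' = "gam N d1" and H' = "gam N d1"] by simp
qed

text \<open>The isomorphism identifies points with equal coordinates in \<open>c\<close> and
  \<open>d\<close>. Its domain corresponds to the intersection \<open>W\<close> of the coordinate
  images, which contains the common coordinates of \<open>P\<close> and \<open>Q\<close>.\<close>

lemma affine_diffeo_from_charts:
  assumes M: "affine_surface M" and N: "affine_surface N" and c: "c \<in> charts M" and d: "d \<in> charts N"
    and P: "P \<in> fst c" and Q: "Q \<in> fst d" and PQ: "snd c P = snd d Q"
    and Gc: "\<And>x. x \<in> chart_image c UNIV \<Longrightarrow> gam M c x = G x"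
    and Gd: "\<And>x. x \<in> chart_image d UNIV \<Longrightarrow> gam N d x = G x"
  shows "\<exists>U f. P \<in> U \<and> affine_diffeo M N U f \<and> f P = Q"
proof -
  note am = affine_surfaceD[OF M] and an = affine_surfaceD[OF N]
  note ic = am(1)[OF c] and id = an(1)[OF d]
  note pc = is_chartD[OF ic] and pd = is_chartD[OF id]
  define W where "W = chart_image c UNIV \<inter> chart_image d UNIV"
  define U where "U = chart_inv c ` W"
  define f where "f = (\<lambda>P. chart_inv d (snd c P))"
  have W: "open W" "W \<subseteq> chart_image c UNIV" "W \<subseteq> chart_image d UNIV"
    using pc(9) pd(9) by (auto simp: W_def)
  have PW: "snd c P \<in> W" using pc(8)[OF P, of UNIV] pd(8)[OF Q, of UNIV] PQ by (simp add: W_def)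
  note wc = open_chart_inv_image[OF ic W(1,2)] and wd = open_chart_inv_image[OF id W(1,3)]
  have PU: "P \<in> U" unfolding U_def using wc(4) P PW by simp
  have fP: "f P = Q" using PQ pd(4)[OF Q] by (simp add: f_def)
  have fU: "f ` U = chart_inv d ` W"
    unfolding U_def f_def image_image by (rule image_cong) (use pc(5) W(2) in auto)
  have ginv: "inv_into U f R = chart_inv c (snd d R)" if "R \<in> chart_inv d ` W" for R
  proof -
    from that obtain z where z: "z \<in> W" "R = chart_inv d z" by blast
    have "snd d R = z" using pd(5) z W(3) by blast
    moreover have "f (chart_inv c z) = R" using pc(5) z W(2) by (auto simp: f_def)
    moreover have "inj_on f U"
    proof (rule inj_onI)
      fix A B assume AB: "A \<in> U" "B \<in> U" "f A = f B"
      then have "snd c A \<in> W" "snd c B \<in> W" "A \<in> fst c" "B \<in> fst c" using wc(2,4) U_def by auto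
      then show "A = B" using AB(3) pd(5) W(3) pc(4) unfolding f_def by (metis subset_iff)
    qed
    ultimately show ?thesis using z(1) by (metis U_def image_eqI inv_into_f_f)
  qed
  have f': "f A = chart_inv d (snd c A)" if "A \<in> chart_inv c ` W" for A by (simp add: f_def)
  have G: "gam M c x = gam N d x" if "x \<in> W" for x
  proof -
    have "x \<in> chart_image c UNIV" "x \<in> chart_image d UNIV" using that W by auto
    then show ?thesis by (simp add: Gc Gd)
  qed
  note tr = transition[OF M N c d W G f' ginv]
  note tr' = transition[OF N M d c W(1,3,2) G[symmetric] ginv f']
  have im: "inv_into U f ` chart_inv d ` W = U"
  proof -
    have "inv_into U f ` chart_inv d ` W = (\<lambda>z. chart_inv c (snd d (chart_inv d z))) ` W"
      unfolding image_image by (rule image_cong) (simp_all add: ginv)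
    also have "\<dots> = U" unfolding U_def by (rule image_cong) (use pd(5) W(3) in auto)
    finally show ?thesis .
  qed
  have diff: "diffeo M N U f"
    unfolding diffeo_def
  proof (intro conjI)
    show "open U" "open (f ` U)" unfolding fU using wc(1) wd(1) by (auto simp: U_def)
    show "U \<subseteq> points M" "f ` U \<subseteq> points N" unfolding fU using wc(2) wd(2) c d by (auto simp: U_def points_def)
    show "homeomorphism U (f ` U) f (inv_into U f)"
      unfolding homeomorphism_def
    proof (intro conjI ballI)
      show "continuous_on U f"
        unfolding f_def
        by (rule continuous_on_compose2[OF pd(3) continuous_on_subset[OF pc(2)]])
           (use wc(2) wc(4) W in \<open>auto simp: U_def\<close>)
      have "continuous_on (f ` U) (\<lambda>R. chart_inv c (snd d R))"
        unfolding fU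
        by (rule continuous_on_compose2[OF pc(3) continuous_on_subset[OF pd(2)]])
           (use wd(2) wd(4) W in auto)
      then show "continuous_on (f ` U) (inv_into U f)"
        by (simp add: fU ginv cong: continuous_on_cong_simp)
      show "inv_into U f ` f ` U = U" unfolding fU by (rule im)
      fix A assume A: "A \<in> U"
      then have "A \<in> fst c" "snd c A \<in> W" using wc(2,4) by (auto simp: U_def)
      then have "snd d (f A) = snd c A" "f A \<in> chart_inv d ` W" using pd(5) W(3) by (auto simp: f_def)
      then show "inv_into U f (f A) = A" using ginv pc(4)[OF \<open>A \<in> fst c\<close>] by simp
    qed (auto simp: f_inv_into_f)
    show "smooth_map M N U f"
      unfolding smooth_map_def U_def using pdiffD(3)[OF tr(1)] by (auto simp: U_def)
    show "smooth_map N M (f ` U) (inv_into U f)"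
      unfolding smooth_map_def fU using pdiffD(3)[OF tr'(1)] by auto
  qed
  have "affine_diffeo M N U f"
    unfolding affine_diffeo_def
    using diff tr preserves_connection_iff_tl[OF tr(1)] by (auto simp: U_def)
  with PU fP show ?thesis by blast
qed

lemma affine_diffeo_coordinates:
  assumes M: "affine_surface M" and N: "affine_surface N" and f: "affine_diffeo M N U f"
    and c: "c \<in> charts M" and d: "d \<in> charts N"
  defines "V \<equiv> chart_image c (U \<inter> f -` fst d)"
  shows "pdiff V (coord_rep c d f) (coord_rep d c (inv_into U f))"
    and "transforms V (coord_rep c d f) (gam M c) (gam N d)"
proof -
  note am = affine_surfaceD[OF M] and an = affine_surfaceD[OF N]
  note ic = am(1)[OF c] and id = an(1)[OF d]
  note pc = is_chartD[OF ic] and pd = is_chartD[OF id]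
  let ?g = "inv_into U f"
  have df: "open U" "open (f ` U)" "homeomorphism U (f ` U) f ?g" "smooth_map M N U f" "smooth_map N M (f ` U) ?g"
    using f by (auto simp: affine_diffeo_def diffeo_def)
  have cf: "continuous_on U f" "continuous_on (f ` U) ?g" and gf: "\<And>A. A \<in> U \<Longrightarrow> ?g (f A) = A"
    using df(3) by (auto simp: homeomorphism_def)
  let ?V' = "chart_image d (f ` U \<inter> ?g -` fst c)"
  have im: "coord_rep c d f ` V = ?V'"
  proof
    show "coord_rep c d f ` V \<subseteq> ?V'"
      by (auto simp: V_def chart_image_def coord_rep_def pc(4) gf)
    show "?V' \<subseteq> coord_rep c d f ` V"
    proof
      fix y assume "y \<in> ?V'"
      then obtain A where A: "A \<in> U" "f A \<in> fst d" "A \<in> fst c" "y = snd d (f A)"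
        by (auto simp: chart_image_def gf)
      then have "y = coord_rep c d f (snd c A)" "snd c A \<in> V"
        by (auto simp: coord_rep_def pc(4) V_def chart_image_def)
      then show "y \<in> coord_rep c d f ` V" by blast
    qed
  qed
  have "open V" unfolding V_def
    by (rule open_chart_image[OF ic continuous_open_preimage[OF cf(1) df(1) pd(1)]])
  moreover have "open ?V'"
    by (rule open_chart_image[OF id continuous_open_preimage[OF cf(2) df(2) pc(1)]])
  moreover have "smooth_on V (coord_rep c d f)" "smooth_on ?V' (coord_rep d c ?g)"
    using df(4,5) c d by (auto simp: smooth_map_def V_def)
  moreover have "coord_rep d c ?g (coord_rep c d f x) = x" if "x \<in> V" for x
    using that by (auto simp: V_def chart_image_def coord_rep_def pc(4) pd(4) gf)
  ultimately show p: "pdiff V (coord_rep c d f) (coord_rep d c ?g)"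
    unfolding pdiff_def im by blast
  show "transforms V (coord_rep c d f) (gam M c) (gam N d)"
  proof -
    have "preserves_connection V (coord_rep c d f) (gam M c) (gam N d)"
      using f c d by (simp add: affine_diffeo_def V_def)
    then show ?thesis using preserves_connection_iff_tl[OF p] by simp
  qed
qed

text \<open>The invariants are defined through an arbitrary witness. Homogeneity carries its base
  point to \<open>P\<close>, where the witness vector has some second component \<open>k\<close>;
  the factors \<open>(k^3)^2\<close> and \<open>(k^2)^3\<close> cancel in the quotient, and
  \<open>k^2\<close> does not affect the sign.\<close>

lemma invariants_at_chart:
  assumes M: "affine_surface M" and hom: "locally_homogeneous M" and c: "c \<in> charts M" and P: "P \<in> fst c"
    and ric: "\<And>v. ricci (gam M c) (snd c P) v v = r * (v $ 2)\<^sup>2" and r: "r \<noteq> 0"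
    and nab: "\<And>v. nabla_ricci_at (gam M c) (snd c P) v v v = n * (v $ 2) ^ 3"
  shows "alpha_inv M = n\<^sup>2 / r ^ 3" "eps_inv M = sgn r"
proof -
  note am = affine_surfaceD[OF M]
  obtain P0 c0 v0 where w: "ricci_witness M = (P0, c0, v0)" by (metis prod_cases3)
  have "(\<lambda>(P, c, v). c \<in> charts M \<and> P \<in> fst c \<and> ricci (gam M c) (snd c P) v v \<noteq> 0) (P, c, axis 2 1)"
    using c P ric r by (simp add: axis_def)
  then have "(\<lambda>(P, c, v). c \<in> charts M \<and> P \<in> fst c \<and> ricci (gam M c) (snd c P) v v \<noteq> 0) (ricci_witness M)"
    unfolding ricci_witness_def by (rule someI)
  then have w0: "c0 \<in> charts M" "P0 \<in> fst c0" "ricci (gam M c0) (snd c0 P0) v0 v0 \<noteq> 0" by (auto simp: w)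
  have "P0 \<in> points M" "P \<in> points M" using w0 c P by (auto simp: points_def)
  then obtain U f where f: "P0 \<in> U" "affine_diffeo M M U f" "f P0 = P"
    using hom unfolding locally_homogeneous_def by blast
  define V where "V = chart_image c0 (U \<inter> f -` fst c)"
  define t where "t = coord_rep c0 c f"
  define s where "s = coord_rep c c0 (inv_into U f)"
  note cc = affine_diffeo_coordinates[OF M M f(2) w0(1) c, folded V_def t_def s_def]
  let ?x = "snd c0 P0"
  have x: "?x \<in> V" using f w0 P by (auto simp: V_def chart_image_def)
  have tx: "t ?x = snd c P" using f w0 is_chartD(4)[OF am(1)[OF w0(1)] w0(2)] by (simp add: t_def coord_rep_def)
  have G: "smooth_on V (gam M c0)"
    by (rule smooth_subset[OF am(4)[OF w0(1)]]) (auto simp: V_def chart_image_def)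
  have tV: "t ` V \<subseteq> chart_image c UNIV"
    using is_chartD(4)[OF am(1)[OF w0(1)]] by (auto simp: V_def chart_image_def t_def coord_rep_def)
  have G': "smooth_on (t ` V) (gam M c)"
    by (rule smooth_subset[OF am(4)[OF c] tV])
  define k where "k = fd t ?x v0 $ 2"
  have R: "ricci (gam M c0) ?x v0 v0 = r * k\<^sup>2"
    using ricci_natural[OF cc G G' x, of v0 v0] ric by (simp add: tx k_def)
  have Nb: "nabla_ricci_at (gam M c0) ?x v0 v0 v0 = n * k ^ 3"
    using nabla_ricci_natural[OF cc G G' x, of v0 v0 v0] nab by (simp add: tx k_def)
  have k: "k \<noteq> 0" using R w0(3) by auto
  show "alpha_inv M = n\<^sup>2 / r ^ 3"
    using k r by (simp add: alpha_inv_def w R Nb field_simps power_mult_distrib flip: power_mult)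
  show "eps_inv M = sgn r"
  proof -
    have "sgn (k\<^sup>2) = 1" using k by (intro sgn_pos) simp
    then show ?thesis unfolding eps_inv_def w by (simp only: prod.case R sgn_mult mult_1_right)
  qed
qed

section \<open>The model connection\<close>

definition vec2 :: "real \<Rightarrow> real \<Rightarrow> real^2" where
  "vec2 a b = a *\<^sub>R axis 1 1 + b *\<^sub>R axis 2 1"

lemma vec2_nth [simp]: "vec2 a b $ 1 = a" "vec2 a b $ 2 = b"
  by (simp_all add: vec2_def axis_def)

lemma vec2_eq_iff: "(u::real^2) = v \<longleftrightarrow> u $ 1 = v $ 1 \<and> u $ 2 = v $ 2"
  by (simp add: vec_eq_iff forall_2)

lemma has_derivative_nth_real:
  assumes "\<And>y. (u has_real_derivative u' y) (at y)"
  shows "((\<lambda>x::real^2. u (x $ i)) has_derivative (\<lambda>v. u' (x $ i) * v $ i)) (at x)"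
  by (rule has_derivative_compose[OF bounded_linear.has_derivative[OF bounded_linear_vec_nth has_derivative_ident]])
     (use assms in \<open>simp add: has_field_derivative_def\<close>)

lemma has_derivative_vec2:
  assumes "(f has_derivative f') F" "(g has_derivative g') F"
  shows "((\<lambda>x. vec2 (f x) (g x)) has_derivative (\<lambda>h. vec2 (f' h) (g' h))) F"
  unfolding vec2_def by (intro has_derivative_add has_derivative_scaleR_left assms)

lemma smooth_vec2:
  "open V \<Longrightarrow> smooth_on V f \<Longrightarrow> smooth_on V g \<Longrightarrow> smooth_on V (\<lambda>x. vec2 (f x) (g x))"
  unfolding vec2_def by (intro smooth_add smooth_scaleR smooth_const)

lemma smooth_nth_real:
  assumes "open V" "smooth_on UNIV (u :: real \<Rightarrow> real)"
  shows "smooth_on V (\<lambda>x::real^2. u (x $ i))"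
  by (rule smooth_compose[OF assms(1) open_UNIV smooth_vec_nth[OF assms(1) smooth_ident] assms(2)]) simp

section \<open>Constant Christoffel symbols and their linear normalisation\<close>

definition sym3 :: "real^2 \<Rightarrow> real^2 \<Rightarrow> real^2 \<Rightarrow> real^2^2^2" where
  "sym3 p q r = (\<chi> i j. if i = 1 \<and> j = 1 then p else if i = 2 \<and> j = 2 then r else q)"

lemma christ_sym3:
  "christ (sym3 p q r) u v = (u $ 1 * v $ 1) *\<^sub>R p + (u $ 1 * v $ 2 + u $ 2 * v $ 1) *\<^sub>R q + (u $ 2 * v $ 2) *\<^sub>R r"
  by (simp add: christ_def sum_2 sym3_def algebra_simps)

lemma symmetric_sym3:
  assumes "\<And>u v. christ A u v = christ A v u"
  obtains p q r where "A = sym3 p q r"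
proof
  have "A $ i $ j = A $ j $ i" for i j using assms christ_axis by metis
  then show "A = sym3 (A $ 1 $ 1) (A $ 1 $ 2) (A $ 2 $ 2)"
    by (simp add: vec_eq_iff forall_2 sym3_def)
qed

lemma constant_connection:
  assumes V: "open V" and G: "\<And>x. x \<in> V \<Longrightarrow> G x = sym3 p q r" and x: "x \<in> V"
  shows "smooth_on V G" "fd G x = (\<lambda>_. 0)"
    "ricci G x u v = u $ 1 * v $ 1 * ((p $ 1 - q $ 2) * q $ 2 + p $ 2 * (r $ 2 - q $ 1))
      + (u $ 1 * v $ 2 + u $ 2 * v $ 1) * (q $ 1 * q $ 2 - p $ 2 * r $ 1)
      + u $ 2 * v $ 2 * (q $ 1 * (r $ 2 - q $ 1) + (p $ 1 - q $ 2) * r $ 1)"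
proof -
  show sm: "smooth_on V G" using smooth_cong[OF V, of G "\<lambda>_. sym3 p q r"] G smooth_const by blast
  show fd: "fd G x = (\<lambda>_. 0)"
    using fd_cong(1)[OF V x, of G "\<lambda>_. sym3 p q r"] G by simp
  show "ricci G x u v = u $ 1 * v $ 1 * ((p $ 1 - q $ 2) * q $ 2 + p $ 2 * (r $ 2 - q $ 1))
      + (u $ 1 * v $ 2 + u $ 2 * v $ 1) * (q $ 1 * q $ 2 - p $ 2 * r $ 1)
      + u $ 2 * v $ 2 * (q $ 1 * (r $ 2 - q $ 1) + (p $ 1 - q $ 2) * r $ 1)"
    unfolding ricci_curvt[OF V sm x] curvt_def fd G[OF x] christ_simps christ_sym3
    by (simp add: sum_2 axis_def algebra_simps)
qed

text \<open>The Ricci tensor is a constant multiple of the square of the second coordinate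
  differential. Its covariant derivative hence sees only the second component of the Christoffel
  symbols, and of these only \<open>d\<close> is nonzero.\<close>

lemma adapted_connection:
  assumes V: "open V" and G: "\<And>x. x \<in> V \<Longrightarrow> G x = sym3 (vec2 a 0) (vec2 b 0) (vec2 c d)" and x: "x \<in> V"
  shows "ricci G x v v = (b * (d - b) + a * c) * (v $ 2)\<^sup>2"
    "nabla_ricci_at G x v v v = - 2 * d * (b * (d - b) + a * c) * (v $ 2) ^ 3"
proof -
  note R = constant_connection(3)[OF V G]
  show "ricci G x v v = (b * (d - b) + a * c) * (v $ 2)\<^sup>2"
    using R[OF _ x] by (simp add: power2_eq_square algebra_simps)
  have "fd (\<lambda>y. ricci G y v v) x = fd (\<lambda>y. ricci G x v v) x"
    by (rule fd_cong(1)[OF V x]) (simp add: R x)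
  then show "nabla_ricci_at G x v v v = - 2 * d * (b * (d - b) + a * c) * (v $ 2) ^ 3"
    by (simp add: nabla_ricci_at_eq R x G christ_sym3 power3_eq_cube algebra_simps)
qed

text \<open>The new coordinates are \<open>S (x - x0)\<close>: the translation puts \<open>P\<close>
  at 0, and for an affine map the second derivatives vanish, so the constant symbols transform as a
  tensor and stay constant.\<close>

lemma linear_chart:
  assumes M: "affine_surface M" and c: "c \<in> charts M" and P: "P \<in> fst c"
    and G: "\<And>x. x \<in> chart_image c UNIV \<Longrightarrow> gam M c x = C"
    and S: "linear S" "linear T" "\<And>x. T (S x) = x" "\<And>y. S (T y) = y"
  obtains c' p q r where "c' \<in> charts M" "P \<in> fst c'" "snd c' P = 0"
    "\<And>y. y \<in> chart_image c' UNIV \<Longrightarrow> gam M c' y = sym3 p q r"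
    "\<And>u v. christ (sym3 p q r) (S u) (S v) = S (christ C u v)"
    "\<And>u v. ricci (gam M c') 0 (S u) (S v) = ricci (gam M c) (snd c P) u v"
proof -
  note am = affine_surfaceD[OF M]
  note ic = am(1)[OF c]
  note pc = is_chartD[OF ic]
  let ?W = "chart_image c UNIV"
  define x0 where "x0 = snd c P"
  have x0: "x0 \<in> ?W" using pc(8)[OF P] by (simp add: x0_def)
  define F where "F x = S (x - x0)" for x
  define H where "H y = T y + x0" for y
  have bl: "bounded_linear S" "bounded_linear T" using S(1,2) by (auto simp: linear_conv_bounded_linear)
  have HF: "H (F x) = x" "F (H y) = y" for x y using S(3,4) by (simp_all add: F_def H_def)
  have dF: "fd F x = S" for x
    by (rule fd_eqI) (auto simp: F_def[abs_def] intro!: derivative_eq_intros bounded_linear.has_derivative[OF bl(1)])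
  have smF: "smooth_on V F" "smooth_on V H" if "open V" for V
    unfolding F_def[abs_def] H_def[abs_def]
    by (intro smooth_linear_compose[OF bl(1)] smooth_linear_compose[OF bl(2)] smooth_diff smooth_add
        smooth_ident smooth_const that)+
  have "F ` ?W = H -` ?W"     using HF by (auto intro: image_eqI[of _ F "H _"])
  moreover have "open (H -` ?W)"
    by (rule open_vimage[OF pc(9) smooth_continuous[OF smF(2)[OF open_UNIV]]])
  ultimately have pF: "pdiff ?W F H"
    unfolding pdiff_def using smF pc(9) HF by simp
  define C' where "C' = (\<chi> i j. S (christ C (T (axis i 1)) (T (axis j 1))))"
  have C': "christ C' u v = S (christ C (T u) (T v))" for u v
  proof -
    have l: "linear (\<lambda>u. S (christ C (T u) (T v)))" "linear (\<lambda>u. S (christ C (T v) (T u)))" for v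
      by (auto intro!: linearI simp: linear_add[OF S(1)] linear_add[OF S(2)] linear_cmul[OF S(1)] linear_cmul[OF S(2)] christ_simps)
    have 1: "S (christ C (T u) (T v)) = (\<Sum>i\<in>UNIV. u $ i *\<^sub>R S (christ C (T (axis i 1)) (T v)))"
      by (subst vec2_expand[of u]) (simp add: linear_add[OF l(1)] linear_cmul[OF l(1)] sum_2)
    have 2: "S (christ C (T (axis i 1)) (T v)) =
        (\<Sum>j\<in>UNIV. v $ j *\<^sub>R S (christ C (T (axis i 1)) (T (axis j 1))))" for i
      by (subst vec2_expand[of v]) (simp add: linear_add[OF l(2)] linear_cmul[OF l(2)] sum_2)
    show ?thesis
      unfolding 1 2 christ_def[of C'] by (simp add: C'_def scaleR_sum_right)
  qed
  have tlF: "transforms ?W F (gam M c) (\<lambda>_. C')"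
    unfolding transforms_def dF by (simp add: C' S(3) G)
  obtain c' where c': "c' \<in> charts M" "fst c' = chart_inv c ` ?W"
    "\<And>P. P \<in> fst c' \<Longrightarrow> snd c' P = F (snd c P)" "chart_image c' UNIV = F ` ?W"
    "\<And>y. y \<in> F ` ?W \<Longrightarrow> gam M c' y = C'"
    using new_chart[OF M c pF _ tlF] by blast
  have P': "P \<in> fst c'" unfolding c'(2) using x0 pc(4)[OF P] by (auto simp: x0_def intro!: image_eqI[of P _ "snd c P"])
  have z: "F x0 = 0" "snd c' P = 0" using c'(3)[OF P'] linear_0[OF S(1)] by (auto simp: F_def x0_def)
  have 0: "0 \<in> F ` ?W" using z x0 by (metis image_eqI)
  have "christ C' u v = christ C' v u" for u v
    using am(5)[OF c'(1)] 0 c'(4,5) unfolding sym_on_def by metis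
  then obtain p q r where pqr: "C' = sym3 p q r" using symmetric_sym3 by blast
  have "ricci (gam M c') 0 (S u) (S v) = ricci (gam M c) (snd c P) u v" for u v
  proof -
    have t: "transforms ?W F (gam M c) (gam M c')"
      using tlF transforms_cong[OF pc(9), where t = F and t' = F and G = "gam M c" and H = "gam M c"
          and G' = "gam M c'" and H' = "\<lambda>_. C'"] c'(5) by simp
    have "smooth_on (F ` ?W) (gam M c')" using am(4)[OF c'(1)] c'(4) by simp
    from ricci_natural[OF pF t am(4)[OF c] this x0] show ?thesis
      by (simp add: dF z) (simp add: x0_def)
  qed
  then show ?thesis
    using that[OF c'(1) P' z(2), of p q r] c'(4,5) C' S(3) pqr by auto
qed

text \<open>A nonzero symmetric form with vanishing determinant is plus or minus the square of a
  covector. Scaling by the square root of the absolute value of a diagonal entry leaves only the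
  sign \<open>\<sigma>\<close>.\<close>

lemma rank_one_form:
  fixes a b c :: real
  assumes "a * c = b * b" "a \<noteq> 0 \<or> b \<noteq> 0 \<or> c \<noteq> 0"
  obtains \<omega>1 \<omega>2 \<sigma> where "a = \<sigma> * \<omega>1 * \<omega>1" "b = \<sigma> * \<omega>1 * \<omega>2" "c = \<sigma> * \<omega>2 * \<omega>2"
    "\<sigma> = 1 \<or> \<sigma> = - 1" "\<omega>1 * \<omega>1 + \<omega>2 * \<omega>2 \<noteq> 0"
proof (cases "a = 0")
  case True
  then have "b = 0" "c \<noteq> 0" using assms by auto
  moreover have "c = sgn c * sqrt \<bar>c\<bar> * sqrt \<bar>c\<bar>" by (simp add: mult.assoc sgn_mult_abs)
  ultimately show ?thesis using True that[of "sgn c" 0 "sqrt \<bar>c\<bar>"] by (auto simp: sgn_if)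
next
  case False
  define k where "k = sqrt \<bar>a\<bar>"
  have k: "k > 0" "k * k = \<bar>a\<bar>" using False by (simp_all add: k_def)
  have s: "sgn a = 1 \<or> sgn a = - 1" "sgn a * sgn a = 1" "sgn a * \<bar>a\<bar> = a"
    using False by (auto simp: sgn_if)
  have 1: "a = sgn a * k * k" using k s by (simp add: mult.assoc)
  have 2: "b = sgn a * k * (sgn a * b / k)" using k s by (simp add: field_simps)
  have "sgn a * (sgn a * b / k) * (sgn a * b / k) = sgn a * (b * b) / (k * k)"
    using s by (simp add: field_simps)
  also have "\<dots> = sgn a * a * c / \<bar>a\<bar>" using assms(1) k by simp
  also have "\<dots> = c" using False by (auto simp: sgn_if)
  finally have 3: "c = sgn a * (sgn a * b / k) * (sgn a * b / k)" by simp
  have "k * k + (sgn a * b / k) * (sgn a * b / k) > 0"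
    using k(1) by (intro add_pos_nonneg) auto
  then show ?thesis using that[OF 1 2 3 s(1)] by linarith
qed

lemma rank_one_matrix:
  fixes A :: "real^2^2"
  assumes "rank A = 1"
  shows "A $ 1 $ 1 * A $ 2 $ 2 = A $ 1 $ 2 * A $ 2 $ 1" "A \<noteq> 0"
proof -
  have "det A = 0" using assms by (simp add: det_eq_0_rank)
  then show "A $ 1 $ 1 * A $ 2 $ 2 = A $ 1 $ 2 * A $ 2 $ 1" by (simp add: det_2)
  show "A \<noteq> 0" using assms rank_eq_0[of A] by auto
qed

text \<open>If \<open>\<partial>\<^sub>1\<close> spans the kernel of the Ricci tensor, then the equations \<open>\<rho>\<^sub>1\<^sub>1 = \<rho>\<^sub>1\<^sub>2 = 0\<close> are linear in
  \<open>(\<Gamma>\<^sub>1\<^sub>1\<^sup>2, \<Gamma>\<^sub>1\<^sub>2\<^sup>2)\<close> with determinant \<open>- \<rho>\<^sub>2\<^sub>2\<close>, so both symbols vanish.\<close>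

lemma adapted_chart:
  assumes M: "affine_surface M" and A: "type_A M" and rk: "ricci_rank M 1" and P: "P \<in> points M"
  obtains k a b c d where "k \<in> charts M" "P \<in> fst k" "snd k P = 0"
    "\<And>x. x \<in> chart_image k UNIV \<Longrightarrow> gam M k x = sym3 (vec2 a 0) (vec2 b 0) (vec2 c d)"
    "b * (d - b) + a * c = 1 \<or> b * (d - b) + a * c = -1" "d \<ge> 0"
proof -
  note am = affine_surfaceD[OF M]
  obtain k C where k: "k \<in> charts M" "P \<in> fst k" "\<And>x. x \<in> chart_image k UNIV \<Longrightarrow> gam M k x = C"
    using A P unfolding type_A_def by blast
  note pk = is_chartD[OF am(1)[OF k(1)]]
  have x0: "snd k P \<in> chart_image k UNIV" using pk(8)[OF k(2)] by simp
  have "christ C u v = christ C v u" for u v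
    using am(5)[OF k(1)] x0 k(3) unfolding sym_on_def by metis
  then obtain p q r where pqr: "C = sym3 p q r" using symmetric_sym3 by blast
  have G: "gam M k x = sym3 p q r" if "x \<in> chart_image k UNIV" for x using k(3)[OF that] pqr by simp
  define e1 where "e1 = (p $ 1 - q $ 2) * q $ 2 + p $ 2 * (r $ 2 - q $ 1)"
  define e2 where "e2 = q $ 1 * q $ 2 - p $ 2 * r $ 1"
  define e3 where "e3 = q $ 1 * (r $ 2 - q $ 1) + (p $ 1 - q $ 2) * r $ 1"
  have ric: "ricci (gam M k) (snd k P) u v = u $ 1 * v $ 1 * e1 + (u $ 1 * v $ 2 + u $ 2 * v $ 1) * e2 + u $ 2 * v $ 2 * e3" for u v
    using constant_connection(3)[OF pk(9) G x0] by (simp add: e1_def e2_def e3_def)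
  let ?A = "ricci_matrix (gam M k) (snd k P)"
  have entries: "?A $ 1 $ 1 = e1" "?A $ 1 $ 2 = e2" "?A $ 2 $ 1 = e2" "?A $ 2 $ 2 = e3"
    by (simp_all add: ricci_matrix_def ric axis_def)
  have "rank ?A = 1" using rk k(1) x0 by (simp add: ricci_rank_def)
  from rank_one_matrix[OF this] have "e1 * e3 = e2 * e2" "e1 \<noteq> 0 \<or> e2 \<noteq> 0 \<or> e3 \<noteq> 0"
    using entries by (auto simp: vec_eq_iff forall_2)
  then obtain w1 w2 \<sigma> where w: "e1 = \<sigma> * w1 * w1" "e2 = \<sigma> * w1 * w2" "e3 = \<sigma> * w2 * w2"
    "\<sigma> = 1 \<or> \<sigma> = - 1" "w1 * w1 + w2 * w2 \<noteq> 0"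
    using rank_one_form by metis
  define D where "D = w1 * w1 + w2 * w2"
  \<comment> \<open>The second new coordinate is the covector \<open>(w1, w2)\<close> whose signed
    square is the Ricci tensor, the first an orthogonal one. \<open>S\<close> is a rotation up to
    scale with determinant \<open>D\<close>.\<close>
  define S where "S v = vec2 (w2 * v $ 1 - w1 * v $ 2) (w1 * v $ 1 + w2 * v $ 2)" for v :: "real^2"
  define T where "T v = vec2 ((w2 * v $ 1 + w1 * v $ 2) / D) ((w2 * v $ 2 - w1 * v $ 1) / D)" for v :: "real^2"
  have lin: "linear S" "linear T"
    by (auto intro!: linearI simp: S_def T_def vec2_eq_iff algebra_simps add_divide_distrib diff_divide_distrib)
  have D: "D \<noteq> 0" using w(5) by (simp add: D_def)
  have TS: "T (S x) = x" "S (T x) = x" for x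
  proof -
    have "w2 * (w2 * x $ 1 - w1 * x $ 2) + w1 * (w1 * x $ 1 + w2 * x $ 2) = D * x $ 1"
      "w2 * (w1 * x $ 1 + w2 * x $ 2) - w1 * (w2 * x $ 1 - w1 * x $ 2) = D * x $ 2"
      by (simp_all add: D_def algebra_simps)
    then show "T (S x) = x" using D by (simp add: T_def S_def vec2_eq_iff)
    have "w2 * (w2 * x $ 1 + w1 * x $ 2) - w1 * (w2 * x $ 2 - w1 * x $ 1) = D * x $ 1"
      "w1 * (w2 * x $ 1 + w1 * x $ 2) + w2 * (w2 * x $ 2 - w1 * x $ 1) = D * x $ 2"
      by (simp_all add: D_def algebra_simps)
    then have "(w2 * (w2 * x $ 1 + w1 * x $ 2) - w1 * (w2 * x $ 2 - w1 * x $ 1)) / D = x $ 1"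
      "(w1 * (w2 * x $ 1 + w1 * x $ 2) + w2 * (w2 * x $ 2 - w1 * x $ 1)) / D = x $ 2"
      using D by simp_all
    then show "S (T x) = x"
      by (simp only: T_def S_def vec2_eq_iff vec2_nth times_divide_eq_right
          flip: diff_divide_distrib add_divide_distrib)
  qed
  obtain k' p' q' r' where k': "k' \<in> charts M" "P \<in> fst k'" "snd k' P = 0"
    "\<And>y. y \<in> chart_image k' UNIV \<Longrightarrow> gam M k' y = sym3 p' q' r'"
    "\<And>u v. ricci (gam M k') 0 (S u) (S v) = ricci (gam M k) (snd k P) u v"
    using linear_chart[OF M k lin TS] by metis
  note pk' = is_chartD[OF am(1)[OF k'(1)]]
  have x0': "0 \<in> chart_image k' UNIV" using pk'(8)[OF k'(2), of UNIV] k'(3) by simp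
  have ric': "ricci (gam M k') 0 u v = \<sigma> * u $ 2 * v $ 2" for u v
  proof -
    have "ricci (gam M k') 0 (S (T u)) (S (T v)) = \<sigma> * S (T u) $ 2 * S (T v) $ 2"
      unfolding k'(5) unfolding ric S_def w(1,2,3) by (simp add: algebra_simps)
    then show ?thesis by (simp only: TS)
  qed
  note R = constant_connection(3)[where G = "gam M k'", OF pk'(9) k'(4) x0']
  have e: "(p' $ 1 - q' $ 2) * q' $ 2 + p' $ 2 * (r' $ 2 - q' $ 1) = 0" "q' $ 1 * q' $ 2 - p' $ 2 * r' $ 1 = 0"
    "q' $ 1 * (r' $ 2 - q' $ 1) + (p' $ 1 - q' $ 2) * r' $ 1 = \<sigma>"
    using R[where u = "axis 1 1" and v = "axis 1 1"] R[where u = "axis 1 1" and v = "axis 2 1"]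
      R[where u = "axis 2 1" and v = "axis 2 1"]
    by (simp_all add: ric' axis_def)
  have "\<sigma> * q' $ 2 = 0" "\<sigma> * p' $ 2 = 0" using e by algebra+
  then have pq: "p' $ 2 = 0" "q' $ 2 = 0" using w(4) by auto
  have f: "p' = vec2 (p' $ 1) 0" "q' = vec2 (q' $ 1) 0" "r' = vec2 (r' $ 1) (r' $ 2)"
    using pq by (simp_all add: vec2_eq_iff)
  have \<sigma>: "q' $ 1 * (r' $ 2 - q' $ 1) + p' $ 1 * r' $ 1 = 1 \<or> q' $ 1 * (r' $ 2 - q' $ 1) + p' $ 1 * r' $ 1 = - 1"
    using e(3) w(4) pq by simp
  show ?thesis
  proof (cases "r' $ 2 \<ge> 0")
    case True
    then show ?thesis using that[OF k'(1,2,3), of "p' $ 1" "q' $ 1" "r' $ 1" "r' $ 2"] k'(4) f \<sigma> by simp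
  next
    case False
    \<comment> \<open>The reflection \<open>x \<mapsto> - x\<close> negates all Christoffel symbols
      and keeps the Ricci tensor, which is quadratic in them. This achieves
      \<open>d \<ge> 0\<close>.\<close>
    have lin: "linear (\<lambda>v::real^2. - v)" by (auto intro!: linearI)
    obtain k2 p2 q2 r2 where k2: "k2 \<in> charts M" "P \<in> fst k2" "snd k2 P = 0"
      "\<And>y. y \<in> chart_image k2 UNIV \<Longrightarrow> gam M k2 y = sym3 p2 q2 r2"
      "\<And>u v. christ (sym3 p2 q2 r2) (- u) (- v) = - christ (sym3 p' q' r') u v"
      using linear_chart[OF M k'(1,2,4) lin lin] by (metis (no_types, lifting) minus_minus)
    have "christ (sym3 p2 q2 r2) u v = - christ (sym3 p' q' r') u v" for u v
      using k2(5)[of u v] by (simp add: christ_simps)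
    from this[of "axis 1 1" "axis 1 1"] this[of "axis 1 1" "axis 2 1"] this[of "axis 2 1" "axis 2 1"]
    have "p2 = - p'" "q2 = - q'" "r2 = - r'"
      by (simp_all add: christ_sym3 axis_def)
    then have "p2 = vec2 (- p' $ 1) 0" "q2 = vec2 (- q' $ 1) 0" "r2 = vec2 (- r' $ 1) (- r' $ 2)"
      using pq by (simp_all add: vec2_eq_iff)
    then show ?thesis
      using that[OF k2(1,2,3), of "- p' $ 1" "- q' $ 1" "- r' $ 1" "- r' $ 2"] k2(4) \<sigma> False
      by (simp add: algebra_simps)
  qed
qed

section \<open>Reduction of the normalised connection to the model\<close>

lemma oscillator_exists:
  fixes \<kappa> :: real
  obtains C S where "\<And>y. (C has_real_derivative \<kappa> * S y) (at y)" "\<And>y. (S has_real_derivative C y) (at y)"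
    "C 0 = 1" "S 0 = 0"
proof -
  consider "\<kappa> = 0" | "\<kappa> > 0" | "\<kappa> < 0" by linarith
  then show ?thesis
  proof cases
    case 1
    then show ?thesis by (intro that[of "\<lambda>_. 1" "\<lambda>y. y"]) (auto intro!: derivative_eq_intros)
  next
    case 2
    define m where "m = sqrt \<kappa>"
    have m: "m > 0" "\<kappa> = m * m" using 2 by (simp_all add: m_def)
    then show ?thesis
      by (intro that[of "\<lambda>y. cosh (m * y)" "\<lambda>y. sinh (m * y) / m"]) (auto intro!: derivative_eq_intros)
  next
    case 3
    define m where "m = sqrt (- \<kappa>)"
    have m: "m > 0" "\<kappa> = - (m * m)" using 3 by (simp_all add: m_def)
    then show ?thesis
      by (intro that[of "\<lambda>y. cos (m * y)" "\<lambda>y. sin (m * y) / m"]) (auto intro!: derivative_eq_intros)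
  qed
qed

lemma smooth_affine_arg: "smooth_on UNIV f \<Longrightarrow> smooth_on UNIV (\<lambda>y::real. f (r * y) :: real)"
  by (rule smooth_compose[OF open_UNIV open_UNIV smooth_mult[OF open_UNIV smooth_const smooth_ident]]) auto

text \<open>The condition \<open>h 0 = 0\<close> makes the later coordinate change fix the origin.
  The last two cases are resonant, with polynomial solutions.\<close>

lemma inhomogeneous_exists:
  fixes p q c :: real
  obtains h h1 h2 where "\<And>y. (h has_real_derivative h1 y) (at y)" "\<And>y. (h1 has_real_derivative h2 y) (at y)"
    "\<And>y. h2 y + p * h1 y + q * h y = - c" "h 0 = 0" "smooth_on UNIV h"
proof -
  note sm = smooth_mult[OF open_UNIV] smooth_const smooth_ident smooth_diff[OF open_UNIV]
    smooth_affine_arg[OF smooth_exp]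
  consider "q \<noteq> 0" | "q = 0" "p \<noteq> 0" | "q = 0" "p = 0" by blast
  then show ?thesis
  proof cases
    case 1
    \<comment> \<open>The constant \<open>- m\<close> solves the equation, and
      \<open>exp (- p y / 2) C y\<close> solves the homogeneous one. Adding \<open>m\<close> times
      the latter yields the value 0 at 0.\<close>
    define \<kappa> where "\<kappa> = p\<^sup>2 / 4 - q"
    define m where "m = c / q"
    obtain C S where CS: "\<And>y. (C has_real_derivative \<kappa> * S y) (at y)"
      "\<And>y. (S has_real_derivative C y) (at y)" "C 0 = 1" "S 0 = 0"
      using oscillator_exists by blast
    show ?thesis
    proof (rule that)
      show "((\<lambda>y. m * (exp (- p / 2 * y) * C y - 1)) has_real_derivative
          m * exp (- p / 2 * y) * (\<kappa> * S y - p / 2 * C y)) (at y)" for y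
        by (auto intro!: derivative_eq_intros CS simp: algebra_simps)
      show "((\<lambda>y. m * exp (- p / 2 * y) * (\<kappa> * S y - p / 2 * C y)) has_real_derivative
          m * exp (- p / 2 * y) * (\<kappa> * C y - p / 2 * \<kappa> * S y
            - p / 2 * (\<kappa> * S y - p / 2 * C y))) (at y)" for y
        by (auto intro!: derivative_eq_intros CS simp: field_simps)
      have q: "q = p\<^sup>2 / 4 - \<kappa>" and c: "c = m * q" using 1 by (simp_all add: \<kappa>_def m_def)
      show "m * exp (- p / 2 * y) * (\<kappa> * C y - p / 2 * \<kappa> * S y
            - p / 2 * (\<kappa> * S y - p / 2 * C y))
          + p * (m * exp (- p / 2 * y) * (\<kappa> * S y - p / 2 * C y))
          + q * (m * (exp (- p / 2 * y) * C y - 1)) = - c" for y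
        unfolding c by (simp add: q power2_eq_square algebra_simps)
      show "smooth_on UNIV (\<lambda>y. m * (exp (- p / 2 * y) * C y - 1))"
        by (intro sm smooth_oscillator[OF CS(1,2)])
    qed (simp add: CS)
  next
    case 2
    show ?thesis
    proof (rule that)
      show "((\<lambda>y. (- c / p) * y) has_real_derivative - c / p) (at y)" for y
        using DERIV_cmult_Id by blast
      show "((\<lambda>y. - c / p) has_real_derivative 0) (at y)" for y by simp
      show "smooth_on UNIV (\<lambda>y. - c / p * y)" by (intro sm)
    qed (use 2 in auto)
  next
    case 3
    show ?thesis
    proof (rule that)
      show "((\<lambda>y. - c / 2 * (y * y)) has_real_derivative - c * y) (at y)" for y
        by (auto intro!: derivative_eq_intros simp: algebra_simps)
      show "((\<lambda>y. - c * y) has_real_derivative - c) (at y)" for y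
        by (auto intro!: derivative_eq_intros)
      show "smooth_on UNIV (\<lambda>y. - c / 2 * (y * y))" by (intro sm)
    qed (use 3 in auto)
  qed
qed

definition model :: "real \<Rightarrow> real \<Rightarrow> christoffel2" where
  "model d \<kappa> x = sym3 0 (vec2 (d / 2) 0) (vec2 (- \<kappa> * x $ 1) d)"

text \<open>If \<open>x\<^sup>2\<close> is used as parameter of a geodesic, then \<open>w = E x\<^sup>1 - h x\<^sup>2\<close> with \<open>E' = 1 + a E\<close> solves
  \<open>w'' + p w' + q w = 0\<close> for \<open>p = 2 b - d\<close> and \<open>q = a c\<close>; the factor \<open>exp (p x\<^sup>2 / 2)\<close> then removes the first
  order term.\<close>

lemma adapted_to_model:
  fixes a b c d :: real
  obtains F H where "pdiff UNIV F H" "F 0 = 0"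
    "\<And>W. transforms W F (\<lambda>_. sym3 (vec2 a 0) (vec2 b 0) (vec2 c d)) (model d (d\<^sup>2 / 4 - (b * (d - b) + a * c)))"
proof -
  define p where "p = 2 * b - d"
  define \<kappa> where "\<kappa> = d\<^sup>2 / 4 - (b * (d - b) + a * c)"
  obtain h h1 h2 where h: "\<And>y. (h has_real_derivative h1 y) (at y)" "\<And>y. (h1 has_real_derivative h2 y) (at y)"
    "\<And>y. h2 y + p * h1 y + a * c * h y = - c" "h 0 = 0" "smooth_on UNIV h"
    using inhomogeneous_exists by blast
  \<comment> \<open>\<open>E\<close> is the solution of \<open>E' = 1 + a E\<close> with
    \<open>E 0 = 0\<close>, written so that \<open>a = 0\<close> is covered. For
    \<open>a \<noteq> 0\<close>, \<open>1 + a E = exp (a x)\<close>; hence its inverse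
    \<open>L\<close> lives where \<open>1 + a z > 0\<close>.\<close>
  define E where "E x = (if a = 0 then x else (exp (a * x) - 1) / a)" for x
  define L where "L z = (if a = 0 then z else ln (1 + a * z) / a)" for z
  have E: "(E has_real_derivative 1 + a * E x) (at x)" for x
  proof (cases "a = 0")
    case True
    then show ?thesis by (simp add: E_def[abs_def])
  next
    case False
    then show ?thesis unfolding E_def[abs_def] by (auto intro!: derivative_eq_intros)
  qed
  have E0: "E 0 = 0" by (simp add: E_def)
  have LE: "L (E x) = x" "1 + a * E x > 0" for x by (auto simp: L_def E_def)
  have EL: "E (L z) = z" if "1 + a * z > 0" for z using that by (auto simp: L_def E_def)
  have smE: "smooth_on UNIV E"
  proof (cases "a = 0")
    case True
    then show ?thesis by (simp add: E_def[abs_def] smooth_ident)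
  next
    case False
    have "smooth_on UNIV (\<lambda>x. (exp (a * x) - 1) * inverse a)"
      by (intro smooth_mult smooth_diff smooth_affine_arg[OF smooth_exp] smooth_const open_UNIV)
    then show ?thesis using False by (simp add: E_def[abs_def] divide_inverse)
  qed
  let ?Z = "{z. 1 + a * z > 0}"
  have oZ: "open ?Z" by (intro open_Collect_less continuous_intros)
  have smL: "smooth_on ?Z L"
  proof (cases "a = 0")
    case True
    then show ?thesis by (simp add: L_def[abs_def] smooth_ident)
  next
    case False
    have "smooth_on ?Z (\<lambda>z. ln (1 + a * z) * inverse a)"
      by (rule smooth_mult[OF oZ smooth_compose[OF oZ open_greaterThan _ smooth_ln] smooth_const])
         (auto intro!: smooth_add smooth_mult smooth_const smooth_ident oZ)
    then show ?thesis using False by (simp add: L_def[abs_def] divide_inverse)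
  qed
  define f where "f x = exp (p / 2 * x $ 2) * (E (x $ 1) - h (x $ 2))" for x :: "real^2"
  define F where "F x = vec2 (f x) (x $ 2)" for x
  define g where "g y = exp (- p / 2 * y $ 2) * y $ 1 + h (y $ 2)" for y :: "real^2"
  define H where "H y = vec2 (L (g y)) (y $ 2)" for y
  let ?O = "{y. 1 + a * g y > 0}"
  note nth = smooth_nth_real[OF open_UNIV]
  note sm = smooth_mult[OF open_UNIV] smooth_diff[OF open_UNIV] smooth_add[OF open_UNIV] nth[OF smE] nth[OF h(5)]
    nth[OF smooth_ident] nth[OF smooth_affine_arg[OF smooth_exp]]
  have smf: "smooth_on UNIV f" unfolding f_def[abs_def] by (intro sm)
  have smg: "smooth_on UNIV g" unfolding g_def[abs_def] by (intro sm)
  have oO: "open ?O"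
    by (intro open_Collect_less continuous_intros smooth_continuous[OF smg])
  have smF: "smooth_on UNIV F"
    unfolding F_def[abs_def] vec2_def
    by (intro smooth_add smooth_scaleR smooth_const open_UNIV smf nth[OF smooth_ident])
  have "smooth_on ?O (\<lambda>y. L (g y))"
    by (rule smooth_compose[OF oO oZ smooth_subset[OF smg] smL]) auto
  then have smH: "smooth_on ?O H"
    unfolding H_def[abs_def] vec2_def
    by (intro smooth_add smooth_scaleR smooth_const oO smooth_subset[OF nth[OF smooth_ident]]) auto
  have e: "exp (p / 2 * y) * exp (- (p / 2 * y)) = 1" for y by (simp flip: exp_add)
  have gF: "g (F x) = E (x $ 1)" for x
    using e[of "x $ 2"] by (simp add: g_def F_def f_def algebra_simps flip: mult.assoc)
  have HF: "H (F x) = x" for x by (simp add: H_def gF LE vec2_eq_iff) (simp add: F_def)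
  have FH: "F (H y) = y" if "y \<in> ?O" for y
    using EL[of "g y"] that e[of "y $ 2"] by (simp add: F_def f_def H_def vec2_eq_iff g_def flip: mult.assoc)
  have "F x \<in> ?O" for x using gF LE by simp
  with FH have im: "F ` UNIV = ?O" by (metis (no_types, lifting) UNIV_I image_eqI image_subsetI subset_antisym subsetI)
  have pF: "pdiff UNIV F H"
    unfolding pdiff_def im using smF smH oO HF by simp
  \<comment> \<open>\<open>fv v x\<close> is the derivative of \<open>f\<close> in the direction
    \<open>v\<close>, and \<open>fw v u x\<close> the derivative of that in the direction
    \<open>u\<close>. Because of \<open>E' = 1 + a E\<close>, both remain polynomial in
    \<open>E\<close>.\<close>
  define fv where "fv v x = exp (p / 2 * x $ 2) * ((1 + a * E (x $ 1)) * v $ 1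
     + (p / 2 * (E (x $ 1) - h (x $ 2)) - h1 (x $ 2)) * v $ 2)" for v x :: "real^2"
  define fw where "fw v u x = exp (p / 2 * x $ 2) * (p / 2 * u $ 2 * ((1 + a * E (x $ 1)) * v $ 1
     + (p / 2 * (E (x $ 1) - h (x $ 2)) - h1 (x $ 2)) * v $ 2) + a * (1 + a * E (x $ 1)) * u $ 1 * v $ 1
     + (p / 2 * ((1 + a * E (x $ 1)) * u $ 1 - h1 (x $ 2) * u $ 2) - h2 (x $ 2) * u $ 2) * v $ 2)" for v u x :: "real^2"
  note n = has_derivative_nth_real
  have ex: "((\<lambda>y. exp (p / 2 * y)) has_real_derivative p / 2 * exp (p / 2 * y)) (at y)" for y
    by (auto intro!: derivative_eq_intros)
  have df: "(f has_derivative (\<lambda>v. fv v x)) (at x)" for x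
    unfolding f_def[abs_def]
    by (rule has_derivative_eq_rhs, (rule has_derivative_mult has_derivative_diff n[OF ex] n[OF E] n[OF h(1)])+)
       (simp add: fun_eq_iff fv_def field_simps)
  have dF: "fd F x = (\<lambda>v. vec2 (fv v x) (v $ 2))" for x
    unfolding F_def[abs_def] vec2_def
    by (rule fd_eqI)
       (intro has_derivative_add has_derivative_scaleR_left df bounded_linear.has_derivative[OF bounded_linear_vec_nth] has_derivative_ident)
  have dfv: "(fv v has_derivative (\<lambda>u. fw v u x)) (at x)" for v x
    unfolding fv_def[abs_def]
    by (rule has_derivative_eq_rhs, (rule has_derivative_mult has_derivative_diff has_derivative_add
         has_derivative_const n[OF ex] n[OF E] n[OF h(1)] n[OF h(2)])+)
       (simp add: fun_eq_iff fw_def algebra_simps)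
  have d2F: "fd2 F x u v = vec2 (fw v u x) 0" for x u v
  proof -
    have "((\<lambda>y. vec2 (fv v y) (v $ 2)) has_derivative (\<lambda>u. fw v u x *\<^sub>R axis 1 1 + 0)) (at x)"
      unfolding vec2_def by (intro has_derivative_add has_derivative_scaleR_left dfv has_derivative_const)
    from fd_eqI[OF this] show ?thesis by (simp add: dF vec2_def)
  qed
  have tlF: "transforms W F (\<lambda>_. sym3 (vec2 a 0) (vec2 b 0) (vec2 c d)) (model d \<kappa>)" for W
    unfolding transforms_def
  proof (intro ballI allI)
    fix x u v :: "real^2"
    \<comment> \<open>The equation for \<open>h\<close> eliminates its second derivative. With the
      exponential, \<open>E\<close>, \<open>h\<close> and \<open>h1\<close> replaced by letters, the
      transformation law is a polynomial identity.\<close>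
    have h2: "h2 (x $ 2) = - c - p * h1 (x $ 2) - a * c * h (x $ 2)" using h(3)[of "x $ 2"] by linarith
    have b: "b = (p + d) / 2" by (simp add: p_def)
    have \<kappa>: "\<kappa> = p * p / 4 - a * c" by (simp add: \<kappa>_def p_def power2_eq_square field_simps)
    define e where "e = exp (p / 2 * x $ 2)"
    define X where "X = E (x $ 1)"
    define Y where "Y = h (x $ 2)"
    define Y1 where "Y1 = h1 (x $ 2)"
    show "fd2 F x u v + christ (model d \<kappa> (F x)) (fd F x u) (fd F x v) =
        fd F x (christ (sym3 (vec2 a 0) (vec2 b 0) (vec2 c d)) u v)"
      unfolding d2F unfolding dF model_def christ_sym3 vec2_eq_iff F_def fv_def fw_def f_def h2
        e_def[symmetric] X_def[symmetric] Y_def[symmetric] Y1_def[symmetric]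
      by (simp add: \<kappa> b field_simps)
  qed
  have "F 0 = 0" by (simp add: F_def f_def E0 h(4) vec2_eq_iff)
  with pF tlF show ?thesis using that unfolding \<kappa>_def by blast
qed

text \<open>Since the Ricci coefficient is normalised to \<open>\<epsilon> = \<plusminus>1\<close>,
  the invariants give \<open>\<alpha> \<epsilon> = (2 d)\<^sup>2\<close>, and
  \<open>d \<ge> 0\<close> selects the root. Both model parameters thus depend only on
  \<open>\<alpha>\<close> and \<open>\<epsilon>\<close>.\<close>

lemma model_chart:
  assumes M: "affine_surface M" and A: "type_A M" and rk: "ricci_rank M 1" and P: "P \<in> points M"
  defines "\<alpha> \<equiv> alpha_inv M" and "\<epsilon> \<equiv> eps_inv M"
  obtains k where "k \<in> charts M" "P \<in> fst k" "snd k P = 0"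
    "\<And>x. x \<in> chart_image k UNIV \<Longrightarrow> gam M k x = model (sqrt (\<alpha> * \<epsilon>) / 2) (\<epsilon> * (\<alpha> - 16) / 16) x"
    "\<epsilon> = 1 \<or> \<epsilon> = - 1" "\<alpha> * \<epsilon> \<ge> 0"
proof -
  note am = affine_surfaceD[OF M]
  obtain k a b c d where k: "k \<in> charts M" "P \<in> fst k" "snd k P = 0"
    "\<And>x. x \<in> chart_image k UNIV \<Longrightarrow> gam M k x = sym3 (vec2 a 0) (vec2 b 0) (vec2 c d)"
    "b * (d - b) + a * c = 1 \<or> b * (d - b) + a * c = -1" "d \<ge> 0"
    using adapted_chart[OF M A rk P] by blast
  define \<rho> where "\<rho> = b * (d - b) + a * c"
  note pk = is_chartD[OF am(1)[OF k(1)]]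
  have x0: "snd k P \<in> chart_image k UNIV" using pk(8)[OF k(2), of UNIV] by simp
  have hom: "locally_homogeneous M" using A by (simp add: type_A_def)
  have \<rho>: "\<rho> = 1 \<or> \<rho> = - 1" using k(5) by (simp add: \<rho>_def)
  have "\<alpha> = (- 2 * d * \<rho>)\<^sup>2 / \<rho> ^ 3" "\<epsilon> = sgn \<rho>"
    using invariants_at_chart[OF M hom k(1,2), of \<rho> "- 2 * d * \<rho>"] adapted_connection[OF pk(9) k(4) x0] \<rho>
    unfolding \<alpha>_def \<epsilon>_def \<rho>_def by auto
  then have \<epsilon>: "\<epsilon> = \<rho>" and \<alpha>: "\<alpha> = 4 * d\<^sup>2 * \<rho>"
    using \<rho> by (auto simp: power2_eq_square power3_eq_cube)
  have \<alpha>\<epsilon>: "\<alpha> * \<epsilon> = (2 * d)\<^sup>2" using \<rho> by (auto simp: \<alpha> \<epsilon> power2_eq_square)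
  have d: "sqrt (\<alpha> * \<epsilon>) / 2 = d" unfolding \<alpha>\<epsilon> real_sqrt_abs using k(6) by simp
  have \<kappa>: "\<epsilon> * (\<alpha> - 16) / 16 = d\<^sup>2 / 4 - (b * (d - b) + a * c)"
    unfolding \<rho>_def[symmetric] using \<rho> by (auto simp: \<alpha> \<epsilon> power2_eq_square field_simps)
  obtain F H where F: "pdiff UNIV F H" "F 0 = 0"
    "\<And>W. transforms W F (\<lambda>_. sym3 (vec2 a 0) (vec2 b 0) (vec2 c d)) (model d (d\<^sup>2 / 4 - (b * (d - b) + a * c)))"
    using adapted_to_model by blast
  let ?W = "chart_image k UNIV"
  have pF: "pdiff ?W F H" by (rule pdiff_subset[OF F(1) pk(9)]) simp
  have tlF: "transforms ?W F (gam M k) (model d (d\<^sup>2 / 4 - (b * (d - b) + a * c)))"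
    using F(3)[of ?W] k(4) unfolding transforms_def by simp
  obtain k' where k': "k' \<in> charts M" "fst k' = chart_inv k ` ?W"
    "\<And>P. P \<in> fst k' \<Longrightarrow> snd k' P = F (snd k P)" "chart_image k' UNIV = F ` ?W"
    "\<And>y. y \<in> F ` ?W \<Longrightarrow> gam M k' y = model d (d\<^sup>2 / 4 - (b * (d - b) + a * c)) y"
    using new_chart[OF M k(1) pF _ tlF] by blast
  have P': "P \<in> fst k'" unfolding k'(2) using x0 pk(4)[OF k(2)] by (metis image_eqI)
  have z: "snd k' P = 0" using k'(3)[OF P'] F(2) k(3) by simp
  have g: "gam M k' x = model (sqrt (\<alpha> * \<epsilon>) / 2) (\<epsilon> * (\<alpha> - 16) / 16) x" if "x \<in> chart_image k' UNIV" for x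
    unfolding d \<kappa> using k'(4,5) that by simp
  have "\<epsilon> = 1 \<or> \<epsilon> = - 1" "\<alpha> * \<epsilon> \<ge> 0" using \<epsilon> \<rho> unfolding \<alpha>\<epsilon> by auto
  then show ?thesis by (intro that[OF k'(1) P' z g])
qed

section \<open>Killing fields of the model\<close>

lemma fd_zero:
  fixes F :: "'a::real_normed_vector \<Rightarrow> real"
  assumes "(F has_derivative F') (at x)" "open B" "x \<in> B" "\<And>y. y \<in> B \<Longrightarrow> F y = 0"
  shows "F' h = 0"
proof -
  have "((\<lambda>_. 0::real) has_derivative F') (at x)"
    by (rule has_derivative_transform_within_open[OF assms(1-3)]) (simp add: assms(4))
  from has_derivative_unique[OF this has_derivative_const] show ?thesis by simp
qed

lemma constant_on_convex:
  fixes F :: "real^2 \<Rightarrow> real"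
  assumes "convex B" "z \<in> B" "x \<in> B" and F: "\<And>y. y \<in> B \<Longrightarrow> (F has_derivative F' y) (at y)"
    and "\<And>y. y \<in> B \<Longrightarrow> F' y (axis 1 1) = 0" "\<And>y. y \<in> B \<Longrightarrow> F' y (axis 2 1) = 0"
  shows "F x = F z"
proof (rule has_derivative_zero_unique[OF assms(1) _ assms(3,2)])
  fix y assume y: "y \<in> B"
  have l: "linear (F' y)" using F[OF y] has_derivative_linear by blast
  have "F' y h = 0" for h
    by (subst vec2_expand[of h]) (simp add: linear_add[OF l] linear_cmul[OF l] assms(5,6) y)
  then have "F' y = (\<lambda>h. 0)" by (simp add: fun_eq_iff)
  then show "(F has_derivative (\<lambda>h. 0)) (at y within B)"
    using F[OF y] has_derivative_at_withinI by metis
qed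

lemma has_derivative_model: "(model d \<kappa> has_derivative (\<lambda>h. sym3 0 0 (vec2 (- \<kappa> * h $ 1) 0))) (at x)"
proof -
  have "((\<lambda>x::real^2. sym3 0 (vec2 (d / 2) 0) (vec2 0 d) + x $ 1 *\<^sub>R sym3 0 0 (vec2 (- \<kappa>) 0)) has_derivative
     (\<lambda>h. 0 + h $ 1 *\<^sub>R sym3 0 0 (vec2 (- \<kappa>) 0))) (at x)"
    by (intro has_derivative_add has_derivative_const has_derivative_scaleR_left
        bounded_linear.has_derivative[OF bounded_linear_vec_nth has_derivative_ident])
  moreover have m: "model d \<kappa> = (\<lambda>x. sym3 0 (vec2 (d / 2) 0) (vec2 0 d) + x $ 1 *\<^sub>R sym3 0 0 (vec2 (- \<kappa>) 0))"
    by (simp add: fun_eq_iff model_def sym3_def vec_eq_iff forall_2)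
  moreover have "sym3 0 0 (vec2 (- \<kappa> * r) 0) = 0 + r *\<^sub>R sym3 0 0 (vec2 (- \<kappa>) 0)" for r
    by (simp add: sym3_def vec_eq_iff forall_2)
  ultimately show ?thesis unfolding m by simp
qed

lemma kill_model:
  assumes l: "linear (fd X x)"
  shows "kill (model d \<kappa>) X x u v = fd2 X x u v + vec2 (- \<kappa> * X x $ 1 * u $ 2 * v $ 2) 0
    + vec2 (d / 2 * (fd X x u $ 1 * v $ 2 + fd X x u $ 2 * v $ 1) - \<kappa> * x $ 1 * fd X x u $ 2 * v $ 2) (d * fd X x u $ 2 * v $ 2)
    + vec2 (d / 2 * (u $ 1 * fd X x v $ 2 + u $ 2 * fd X x v $ 1) - \<kappa> * x $ 1 * u $ 2 * fd X x v $ 2) (d * u $ 2 * fd X x v $ 2)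
    - ((d / 2 * (u $ 1 * v $ 2 + u $ 2 * v $ 1) - \<kappa> * x $ 1 * u $ 2 * v $ 2) *\<^sub>R fd X x (axis 1 1)
       + (d * u $ 2 * v $ 2) *\<^sub>R fd X x (axis 2 1))"
proof -
  have e: "fd X x w = w $ 1 *\<^sub>R fd X x (axis 1 1) + w $ 2 *\<^sub>R fd X x (axis 2 1)" for w
    by (subst vec2_expand[of w]) (simp add: linear_add[OF l] linear_cmul[OF l])
  have c: "christ (model d \<kappa> x) a b = vec2 (d / 2 * (a $ 1 * b $ 2 + a $ 2 * b $ 1) - \<kappa> * x $ 1 * a $ 2 * b $ 2)
     (d * a $ 2 * b $ 2)" for a b
    by (simp add: model_def christ_sym3 vec2_eq_iff)
  have m: "christ (fd (model d \<kappa>) x h) a b = vec2 (- \<kappa> * h $ 1 * a $ 2 * b $ 2) 0" for h a b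
    unfolding fd_eqI[OF has_derivative_model] by (simp add: christ_sym3 vec2_eq_iff)
  show ?thesis
    unfolding kill_def c m e[of "vec2 _ _"] by simp
qed

text \<open>These are the two components of the Killing operator on the three pairs of coordinate
  vectors.\<close>

lemma killing_model_equations:
  assumes B: "open B" and X: "smooth_on B X" and x: "x \<in> B"
    and k: "\<And>x u v. x \<in> B \<Longrightarrow> kill (model d \<kappa>) X x u v = 0"
  shows "fd2 X x (axis 1 1) (axis 1 1) $ 2 = 0"
    "fd2 X x (axis 1 1) (axis 1 1) $ 1 + d * fd X x (axis 1 1) $ 2 = 0"
    "fd2 X x (axis 1 1) (axis 2 1) $ 2 + d / 2 * fd X x (axis 1 1) $ 2 = 0"
    "fd2 X x (axis 1 1) (axis 2 1) $ 1 + d / 2 * fd X x (axis 2 1) $ 2 - \<kappa> * (x $ 1 * fd X x (axis 1 1) $ 2) = 0"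
    "fd2 X x (axis 2 1) (axis 2 1) $ 2 + d * fd X x (axis 2 1) $ 2 + \<kappa> * (x $ 1 * fd X x (axis 1 1) $ 2) = 0"
    "fd2 X x (axis 2 1) (axis 2 1) $ 1 - \<kappa> * X x $ 1 - 2 * \<kappa> * (x $ 1 * fd X x (axis 2 1) $ 2)
       + \<kappa> * (x $ 1 * fd X x (axis 1 1) $ 1) = 0"
proof -
  note K = k[OF x, unfolded kill_model[OF smooth_linear[OF X x]] vec2_eq_iff]
  have a: "(axis 1 1 :: real^2) $ 1 = 1" "(axis 1 1 :: real^2) $ 2 = 0" "(axis 2 1 :: real^2) $ 1 = 0"
    "(axis 2 1 :: real^2) $ 2 = 1"
    by (simp_all add: axis_def)
  show "fd2 X x (axis 1 1) (axis 1 1) $ 2 = 0"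
    "fd2 X x (axis 1 1) (axis 1 1) $ 1 + d * fd X x (axis 1 1) $ 2 = 0"
    using K[where u = "axis 1 1" and v = "axis 1 1"] by (simp_all add: a)
  show "fd2 X x (axis 1 1) (axis 2 1) $ 2 + d / 2 * fd X x (axis 1 1) $ 2 = 0"
    "fd2 X x (axis 1 1) (axis 2 1) $ 1 + d / 2 * fd X x (axis 2 1) $ 2 - \<kappa> * (x $ 1 * fd X x (axis 1 1) $ 2) = 0"
    using K[where u = "axis 1 1" and v = "axis 2 1"] by (simp_all add: a algebra_simps)
  show "fd2 X x (axis 2 1) (axis 2 1) $ 2 + d * fd X x (axis 2 1) $ 2 + \<kappa> * (x $ 1 * fd X x (axis 1 1) $ 2) = 0"
    "fd2 X x (axis 2 1) (axis 2 1) $ 1 - \<kappa> * X x $ 1 - 2 * \<kappa> * (x $ 1 * fd X x (axis 2 1) $ 2)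
       + \<kappa> * (x $ 1 * fd X x (axis 1 1) $ 1) = 0"
    using K[where u = "axis 2 1" and v = "axis 2 1"] by (simp_all add: a algebra_simps)
qed

text \<open>Differentiating the Killing equations once more leaves \<open>(\<kappa> - d\<^sup>2 / 4) \<partial>\<^sub>i X\<^sup>2 = 0\<close>.\<close>

lemma killing_model_component:
  assumes B: "open B" and X: "smooth_on B X" and k: "\<And>x u v. x \<in> B \<Longrightarrow> kill (model d \<kappa>) X x u v = 0"
    and nd: "\<kappa> \<noteq> d\<^sup>2 / 4" and x: "x \<in> B"
  shows "fd X x (axis 1 1) $ 2 = 0" "fd X x (axis 2 1) $ 2 = 0"
proof -
  let ?e = "axis 1 1 :: real^2" and ?f = "axis 2 1 :: real^2"
  note K = killing_model_equations[OF B X _ k]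
  have dz: "((\<lambda>y. g y $ i) has_derivative (\<lambda>h. fd g x h $ i)) (at x)" if "smooth_on B g" "x \<in> B" for g :: field2 and i x
    by (rule bounded_linear.has_derivative[OF bounded_linear_vec_nth smooth_has_derivative[OF that]])
  note dX = dz[OF X] and dX1 = dz[OF smooth_fd[OF X]] and dX2 = dz[OF smooth_fd[OF smooth_fd[OF X]]]
  have y1: "((\<lambda>y::real^2. y $ 1) has_derivative (\<lambda>h. h $ 1)) (at x)" for x
    by (rule bounded_linear.has_derivative[OF bounded_linear_vec_nth has_derivative_ident])
  have a: "?e $ 1 = 1" "?e $ 2 = 0" "?f $ 1 = 0" "?f $ 2 = 1" by (simp_all add: axis_def)
  have c: "fd2 X x ?f ?e = fd2 X x ?e ?f" if "x \<in> B" for x by (rule fd_commute[OF B X that])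
  have T: "fd (\<lambda>y. fd2 X y ?f ?f) x ?e = fd (\<lambda>y. fd2 X y ?e ?f) x ?f" if "x \<in> B" for x
    by (rule fd_commute[OF B smooth_fd[OF X] that])
  have q1: "fd X x ?e $ 2 = 0" if x: "x \<in> B" for x
  proof -
    \<comment> \<open>The equations for \<open>\<partial>\<^sub>2\<partial>\<^sub>2X\<^sup>2\<close>
      and \<open>\<partial>\<^sub>1\<partial>\<^sub>2X\<^sup>2\<close> are differentiated along
      \<open>\<partial>\<^sub>1\<close> and \<open>\<partial>\<^sub>2\<close>. Equality of the mixed
      third derivatives (\<open>T\<close>) makes this an integrability condition on
      \<open>\<partial>\<^sub>1X\<^sup>2\<close>.\<close>
    have 1: "fd (\<lambda>y. fd2 X y ?f ?f) x ?e $ 2 + d * fd2 X x ?e ?f $ 2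
        + \<kappa> * (x $ 1 * fd2 X x ?e ?e $ 2 + ?e $ 1 * fd X x ?e $ 2) = 0"
      by (rule fd_zero[OF has_derivative_add[OF has_derivative_add[OF dX2[OF x] has_derivative_mult_right[OF dX1[OF x]]]
        has_derivative_mult_right[OF has_derivative_mult[OF y1 dX1[OF x]]]] B x K(5)])
    have 2: "fd (\<lambda>y. fd2 X y ?e ?f) x ?f $ 2 + d / 2 * fd2 X x ?f ?e $ 2 = 0"
      by (rule fd_zero[OF has_derivative_add[OF dX2[OF x] has_derivative_mult_right[OF dX1[OF x]]] B x K(3)])
    define q where "q = fd X x ?e $ 2"
    have m: "fd2 X x ?e ?f $ 2 = - (d / 2) * q" using K(3)[OF x] unfolding q_def by linarith
    have t: "fd (\<lambda>y. fd2 X y ?e ?f) x ?f $ 2 = d / 2 * (d / 2 * q)" using 2 unfolding c[OF x] m by linarith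
    have "d / 2 * (d / 2 * q) + d * (- (d / 2) * q) + \<kappa> * (x $ 1 * 0 + 1 * q) = 0"
      using 1 K(1)[OF x] unfolding T[OF x] t m a q_def[symmetric] by simp
    then have "(\<kappa> - d\<^sup>2 / 4) * q = 0" by (simp add: power2_eq_square field_simps)
    then show ?thesis using nd by (simp add: q_def)
  qed
  then show "fd X x ?e $ 2 = 0" using x .
  have 0: "fd2 X x ?e ?e $ 1 = 0" "fd2 X x ?e ?f $ 2 = 0" using K(2)[OF x] K(3)[OF x] q1[OF x] by simp_all
  \<comment> \<open>The same comparison for \<open>X\<^sup>1\<close>, after
    \<open>\<partial>\<^sub>1X\<^sup>2 = 0\<close> has simplified the equations, yields the
    condition on \<open>\<partial>\<^sub>2X\<^sup>2\<close>.\<close>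
  have 3: "fd (\<lambda>y. fd2 X y ?f ?f) x ?e $ 1 - \<kappa> * fd X x ?e $ 1
      - 2 * \<kappa> * (x $ 1 * fd2 X x ?e ?f $ 2 + ?e $ 1 * fd X x ?f $ 2)
      + \<kappa> * (x $ 1 * fd2 X x ?e ?e $ 1 + ?e $ 1 * fd X x ?e $ 1) = 0"
    by (rule fd_zero[OF has_derivative_add[OF has_derivative_diff[OF has_derivative_diff[OF dX2[OF x]
        has_derivative_mult_right[OF dX[OF x]]] has_derivative_mult_right[OF has_derivative_mult[OF y1 dX1[OF x]]]]
        has_derivative_mult_right[OF has_derivative_mult[OF y1 dX1[OF x]]]] B x K(6)])
  have K4: "fd2 X y ?e ?f $ 1 + d / 2 * fd X y ?f $ 2 = 0" if "y \<in> B" for y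
    using K(4)[OF that] q1[OF that] by simp
  have 4: "fd (\<lambda>y. fd2 X y ?e ?f) x ?f $ 1 + d / 2 * fd2 X x ?f ?f $ 2 = 0"
    by (rule fd_zero[OF has_derivative_add[OF dX2[OF x] has_derivative_mult_right[OF dX1[OF x]]] B x K4])
  define q where "q = fd X x ?f $ 2"
  have m: "fd2 X x ?f ?f $ 2 = - d * q" using K(5)[OF x] q1[OF x] unfolding q_def by simp
  have t: "fd (\<lambda>y. fd2 X y ?e ?f) x ?f $ 1 = d / 2 * (d * q)" using 4 unfolding m by linarith
  have "d / 2 * (d * q) - \<kappa> * fd X x ?e $ 1 - 2 * \<kappa> * (x $ 1 * 0 + 1 * q) + \<kappa> * (x $ 1 * 0 + 1 * fd X x ?e $ 1) = 0"
    using 3 0 unfolding T[OF x] t a q_def[symmetric] by simp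
  then have "(\<kappa> - d\<^sup>2 / 4) * q = 0" by (auto simp: power2_eq_square field_simps)
  then show "fd X x ?f $ 2 = 0" using nd by (simp add: q_def)
qed

section \<open>Explicit Killing fields of the model\<close>

definition vec4 :: "real \<Rightarrow> real \<Rightarrow> real \<Rightarrow> real \<Rightarrow> real^4" where
  "vec4 a b c d = a *\<^sub>R axis 1 1 + b *\<^sub>R axis 2 1 + c *\<^sub>R axis 3 1 + d *\<^sub>R axis 4 1"

lemma vec4_nth [simp]: "vec4 a b c d $ 1 = a" "vec4 a b c d $ 2 = b" "vec4 a b c d $ 3 = c" "vec4 a b c d $ 4 = d"
  by (simp_all add: vec4_def axis_def)

lemma vec4_eq_iff: "(p::real^4) = q \<longleftrightarrow> p $ 1 = q $ 1 \<and> p $ 2 = q $ 2 \<and> p $ 3 = q $ 3 \<and> p $ 4 = q $ 4"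
  by (simp add: vec_eq_iff forall_4)

text \<open>The parameters \<open>p\<close> of a Killing field are the coefficients of \<open>\<partial>\<^sub>2\<close>, \<open>x\<^sup>1 \<partial>\<^sub>1\<close>, \<open>C(x\<^sup>2) \<partial>\<^sub>1\<close>
  and \<open>S(x\<^sup>2) \<partial>\<^sub>1\<close>.\<close>

definition param_bracket :: "real \<Rightarrow> real^4 \<Rightarrow> real^4 \<Rightarrow> real^4" where
  "param_bracket \<kappa> p q = vec4 0 0 (q $ 2 * p $ 3 - p $ 2 * q $ 3 + p $ 1 * q $ 4 - q $ 1 * p $ 4)
     (q $ 2 * p $ 4 - p $ 2 * q $ 4 + \<kappa> * (p $ 1 * q $ 3 - q $ 1 * p $ 3))"

text \<open>The fundamental system of \<open>u'' = \<kappa> u\<close> with standard initial values.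
  It treats the hyperbolic, linear and trigonometric cases alike; the sign of
  \<open>\<kappa>\<close> matters only when the Lie algebra and the type are determined.\<close>

locale oscillator =
  fixes \<kappa> :: real and C S :: "real \<Rightarrow> real"
  assumes C': "\<And>y. (C has_real_derivative \<kappa> * S y) (at y)" and S': "\<And>y. (S has_real_derivative C y) (at y)"
    and C0: "C 0 = 1" and S0: "S 0 = 0"
begin

text \<open>The left side is the Wronskian of \<open>C\<close> and \<open>S\<close>, so it keeps its
  value at 0. It later inverts the expansion of a solution in \<open>C\<close> and
  \<open>S\<close>.\<close>

lemma pythagoras: "C y * C y - \<kappa> * S y * S y = 1"
proof -
  have "((\<lambda>y. C y * C y - \<kappa> * S y * S y) has_real_derivative 0) (at y)" for y
    by (auto intro!: derivative_eq_intros C' S' simp: algebra_simps)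
  then have "C y * C y - \<kappa> * S y * S y = C 0 * C 0 - \<kappa> * S 0 * S 0"
    using DERIV_isconst_all[of "\<lambda>y. C y * C y - \<kappa> * S y * S y"] by blast
  then show ?thesis by (simp add: C0 S0)
qed

definition kfield :: "real^4 \<Rightarrow> field2" where
  "kfield p x = vec2 (p $ 2 * x $ 1 + p $ 3 * C (x $ 2) + p $ 4 * S (x $ 2)) (p $ 1)"

lemma kfield_linear: "kfield (p + q) x = kfield p x + kfield q x" "kfield (r *\<^sub>R p) x = r *\<^sub>R kfield p x"
  by (simp_all add: kfield_def vec2_eq_iff algebra_simps)

lemma smooth_kfield: "open V \<Longrightarrow> smooth_on V (kfield p)"
proof -
  assume V: "open V"
  note s = smooth_oscillator[OF C' S']
  show "smooth_on V (kfield p)"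
    unfolding kfield_def[abs_def]
    by (intro smooth_vec2[OF V] smooth_add[OF V] smooth_mult[OF V] smooth_const smooth_nth_real[OF V s(1)]
        smooth_nth_real[OF V s(2)] smooth_vec_nth[OF V smooth_ident])
qed

lemma fd_kfield: "fd (kfield p) x = (\<lambda>v. vec2 (p $ 2 * v $ 1 + (p $ 3 * \<kappa> * S (x $ 2) + p $ 4 * C (x $ 2)) * v $ 2) 0)"
proof -
  note n = bounded_linear.has_derivative[OF bounded_linear_vec_nth has_derivative_ident]
  have "(kfield p has_derivative (\<lambda>v. vec2 (p $ 2 * v $ 1 + p $ 3 * (\<kappa> * S (x $ 2) * v $ 2) + p $ 4 * (C (x $ 2) * v $ 2)) 0)) (at x)"
    unfolding kfield_def[abs_def]
    by (intro has_derivative_vec2 has_derivative_add has_derivative_const has_derivative_mult_right n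
        has_derivative_nth_real[OF C'] has_derivative_nth_real[OF S'])
  from fd_eqI[OF this] show ?thesis by (simp add: fun_eq_iff vec2_eq_iff algebra_simps)
qed

lemma fd2_kfield: "fd2 (kfield p) x u v = vec2 (\<kappa> * (p $ 3 * C (x $ 2) + p $ 4 * S (x $ 2)) * u $ 2 * v $ 2) 0"
proof -
  have "((\<lambda>y. vec2 (p $ 2 * v $ 1 + (p $ 3 * \<kappa> * S (y $ 2) + p $ 4 * C (y $ 2)) * v $ 2) 0) has_derivative
     (\<lambda>u. vec2 (0 + (p $ 3 * \<kappa> * (C (x $ 2) * u $ 2) + p $ 4 * (\<kappa> * S (x $ 2) * u $ 2)) * v $ 2) 0)) (at x)"
    by (intro has_derivative_vec2 has_derivative_add has_derivative_const has_derivative_mult_right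
        has_derivative_mult_left has_derivative_nth_real[OF C'] has_derivative_nth_real[OF S'])
  from fd_eqI[OF this] show ?thesis by (simp add: fd_kfield vec2_eq_iff algebra_simps)
qed

lemma kill_kfield: "kill (model d \<kappa>) (kfield p) x u v = 0"
proof -
  have l: "linear (fd (kfield p) x)" by (rule smooth_linear[OF smooth_kfield[OF open_UNIV]]) simp
  show ?thesis
    unfolding kill_model[OF l]
    by (simp add: fd2_kfield) (simp add: fd_kfield vec2_eq_iff kfield_def axis_def field_simps)
qed

lemma vf_bracket_kfield: "vf_bracket (kfield p) (kfield q) x = kfield (param_bracket \<kappa> p q) x"
  by (simp add: vf_bracket_def fd_kfield) (simp add: kfield_def param_bracket_def vec2_eq_iff algebra_simps)

text \<open>The value at 0 shows the parameters 1 and 3, the first derivatives at 0 show 2 and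
  4.\<close>

lemma kfield_inj:
  assumes "open B" "0 \<in> B" "\<And>x. x \<in> B \<Longrightarrow> kfield p x = kfield q x"
  shows "p = q"
proof -
  have "kfield p 0 = kfield q 0" using assms by blast
  moreover have "fd (kfield p) 0 v = fd (kfield q) 0 v" for v
    using fd_cong(1)[OF assms(1,2), of "kfield p" "kfield q"] assms(3) by simp
  from this[of "axis 1 1"] this[of "axis 2 1"] have "p $ 2 = q $ 2" "p $ 4 = q $ 4"
    by (simp_all add: fd_kfield vec2_eq_iff axis_def C0 S0)
  ultimately show ?thesis by (simp add: vec4_eq_iff kfield_def vec2_eq_iff C0 S0)
qed

text \<open>By \<open>killing_model_component\<close> the second component of \<open>X\<close> is
  constant, whence \<open>\<partial>\<^sub>1X\<^sup>1\<close> is a constant \<open>s\<close>. The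
  remainder \<open>X\<^sup>1 - s x\<^sup>1\<close> depends on \<open>x\<^sup>2\<close> alone and
  solves \<open>u'' = \<kappa> u\<close>. Convexity of \<open>B\<close> turns vanishing partial
  derivatives into constancy.\<close>

lemma killing_classification:
  assumes B: "open B" "convex B" "0 \<in> B" and X: "smooth_on B X"
    and k: "\<And>x u v. x \<in> B \<Longrightarrow> kill (model d \<kappa>) X x u v = 0" and nd: "\<kappa> \<noteq> d\<^sup>2 / 4"
  shows "\<exists>p. \<forall>x\<in>B. X x = kfield p x"
proof -
  let ?e = "axis 1 1 :: real^2" and ?f = "axis 2 1 :: real^2"
  note K = killing_model_equations[OF B(1) X _ k] and Q = killing_model_component[OF B(1) X k nd]
  have dz: "((\<lambda>y. g y $ i) has_derivative (\<lambda>h. fd g x h $ i)) (at x)" if "smooth_on B g" "x \<in> B" for g :: field2 and i x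
    by (rule bounded_linear.has_derivative[OF bounded_linear_vec_nth smooth_has_derivative[OF that]])
  note dX = dz[OF X] and dX1 = dz[OF smooth_fd[OF X]]
  have y1: "((\<lambda>y::real^2. y $ 1) has_derivative (\<lambda>h. h $ 1)) (at x)" for x
    by (rule bounded_linear.has_derivative[OF bounded_linear_vec_nth has_derivative_ident])
  have a: "?e $ 1 = 1" "?e $ 2 = 0" "?f $ 1 = 0" "?f $ 2 = 1" by (simp_all add: axis_def)
  have c: "fd2 X x ?f ?e = fd2 X x ?e ?f" if "x \<in> B" for x by (rule fd_commute[OF B(1) X that])
  have z: "fd2 X x ?e ?e $ 1 = 0" "fd2 X x ?e ?f $ 1 = 0" if "x \<in> B" for x
    using K(2)[OF that] K(4)[OF that] Q[OF _ that] by simp_all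
  define m where "m = X 0 $ 2"
  define s where "s = fd X 0 ?e $ 1"
  have m: "X x $ 2 = m" if "x \<in> B" for x
    unfolding m_def by (rule constant_on_convex[OF B(2,3) that dX]) (use Q[OF _] in auto)
  have s: "fd X x ?e $ 1 = s" if "x \<in> B" for x
    unfolding s_def by (rule constant_on_convex[OF B(2,3) that dX1]) (use z c in auto)
  have r: "fd2 X x ?f ?f $ 1 = \<kappa> * (X x $ 1 - s * x $ 1)" if "x \<in> B" for x
    using K(6)[OF that] Q(2)[OF _ that] s[OF that] by (simp add: algebra_simps)
  note dC = has_derivative_nth_real[OF C', of 2] and dS = has_derivative_nth_real[OF S', of 2]
  \<comment> \<open>For \<open>u = X\<^sup>1 - s x\<^sup>1\<close>, these are the Wronskian
    expressions \<open>u C - u' S\<close> and \<open>u' C - \<kappa> u S\<close>, which give the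
    coefficients of \<open>C\<close> and \<open>S\<close> in \<open>u\<close>. Their constancy
    replaces a uniqueness theorem for the differential equation.\<close>
  define A where "A x = (X x $ 1 - s * x $ 1) * C (x $ 2) - fd X x ?f $ 1 * S (x $ 2)" for x
  define D where "D x = fd X x ?f $ 1 * C (x $ 2) - \<kappa> * ((X x $ 1 - s * x $ 1) * S (x $ 2))" for x
  have A: "A x = A 0" if "x \<in> B" for x
  proof (rule constant_on_convex[OF B(2,3) that])
    fix y assume y: "y \<in> B"
    show "(A has_derivative (\<lambda>h. ((X y $ 1 - s * y $ 1) * (\<kappa> * S (y $ 2) * h $ 2) + (fd X y h $ 1 - s * h $ 1) * C (y $ 2))
        - (fd X y ?f $ 1 * (C (y $ 2) * h $ 2) + fd2 X y h ?f $ 1 * S (y $ 2)))) (at y)"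
      unfolding A_def[abs_def]
      by (intro has_derivative_diff has_derivative_mult has_derivative_mult_right y1 dX[OF y] dX1[OF y] dC dS)
  qed (simp_all add: a s z r)
  have D: "D x = D 0" if "x \<in> B" for x
  proof (rule constant_on_convex[OF B(2,3) that])
    fix y assume y: "y \<in> B"
    show "(D has_derivative (\<lambda>h. (fd X y ?f $ 1 * (\<kappa> * S (y $ 2) * h $ 2) + fd2 X y h ?f $ 1 * C (y $ 2))
        - \<kappa> * ((X y $ 1 - s * y $ 1) * (C (y $ 2) * h $ 2) + (fd X y h $ 1 - s * h $ 1) * S (y $ 2)))) (at y)"
      unfolding D_def[abs_def]
      by (intro has_derivative_diff has_derivative_mult has_derivative_mult_right y1 dX[OF y] dX1[OF y] dC dS)
  qed (simp_all add: a s z r algebra_simps)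
  have "X x = kfield (vec4 m s (A 0) (D 0)) x" if x: "x \<in> B" for x
  proof -
    have "A 0 * C (x $ 2) + D 0 * S (x $ 2) =
        (X x $ 1 - s * x $ 1) * (C (x $ 2) * C (x $ 2) - \<kappa> * S (x $ 2) * S (x $ 2))"
      unfolding A[OF x, symmetric] D[OF x, symmetric] unfolding A_def D_def by (simp add: algebra_simps)
    then show ?thesis by (simp add: pythagoras kfield_def vec2_eq_iff m[OF x])
  qed
  then show ?thesis by blast
qed

end

section \<open>From the model chart to germs on the surface\<close>

lemma kill_cong:
  assumes "open V" "x \<in> V" "\<And>y. y \<in> V \<Longrightarrow> G y = G' y"
  shows "kill G X x u v = kill G' X x u v"
  using fd_cong(1)[OF assms(1,2), of G G'] assms(2,3) by (simp add: kill_def)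

lemma tangent_spaceI:
  assumes "\<And>c. \<not> (c \<in> charts M \<and> P \<in> fst c) \<Longrightarrow> v c = 0"
    and "\<And>c d. c \<in> charts M \<Longrightarrow> d \<in> charts M \<Longrightarrow> P \<in> fst c \<Longrightarrow> P \<in> fst d \<Longrightarrow>
        v d = fd (coord_rep c d id) (snd c P) (v c)"
  shows "v \<in> tangent_space M P"
  using assms unfolding tangent_space_def by blast

lemma tangent_spaceD:
  assumes "v \<in> tangent_space M P"
  shows "\<not> (c \<in> charts M \<and> P \<in> fst c) \<Longrightarrow> v c = 0"
    and "c \<in> charts M \<Longrightarrow> d \<in> charts M \<Longrightarrow> P \<in> fst c \<Longrightarrow> P \<in> fst d \<Longrightarrow>
        v d = fd (coord_rep c d id) (snd c P) (v c)"
  using assms unfolding tangent_space_def by blast+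

text \<open>The chain rule for the change from \<open>k\<close> through \<open>c\<close> to
  \<open>d\<close>. It lets components prescribed in \<open>k\<close> define one tangent vector in
  all charts.\<close>

lemma coord_change_cocycle:
  assumes M: "affine_surface M" and k: "k \<in> charts M" and c: "c \<in> charts M" and d: "d \<in> charts M"
    and P: "P \<in> fst k" "P \<in> fst c" "P \<in> fst d"
  shows "fd (coord_rep k d id) (snd k P) w = fd (coord_rep c d id) (snd c P) (fd (coord_rep k c id) (snd k P) w)"
proof -
  note am = affine_surfaceD[OF M]
  note pk = is_chartD[OF am(1)[OF k]] and pc = is_chartD[OF am(1)[OF c]] and pd = is_chartD[OF am(1)[OF d]]
  let ?V = "chart_image k (fst c \<inter> fst d)"
  have V: "open ?V" by (rule open_chart_image[OF am(1)[OF k]]) (use pc(1) pd(1) in auto)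
  have x: "snd k P \<in> ?V" using pk(8) P by simp
  have y: "coord_rep k c id (snd k P) = snd c P" using P by (simp add: coord_rep_def pk(4))
  have "fd (coord_rep k d id) (snd k P) w = fd (\<lambda>x. coord_rep c d id (coord_rep k c id x)) (snd k P) w"
    by (rule fun_cong[OF fd_cong(1)[OF V x]]) (auto simp: chart_image_def coord_rep_def pk(4) pc(4))
  also have "\<dots> = fd (coord_rep c d id) (coord_rep k c id (snd k P)) (fd (coord_rep k c id) (snd k P) w)"
    by (rule fd_smooth_compose[OF am(2)[OF k c] am(2)[OF c d]]) (use pk(8) pc(8) P y in auto)
  finally show ?thesis by (simp only: y)
qed

lemma vf_rep_related:
  assumes M: "affine_surface M" and k: "k \<in> charts M" and c: "c \<in> charts M"
    and X: "\<And>Q. Q \<in> U \<Longrightarrow> X Q \<in> tangent_space M Q" and W: "W \<subseteq> chart_image k (fst c \<inter> U)"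
  shows "related W (coord_rep k c id) (vf_rep k X) (vf_rep c X)"
  unfolding related_def
proof
  fix x assume "x \<in> W"
  then obtain Q where Q: "Q \<in> fst k" "Q \<in> fst c" "Q \<in> U" "x = snd k Q" using W by (auto simp: chart_image_def)
  note am = affine_surfaceD[OF M]
  note pk = is_chartD[OF am(1)[OF k]] and pc = is_chartD[OF am(1)[OF c]]
  have "X Q c = fd (coord_rep k c id) (snd k Q) (X Q k)"
    by (rule tangent_spaceD(2)[OF X[OF Q(3)] k c Q(1,2)])
  then show "vf_rep c X (coord_rep k c id x) = fd (coord_rep k c id) x (vf_rep k X x)"
    using Q by (simp add: vf_rep_def coord_rep_def pk(4) pc(4))
qed

lemma germ_eq_iff: "germ P X = germ P Y \<longleftrightarrow> eventually (\<lambda>Q. X Q = Y Q) (nhds P)"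
proof
  assume "germ P X = germ P Y"
  moreover have "X \<in> germ P X" by (simp add: germ_def)
  ultimately show "eventually (\<lambda>Q. X Q = Y Q) (nhds P)" by (simp add: germ_def)
next
  assume e: "eventually (\<lambda>Q. X Q = Y Q) (nhds P)"
  show "germ P X = germ P Y"
    unfolding germ_def
  proof (intro Collect_cong iffI)
    fix Z
    have "eventually (\<lambda>Q. (Z Q = X Q) = (Z Q = Y Q)) (nhds P)"
      using e by eventually_elim simp
    from eventually_subst[OF this] show "eventually (\<lambda>Q. Z Q = X Q) (nhds P) \<Longrightarrow> eventually (\<lambda>Q. Z Q = Y Q) (nhds P)"
      "eventually (\<lambda>Q. Z Q = Y Q) (nhds P) \<Longrightarrow> eventually (\<lambda>Q. Z Q = X Q) (nhds P)"
      by simp_all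
  qed
qed

lemma germ_repr: "eventually (\<lambda>Q. germ_repr (germ P X) Q = X Q) (nhds P)"
proof -
  have "X \<in> germ P X" by (simp add: germ_def)
  then have "germ_repr (germ P X) \<in> germ P X" unfolding germ_repr_def by (rule someI[of "\<lambda>Y. Y \<in> germ P X"])
  then show ?thesis by (simp add: germ_def)
qed

text \<open>The bracket differentiates, so agreement has to be carried into each chart on an open
  set and not merely at a point.\<close>

lemma vfield_bracket_cong:
  assumes M: "affine_surface M" and e: "eventually (\<lambda>Q. X Q = X' Q) (nhds P)" "eventually (\<lambda>Q. Y Q = Y' Q) (nhds P)"
  shows "eventually (\<lambda>Q. vfield_bracket M X Y Q = vfield_bracket M X' Y' Q) (nhds P)"
proof -
  from eventually_conj[OF e] obtain N where N: "open N" "P \<in> N" "\<And>Q. Q \<in> N \<Longrightarrow> X Q = X' Q \<and> Y Q = Y' Q"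
    unfolding eventually_nhds by blast
  have "vfield_bracket M X Y Q c = vfield_bracket M X' Y' Q c" if Q: "Q \<in> N" for Q c
  proof (cases "c \<in> charts M \<and> Q \<in> fst c")
    case True
    note ic = affine_surfaceD(1)[OF M, of c]
    have o: "open (chart_image c N)" using open_chart_image ic True N(1) by blast
    have x: "snd c Q \<in> chart_image c N" using True Q by (auto simp: chart_image_def)
    have v: "vf_rep c X y = vf_rep c X' y" "vf_rep c Y y = vf_rep c Y' y" if "y \<in> chart_image c N" for y
      using is_chartD(7)[OF ic that] True N(3) by (simp_all add: vf_rep_def)
    show ?thesis
      using True v[OF x] fd_cong(1)[OF o x v(1)] fd_cong(1)[OF o x v(2)]
      by (simp add: vfield_bracket_def vf_bracket_def)
  qed (auto simp: vfield_bracket_def)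
  then show ?thesis unfolding eventually_nhds using N(1,2) by (intro exI[of _ N]) auto
qed

text \<open>The explicit map goes from parameters to germs, opposite to the direction that
  \<open>killing_isomorphic\<close> asks for.\<close>

lemma lie_isomorphic_inverse:
  assumes b: "bij_betw g (lie_carrier K) (lie_carrier L)"
    and K: "\<And>a b. a \<in> lie_carrier K \<Longrightarrow> b \<in> lie_carrier K \<Longrightarrow> lie_add K a b \<in> lie_carrier K"
      "\<And>a b. a \<in> lie_carrier K \<Longrightarrow> b \<in> lie_carrier K \<Longrightarrow> lie_bracket K a b \<in> lie_carrier K"
      "\<And>r a. a \<in> lie_carrier K \<Longrightarrow> lie_scale K r a \<in> lie_carrier K"
    and h: "\<And>a b. a \<in> lie_carrier K \<Longrightarrow> b \<in> lie_carrier K \<Longrightarrow> g (lie_add K a b) = lie_add L (g a) (g b)"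
      "\<And>a b. a \<in> lie_carrier K \<Longrightarrow> b \<in> lie_carrier K \<Longrightarrow> g (lie_bracket K a b) = lie_bracket L (g a) (g b)"
      "\<And>r a. a \<in> lie_carrier K \<Longrightarrow> g (lie_scale K r a) = lie_scale L r (g a)"
  shows "lie_isomorphic L K"
proof -
  let ?h = "inv_into (lie_carrier K) g"
  have i: "?h (g a) = a" if "a \<in> lie_carrier K" for a
    using bij_betw_imp_inj_on[OF b] that by (rule inv_into_f_f)
  have s: "\<exists>a\<in>lie_carrier K. x = g a" if "x \<in> lie_carrier L" for x
    using b that by (auto simp: bij_betw_def)
  show ?thesis
    unfolding lie_isomorphic_def
  proof (intro exI[of _ ?h] conjI ballI allI)
    show "bij_betw ?h (lie_carrier L) (lie_carrier K)" by (rule bij_betw_inv_into[OF b])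
  next
    fix x y assume "x \<in> lie_carrier L" "y \<in> lie_carrier L"
    then obtain a c where ac: "a \<in> lie_carrier K" "c \<in> lie_carrier K" "x = g a" "y = g c" using s by metis
    show "?h (lie_add L x y) = lie_add K (?h x) (?h y)"
      using ac h(1)[OF ac(1,2)] i K(1) by metis
    show "?h (lie_bracket L x y) = lie_bracket K (?h x) (?h y)"
      using ac h(2)[OF ac(1,2)] i K(2) by metis
  next
    fix r x assume "x \<in> lie_carrier L"
    then obtain a where a: "a \<in> lie_carrier K" "x = g a" using s by metis
    show "?h (lie_scale L r x) = lie_scale K r (?h x)"
      using a h(3)[OF a(1)] i K(3) by metis
  qed
qed

text \<open>The Ricci coefficient of the model is \<open>d\<^sup>2 / 4 - \<kappa>\<close>, so
  \<open>nd\<close> says that it does not vanish.\<close>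

locale model_surface = oscillator +
  fixes M :: "'a::{t2_space, second_countable_topology} surface" and k P d
  assumes M: "affine_surface M" and k: "k \<in> charts M" and P: "P \<in> fst k" and P0: "snd k P = 0"
    and gam: "\<And>x. x \<in> chart_image k UNIV \<Longrightarrow> gam M k x = model d \<kappa> x" and nd: "\<kappa> \<noteq> d\<^sup>2 / 4"
begin

lemmas am = affine_surfaceD[OF M]
lemmas pk = is_chartD[OF am(1)[OF k]]

text \<open>The field with components \<open>kfield p\<close> in \<open>k\<close>, carried to the
  other charts by the coordinate changes. The value 0 elsewhere is what \<open>tangent_space\<close>
  prescribes for charts away from the point.\<close>

definition lift :: "real^4 \<Rightarrow> 'a vfield" where
  "lift p Q c = (if c \<in> charts M \<and> Q \<in> fst c \<and> Q \<in> fst k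
     then fd (coord_rep k c id) (snd k Q) (kfield p (snd k Q)) else 0)"

lemma lift_k: "Q \<in> fst k \<Longrightarrow> lift p Q k = kfield p (snd k Q)"
proof -
  assume Q: "Q \<in> fst k"
  have "fd (coord_rep k k id) (snd k Q) = fd (\<lambda>x. x) (snd k Q)"
    by (rule fd_cong(1)[OF pk(9)]) (use pk(8)[OF Q, of UNIV] pk(5) in \<open>auto simp: coord_rep_def\<close>)
  then show ?thesis using Q k by (simp add: lift_def)
qed

lemma lift_tangent: "Q \<in> fst k \<Longrightarrow> lift p Q \<in> tangent_space M Q"
proof (rule tangent_spaceI)
  assume Q: "Q \<in> fst k"
  fix c d assume "c \<in> charts M" "d \<in> charts M" "Q \<in> fst c" "Q \<in> fst d"
  then show "lift p Q d = fd (coord_rep c d id) (snd c Q) (lift p Q c)"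
    using coord_change_cocycle[OF M k _ _ Q, of c d "kfield p (snd k Q)"] Q by (simp add: lift_def)
qed (auto simp: lift_def)

lemma vf_rep_ext_k: "x \<in> chart_image k UNIV \<Longrightarrow> vf_rep k (lift p) x = kfield p x"
  using pk(5,6) by (simp add: vf_rep_def lift_k)

lemma lift_related:
  assumes "c \<in> charts M"
  shows "related (chart_image k (fst c)) (coord_rep k c id) (kfield p) (vf_rep c (lift p))"
proof -
  have "related (chart_image k (fst c)) (coord_rep k c id) (vf_rep k (lift p)) (vf_rep c (lift p))"
    by (rule vf_rep_related[OF M k assms, of "fst k"]) (auto simp: lift_tangent chart_image_def)
  moreover have "chart_image k (fst c) \<subseteq> chart_image k UNIV" by (auto simp: chart_image_def)
  ultimately show ?thesis unfolding related_def using vf_rep_ext_k by (metis subset_iff)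
qed

lemma lift_smooth:
  assumes c: "c \<in> charts M"
  shows "smooth_on (chart_image c (fst k)) (vf_rep c (lift p))"
proof -
  note p = coord_change(1)[OF M k c]
  note im = coord_change_image(1)[OF am(1)[OF k] am(1)[OF c]]
  have "vf_rep c (lift p) y = push (coord_rep k c id) (coord_rep c k id) (kfield p) y"
    if "y \<in> coord_rep k c id ` chart_image k (fst c)" for y
    using that lift_related[OF c] pdiffD(5)[OF p] by (auto simp: related_def push_def)
  then show ?thesis
    using smooth_cong[OF pdiffD(2)[OF p]] smooth_push[OF p smooth_kfield[OF pdiffD(1)[OF p]]]
    unfolding im by blast
qed

text \<open>The computation in \<open>k\<close> is \<open>kill_kfield\<close>; naturality of the
  Killing operator takes it to every other chart.\<close>

lemma lift_killing: "affine_killing_on M (fst k) (lift p)"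
  unfolding affine_killing_on_def smooth_vector_field_on_def
proof (intro conjI ballI allI impI)
  show "open (fst k)" by (rule pk(1))
  show "fst k \<subseteq> points M" using k by (auto simp: points_def)
  show "Q \<in> fst k \<Longrightarrow> lift p Q \<in> tangent_space M Q" for Q by (rule lift_tangent)
  fix c assume c: "c \<in> charts M"
  show "smooth_on (chart_image c (fst k)) (vf_rep c (lift p))" by (rule lift_smooth[OF c])
  fix Y Z :: field2 and x assume Y: "smooth_on (chart_image c (fst k)) Y" and Z: "smooth_on (chart_image c (fst k)) Z"
    and x: "x \<in> chart_image c (fst k)"
  note cc = coord_change[OF M k c]
  note im = coord_change_image(1)[OF am(1)[OF k] am(1)[OF c]]
  have sub: "chart_image k (fst c) \<subseteq> chart_image k UNIV" "chart_image c (fst k) \<subseteq> chart_image c UNIV"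
    by (auto simp: chart_image_def)
  have G: "smooth_on (chart_image k (fst c)) (gam M k)" "smooth_on (chart_image c (fst k)) (gam M c)"
    using smooth_subset[OF am(4)[OF k] sub(1)] smooth_subset[OF am(4)[OF c] sub(2)] by auto
  have "kill (gam M k) (kfield p) y u v = 0" if "y \<in> chart_image k (fst c)" for y u v
    using kill_cong[OF pk(9), of y "gam M k" "model d \<kappa>"] gam that sub(1) kill_kfield by auto
  from kill_natural[OF cc G(1) _ smooth_kfield[OF pdiffD(1)[OF cc(1)]] _ lift_related[OF c] this]
  have "kill (gam M c) (vf_rep c (lift p)) x u v = 0" for u v
    unfolding im using G(2) lift_smooth[OF c] x by blast
  then show "lie_conn (gam M c) (vf_rep c (lift p)) Y Z x = 0"
    using lie_conn_kill[OF _ G(2) lift_smooth[OF c] Y Z x] pdiffD(2)[OF cc(1)] unfolding im by simp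
qed

lemma ball_in_chart:
  assumes "open W" "0 \<in> W"
  obtains e where "e > 0" "ball 0 e \<subseteq> W \<inter> chart_image k UNIV"
proof -
  have "0 \<in> chart_image k UNIV" using pk(8)[OF P, of UNIV] P0 by simp
  then show ?thesis using assms pk(9) openE[of "W \<inter> chart_image k UNIV" 0] that by (metis IntI open_Int)
qed

lemma eventually_chart:
  assumes "open W" "0 \<in> W"
  shows "eventually (\<lambda>Q. Q \<in> fst k \<and> snd k Q \<in> W) (nhds P)"
proof -
  have "open (fst k \<inter> snd k -` W)" using continuous_open_preimage[OF pk(2,1) assms(1)] .
  then show ?thesis unfolding eventually_nhds using P P0 assms(2)
    by (intro exI[of _ "fst k \<inter> snd k -` W"]) auto
qed

text \<open>Shrinking to a ball around 0 provides the convexity that the classification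
  requires.\<close>

lemma kill_model_imp_kfield:
  assumes V: "open V" "0 \<in> V" "V \<subseteq> chart_image k UNIV" and X: "smooth_on V X"
    and K: "\<And>x u v. x \<in> V \<Longrightarrow> kill (gam M k) X x u v = 0"
  obtains p e where "e > 0" "ball 0 e \<subseteq> V" "\<And>x. x \<in> ball 0 e \<Longrightarrow> X x = kfield p x"
proof -
  obtain e where e: "e > 0" "ball 0 e \<subseteq> V \<inter> chart_image k UNIV" using ball_in_chart[OF V(1,2)] .
  have "kill (model d \<kappa>) X x u v = 0" if "x \<in> ball 0 e" for x u v
    using kill_cong[OF V(1), of x "gam M k" "model d \<kappa>"] gam V(3) K e(2) that by (metis le_infE subset_iff)
  then have "\<exists>p. \<forall>x\<in>ball 0 e. X x = kfield p x"
    by (intro killing_classification[OF open_ball convex_ball _ smooth_subset[OF X] _ nd]) (use e in auto)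
  then show ?thesis using that e by auto
qed

text \<open>The components in \<open>k\<close> are explicit on a ball, and compatibility of tangent
  vectors forces those in all other charts.\<close>

lemma killing_germ:
  assumes U: "P \<in> U" and X: "affine_killing_on M U X"
  obtains p where "germ P X = germ P (lift p)"
proof -
  have oU: "open U" and T: "\<And>Q. Q \<in> U \<Longrightarrow> X Q \<in> tangent_space M Q"
    and sm: "smooth_on (chart_image k U) (vf_rep k X)"
    and L: "\<And>Y Z x. smooth_on (chart_image k U) Y \<Longrightarrow> smooth_on (chart_image k U) Z \<Longrightarrow>
        x \<in> chart_image k U \<Longrightarrow> lie_conn (gam M k) (vf_rep k X) Y Z x = 0"
    using X k by (auto simp: affine_killing_on_def smooth_vector_field_on_def)
  let ?V = "chart_image k U"
  have V: "open ?V" "?V \<subseteq> chart_image k UNIV" using open_chart_image[OF am(1)[OF k] oU] by (auto simp: chart_image_def)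
  have 0: "0 \<in> ?V" using pk(8)[OF P, of U] U P0 by simp
  note c = smooth_const[of ?V]
  have K: "kill (gam M k) (vf_rep k X) x u v = 0" if "x \<in> ?V" for x u v
    using lie_conn_kill[OF V(1) smooth_subset[OF am(4)[OF k] V(2)] sm c c that, of u v] L[OF c c that] by simp
  obtain p e where pe: "e > 0" "ball 0 e \<subseteq> ?V" "\<And>x. x \<in> ball 0 e \<Longrightarrow> vf_rep k X x = kfield p x"
    using kill_model_imp_kfield[OF V(1) 0 V(2) sm K] by metis
  have "X Q = lift p Q" if Q: "Q \<in> fst k" "snd k Q \<in> ball 0 e" for Q
  proof
    fix c
    have QU: "Q \<in> U" using pk(8)[OF Q(1), of U] Q(2) pe(2) by blast
    have Xk: "X Q k = kfield p (snd k Q)" using pe(3)[OF Q(2)] Q(1) by (simp add: vf_rep_def pk(4))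
    show "X Q c = lift p Q c"
    proof (cases "c \<in> charts M \<and> Q \<in> fst c")
      case True
      then have "X Q c = fd (coord_rep k c id) (snd k Q) (X Q k)"
        using tangent_spaceD(2)[OF T[OF QU] k _ Q(1)] by blast
      then show ?thesis using True Q(1) Xk by (simp add: lift_def)
    next
      case False
      then show ?thesis using tangent_spaceD(1)[OF T[OF QU] False] by (auto simp: lift_def)
    qed
  qed
  then have "eventually (\<lambda>Q. X Q = lift p Q) (nhds P)"
    using eventually_chart[OF open_ball, of 0 e] pe(1) by (auto elim!: eventually_mono)
  then show ?thesis using that germ_eq_iff by blast
qed

lemma lift_bracket: "Q \<in> fst k \<Longrightarrow> vfield_bracket M (lift p) (lift q) Q = lift (param_bracket \<kappa> p q) Q"
proof
  fix c assume Q: "Q \<in> fst k"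
  show "vfield_bracket M (lift p) (lift q) Q c = lift (param_bracket \<kappa> p q) Q c"
  proof (cases "c \<in> charts M \<and> Q \<in> fst c")
    case True
    then have c: "c \<in> charts M" by simp
    note cc = coord_change(1)[OF M k c]
    note im = coord_change_image(1)[OF am(1)[OF k] am(1)[OF c]]
    have r: "related (chart_image k (fst c)) (coord_rep k c id) (vf_bracket (kfield p) (kfield q))
        (vf_bracket (vf_rep c (lift p)) (vf_rep c (lift q)))"
      by (rule related_vf_bracket[OF cc]; (rule smooth_kfield[OF pdiffD(1)[OF cc]] lift_related[OF c])?)
         (use lift_smooth[OF c] im in simp_all)
    have "snd k Q \<in> chart_image k (fst c)" "coord_rep k c id (snd k Q) = snd c Q"
      using True Q by (auto simp: chart_image_def coord_rep_def pk(4))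
    then have "vf_bracket (vf_rep c (lift p)) (vf_rep c (lift q)) (snd c Q) =
        fd (coord_rep k c id) (snd k Q) (vf_bracket (kfield p) (kfield q) (snd k Q))"
      using r unfolding related_def by metis
    then show ?thesis
      using True Q by (simp add: vfield_bracket_def lift_def vf_bracket_kfield)
  qed (auto simp: vfield_bracket_def lift_def)
qed

lemma lift_linear: "lift (p + q) Q c = lift p Q c + lift q Q c" "lift (r *\<^sub>R p) Q c = r *\<^sub>R lift p Q c"
proof -
  have l: "linear (fd (coord_rep k c id) (snd k Q))" if "c \<in> charts M" "Q \<in> fst c" "Q \<in> fst k"
    by (rule smooth_linear[OF am(2)[OF k that(1)]]) (use that in \<open>auto simp: chart_image_def\<close>)
  show "lift (p + q) Q c = lift p Q c + lift q Q c" "lift (r *\<^sub>R p) Q c = r *\<^sub>R lift p Q c"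
    using linear_add[OF l] linear_cmul[OF l] by (auto simp: lift_def kfield_linear)
qed

text \<open>Parameters and germs correspond linearly and bijectively, and the bracket of lifts is
  \<open>param_bracket\<close>. Identifying the Lie algebra thus amounts to a linear change of basis
  in \<open>real^4\<close> that matches the two brackets.\<close>

lemma killing_algebra_isomorphic:
  fixes A :: "real^4 \<Rightarrow> real^4"
  assumes A: "linear A" "bij A" and br: "\<And>x y. A (lie_bracket (lie_of_table B) x y) = param_bracket \<kappa> (A x) (A y)"
  shows "lie_isomorphic (killing_algebra M P) (lie_of_table B)"
proof (rule lie_isomorphic_inverse)
  let ?L = "killing_algebra M P" and ?K = "lie_of_table B"
  let ?g = "\<lambda>x. germ P (lift (A x))"
  have carrier: "lie_carrier ?L = range (\<lambda>p. germ P (lift p))"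
  proof
    show "lie_carrier ?L \<subseteq> range (\<lambda>p. germ P (lift p))"
      unfolding killing_algebra_def using killing_germ by (auto simp: image_iff) (metis)
    show "range (\<lambda>p. germ P (lift p)) \<subseteq> lie_carrier ?L"
      unfolding killing_algebra_def using lift_killing P by auto
  qed
  have inj: "inj (\<lambda>p. germ P (lift p))"
  proof (rule injI)
    fix p q assume "germ P (lift p) = germ P (lift q)"
    then obtain N where N: "open N" "P \<in> N" "\<And>Q. Q \<in> N \<Longrightarrow> lift p Q = lift q Q"
      unfolding germ_eq_iff eventually_nhds by blast
    show "p = q"
    proof (rule kfield_inj)
      show "open (chart_image k N)" by (rule open_chart_image[OF am(1)[OF k] N(1)])
      show "0 \<in> chart_image k N" using pk(8)[OF P, of N] P0 N(2) by simp
      fix x assume "x \<in> chart_image k N"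
      then obtain Q where Q: "Q \<in> fst k" "Q \<in> N" "x = snd k Q" by (auto simp: chart_image_def)
      then show "kfield p x = kfield q x" using N(3)[OF Q(2)] lift_k[OF Q(1)] by metis
    qed
  qed
  have "inj ?g" using inj_compose[OF inj bij_is_inj[OF A(2)]] by (simp add: o_def)
  moreover have "range ?g = range (\<lambda>p. germ P (lift p))"
  proof -
    have "range ?g = (\<lambda>p. germ P (lift p)) ` range A" by (simp add: image_image)
    then show ?thesis using bij_is_surj[OF A(2)] by simp
  qed
  ultimately show "bij_betw ?g (lie_carrier ?K) (lie_carrier ?L)"
    unfolding carrier by (simp add: bij_betw_def lie_of_table_def)
  \<comment> \<open>The operations on germs use chosen representatives, which agree with the lifts
    only near \<open>P\<close>; the three identities are therefore checked eventually at
    \<open>P\<close>.\<close>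
  note rep = germ_repr[of P]
  fix x y r
  show "?g (lie_add ?K x y) = lie_add ?L (?g x) (?g y)"
  proof -
    have "eventually (\<lambda>Q. lift (A x + A y) Q =
        (\<lambda>c. germ_repr (germ P (lift (A x))) Q c + germ_repr (germ P (lift (A y))) Q c)) (nhds P)"
      using rep[of "lift (A x)"] rep[of "lift (A y)"] by eventually_elim (simp add: fun_eq_iff lift_linear)
    then show ?thesis by (simp add: killing_algebra_def lie_of_table_def germ_eq_iff linear_add[OF A(1)])
  qed
  show "?g (lie_scale ?K r x) = lie_scale ?L r (?g x)"
  proof -
    have "eventually (\<lambda>Q. lift (r *\<^sub>R A x) Q = (\<lambda>c. r *\<^sub>R germ_repr (germ P (lift (A x))) Q c)) (nhds P)"
      using rep[of "lift (A x)"] by eventually_elim (simp add: fun_eq_iff lift_linear)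
    then show ?thesis by (simp add: killing_algebra_def lie_of_table_def germ_eq_iff linear_cmul[OF A(1)])
  qed
  show "?g (lie_bracket ?K x y) = lie_bracket ?L (?g x) (?g y)"
  proof -
    have "eventually (\<lambda>Q. Q \<in> fst k) (nhds P)" using pk(1) P eventually_nhds by blast
    moreover have "eventually (\<lambda>Q. vfield_bracket M (germ_repr (?g x)) (germ_repr (?g y)) Q
        = vfield_bracket M (lift (A x)) (lift (A y)) Q) (nhds P)"
      by (rule vfield_bracket_cong[OF M rep rep])
    ultimately have "eventually (\<lambda>Q. lift (param_bracket \<kappa> (A x) (A y)) Q
        = vfield_bracket M (germ_repr (?g x)) (germ_repr (?g y)) Q) (nhds P)"
      by eventually_elim (simp add: lift_bracket)
    then show ?thesis by (simp add: killing_algebra_def germ_eq_iff br)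
  qed
qed (simp_all add: lie_of_table_def)

end

section \<open>Classification\<close>

lemma lie_bracket_table:
  "lie_bracket (lie_of_table B) x y = (\<Sum>i\<in>UNIV. \<Sum>j\<in>UNIV. (x $ i * y $ j - x $ j * y $ i) *\<^sub>R B i j)"
  by (simp add: lie_of_table_def)

lemma lie_bracket_A4_12:
  "lie_bracket A4_12 x y = vec4 (x $ 1 * y $ 3 - x $ 3 * y $ 1 + (x $ 2 * y $ 4 - x $ 4 * y $ 2))
     (x $ 2 * y $ 3 - x $ 3 * y $ 2 - (x $ 1 * y $ 4 - x $ 4 * y $ 1)) 0 0"
  unfolding A4_12_def lie_bracket_table by (simp add: sum_4 vec4_eq_iff axis_def algebra_simps)

lemma lie_bracket_A4_9_0:
  "lie_bracket A4_9_0 x y = vec4 (x $ 2 * y $ 3 - x $ 3 * y $ 2 + (x $ 1 * y $ 4 - x $ 4 * y $ 1))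
     (x $ 2 * y $ 4 - x $ 4 * y $ 2) 0 0"
  unfolding A4_9_0_def lie_bracket_table by (simp add: sum_4 vec4_eq_iff axis_def algebra_simps)

lemma lie_bracket_A2_A2:
  "lie_bracket A2_A2 x y = vec4 0 (x $ 1 * y $ 2 - x $ 2 * y $ 1) 0 (x $ 3 * y $ 4 - x $ 4 * y $ 3)"
  unfolding A2_A2_def lie_bracket_table by (simp add: sum_4 vec4_eq_iff axis_def algebra_simps)

lemma bij_inverse:
  assumes "\<And>x. B (A x) = x" "\<And>y. A (B y) = y"
  shows "bij A"
  by (rule o_bij[of B]) (simp_all add: fun_eq_iff assms)

context model_surface
begin

lemma killing_A4_12:
  assumes "\<kappa> < 0"
  shows "lie_isomorphic (killing_algebra M P) A4_12"
proof -
  define m where "m = sqrt (- \<kappa>)"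
  have m: "m > 0" "\<kappa> = - (m * m)" using assms by (simp_all add: m_def)
  \<comment> \<open>With \<open>C = cos (m y)\<close> and \<open>S = sin (m y) / m\<close>, the
    basis goes to \<open>cos (m x\<^sup>2) \<partial>\<^sub>1\<close>,
    \<open>- sin (m x\<^sup>2) \<partial>\<^sub>1\<close>,
    \<open>x\<^sup>1 \<partial>\<^sub>1\<close> and \<open>\<partial>\<^sub>2 / m\<close>: the last
    field rotates the first two.\<close>
  let ?A = "\<lambda>x::real^4. vec4 (x $ 4 / m) (x $ 3) (x $ 1) (- m * x $ 2)"
  let ?B = "\<lambda>p::real^4. vec4 (p $ 3) (- p $ 4 / m) (p $ 2) (m * p $ 1)"
  have "linear ?A" by (auto intro!: linearI simp: vec4_eq_iff algebra_simps add_divide_distrib)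
  moreover have "bij ?A" by (rule bij_inverse[of ?B]) (use m in \<open>simp_all add: vec4_eq_iff\<close>)
  moreover have "?A (lie_bracket A4_12 x y) = param_bracket \<kappa> (?A x) (?A y)" for x y
    using m by (simp add: lie_bracket_A4_12 param_bracket_def vec4_eq_iff field_simps)
  ultimately show ?thesis unfolding A4_12_def by (rule killing_algebra_isomorphic)
qed

lemma killing_A4_9_0:
  assumes "\<kappa> = 0"
  shows "lie_isomorphic (killing_algebra M P) A4_9_0"
proof -
  \<comment> \<open>Here \<open>C = 1\<close> and \<open>S = y\<close>; the basis goes to
    \<open>\<partial>\<^sub>1\<close>, \<open>x\<^sup>2 \<partial>\<^sub>1\<close>,
    \<open>- \<partial>\<^sub>2\<close> and \<open>x\<^sup>1 \<partial>\<^sub>1\<close>.\<close>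
  let ?A = "\<lambda>x::real^4. vec4 (- x $ 3) (x $ 4) (x $ 1) (x $ 2)"
  let ?B = "\<lambda>p::real^4. vec4 (p $ 3) (p $ 4) (- p $ 1) (p $ 2)"
  have "linear ?A" by (auto intro!: linearI simp: vec4_eq_iff algebra_simps)
  moreover have "bij ?A" by (rule bij_inverse[of ?B]) (simp_all add: vec4_eq_iff)
  moreover have "?A (lie_bracket A4_9_0 x y) = param_bracket \<kappa> (?A x) (?A y)" for x y
    using assms by (simp add: lie_bracket_A4_9_0 param_bracket_def vec4_eq_iff algebra_simps)
  ultimately show ?thesis unfolding A4_9_0_def by (rule killing_algebra_isomorphic)
qed

lemma killing_A2_A2:
  assumes "\<kappa> > 0"
  shows "lie_isomorphic (killing_algebra M P) A2_A2"
proof -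
  define m where "m = sqrt \<kappa>"
  have m: "m > 0" "\<kappa> = m * m" using assms by (simp_all add: m_def)
  \<comment> \<open>The elements \<open>e2\<close> and \<open>e4\<close> go to
    \<open>exp (m x\<^sup>2) \<partial>\<^sub>1\<close> and
    \<open>exp (- m x\<^sup>2) \<partial>\<^sub>1\<close>, eigenvectors of both
    \<open>\<partial>\<^sub>2\<close> and \<open>x\<^sup>1 \<partial>\<^sub>1\<close>. The images of
    \<open>e1\<close> and \<open>e3\<close> are the combinations of these two that act on one
    eigenvector and annihilate the other.\<close>
  let ?A = "\<lambda>x::real^4. vec4 ((x $ 1 - x $ 3) / (2 * m)) (- (x $ 1 + x $ 3) / 2) (x $ 2 + x $ 4) (m * (x $ 2 - x $ 4))"
  let ?B = "\<lambda>p::real^4. vec4 (m * p $ 1 - p $ 2) ((p $ 3 + p $ 4 / m) / 2) (- m * p $ 1 - p $ 2) ((p $ 3 - p $ 4 / m) / 2)"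
  have "linear ?A" by (auto intro!: linearI simp: vec4_eq_iff algebra_simps add_divide_distrib diff_divide_distrib)
  moreover have "bij ?A" by (rule bij_inverse[of ?B]) (use m in \<open>simp_all add: vec4_eq_iff field_simps\<close>)
  moreover have "?A (lie_bracket A2_A2 x y) = param_bracket \<kappa> (?A x) (?A y)" for x y
    using m by (simp add: lie_bracket_A2_A2 param_bracket_def vec4_eq_iff field_simps)
  ultimately show ?thesis unfolding A2_A2_def by (rule killing_algebra_isomorphic)
qed

text \<open>A Type B chart has the Killing fields \<open>X = \<partial>\<^sub>2\<close> and \<open>Y = x\<^sup>1 \<partial>\<^sub>1 + x\<^sup>2 \<partial>\<^sub>2\<close>, linearly independent at every point,
  with \<open>[X, Y] = X\<close>. If \<open>\<kappa> < 0\<close>, then \<open>[X, Y] = X \<noteq> 0\<close> forces both fields to be multiples of \<open>\<partial>\<^sub>1\<close> in the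
  model chart.\<close>

lemma not_type_B:
  assumes neg: "\<kappa> < 0"
  shows "\<not> type_B M"
proof
  assume "type_B M"
  moreover have "P \<in> points M" using k P by (auto simp: points_def)
  ultimately obtain c C where c: "c \<in> charts M" "P \<in> fst c"
    "\<And>x. x \<in> chart_image c UNIV \<Longrightarrow> x $ 1 \<noteq> 0 \<and> gam M c x = inverse (x $ 1) *\<^sub>R C"
    unfolding type_B_def by blast
  note ic = am(1)[OF c(1)] and pc = is_chartD[OF am(1)[OF c(1)]]
  let ?V = "chart_image c (fst k)" and ?t = "coord_rep c k id" and ?s = "coord_rep k c id"
  note cc = coord_change[OF M c(1) k] and im = coord_change_image(1)[OF ic am(1)[OF k]]
  note pV = pdiffD[OF cc(1)]
  have sub: "?V \<subseteq> chart_image c UNIV" "chart_image k (fst c) \<subseteq> chart_image k UNIV" by (auto simp: chart_image_def)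
  have G: "smooth_on ?V (gam M c)" "smooth_on (?t ` ?V) (gam M k)"
    unfolding im using smooth_subset[OF am(4)[OF c(1)] sub(1)] smooth_subset[OF am(4)[OF k] sub(2)] .
  define X where "X = (\<lambda>_::real^2. axis 2 1 :: real^2)"
  define Y where "Y = (\<lambda>x::real^2. x)"
  have sm: "smooth_on ?V X" "smooth_on ?V Y" by (auto simp: X_def Y_def smooth_const smooth_ident)
  have dG: "fd (gam M c) x h = (- (inverse (x $ 1) * h $ 1 * inverse (x $ 1))) *\<^sub>R C" if x: "x \<in> ?V" for x h
  proof -
    have x1: "x $ 1 \<noteq> 0" using c(3) x sub(1) by blast
    have "((\<lambda>x::real^2. inverse (x $ 1) *\<^sub>R C) has_derivative (\<lambda>h. (- (inverse (x $ 1) * h $ 1 * inverse (x $ 1))) *\<^sub>R C)) (at x)"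
      by (intro has_derivative_scaleR_left Deriv.has_derivative_inverse x1
          bounded_linear.has_derivative[OF bounded_linear_vec_nth has_derivative_ident])
    then have "(gam M c has_derivative (\<lambda>h. (- (inverse (x $ 1) * h $ 1 * inverse (x $ 1))) *\<^sub>R C)) (at x)"
      by (rule has_derivative_transform_within_open[OF _ pV(1) x]) (use c(3) sub(1) in auto)
    from fd_eqI[OF this] show ?thesis by simp
  qed
  have kX: "kill (gam M c) X x u v = 0" if "x \<in> ?V" for x u v
    unfolding kill_def dG[OF that] by (simp add: X_def christ_simps axis_def)
  have kY: "kill (gam M c) Y x u v = 0" if x: "x \<in> ?V" for x u v
  proof -
    have "x $ 1 \<noteq> 0" "gam M c x = inverse (x $ 1) *\<^sub>R C" using c(3) x sub(1) by auto
    moreover have "christ (- A) u v = - christ A u v" for A by (simp add: christ_def sum_2 vec_eq_iff)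
    ultimately show ?thesis
      unfolding kill_def dG[OF x] by (simp add: Y_def christ_simps)
  qed
  let ?X = "push ?t ?s X" and ?Y = "push ?t ?s Y"
  note smp = smooth_push[OF cc(1)] and rel = related_push[OF cc(1)]
  have K: "kill (gam M k) ?X y u v = 0" "kill (gam M k) ?Y y u v = 0" if "y \<in> chart_image k (fst c)" for y u v
    using kill_natural[OF cc G sm(1) smp[OF sm(1)] rel kX] kill_natural[OF cc G sm(2) smp[OF sm(2)] rel kY] that
    unfolding im by blast+
  have W: "open (chart_image k (fst c))" "0 \<in> chart_image k (fst c)"
    using pV(2) pk(8)[OF P, of "fst c"] c(2) P0 unfolding im by auto
  obtain p e where p: "e > 0" "ball 0 e \<subseteq> chart_image k (fst c)" "\<And>x. x \<in> ball 0 e \<Longrightarrow> ?X x = kfield p x"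
    using kill_model_imp_kfield[OF W sub(2) smp[OF sm(1), unfolded im] K(1)] by metis
  obtain q e' where q: "e' > 0" "ball 0 e' \<subseteq> chart_image k (fst c)" "\<And>x. x \<in> ball 0 e' \<Longrightarrow> ?Y x = kfield q x"
    using kill_model_imp_kfield[OF W sub(2) smp[OF sm(2), unfolded im] K(2)] by metis
  define B where "B = ball (0::real^2) (min e e')"
  have B: "open B" "0 \<in> B" "B \<subseteq> ?t ` ?V" "\<And>x. x \<in> B \<Longrightarrow> ?X x = kfield p x" "\<And>x. x \<in> B \<Longrightarrow> ?Y x = kfield q x"
    unfolding B_def im using p q by auto
  have XY: "vf_bracket X Y = X" by (simp add: vf_bracket_def[abs_def] X_def Y_def)
  have rb: "related ?V ?t X (vf_bracket ?X ?Y)"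
    using related_vf_bracket[OF cc(1) sm(1) smp[OF sm(1)] rel sm(2) smp[OF sm(2)] rel] unfolding XY .
  have "kfield (param_bracket \<kappa> p q) x = kfield p x" if x: "x \<in> B" for x
  proof -
    obtain z where z: "z \<in> ?V" "x = ?t z" using B(3) x by auto
    have "vf_bracket ?X ?Y x = ?X x" using rb rel[of X] z by (simp add: related_def)
    moreover have "vf_bracket ?X ?Y x = vf_bracket (kfield p) (kfield q) x"
      using B(4)[OF x] B(5)[OF x] fd_cong(1)[OF B(1) x B(4)] fd_cong(1)[OF B(1) x B(5)]
      by (simp add: vf_bracket_def)
    ultimately show ?thesis using B(4)[OF x] by (simp add: vf_bracket_kfield)
  qed
  then have br: "param_bracket \<kappa> p q = p" by (rule kfield_inj[OF B(1,2)])
  \<comment> \<open>Brackets of Killing fields have no \<open>\<partial>\<^sub>2\<close> and no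
    \<open>x\<^sup>1 \<partial>\<^sub>1\<close> component, and \<open>p\<close> is such a
    bracket.\<close>
  have p12: "p $ 1 = 0" "p $ 2 = 0" using br by (simp_all add: param_bracket_def vec4_eq_iff)
  then have e1: "(q $ 2 - 1) * p $ 3 = q $ 1 * p $ 4" "(q $ 2 - 1) * p $ 4 = \<kappa> * (q $ 1 * p $ 3)"
    using br by (simp_all add: param_bracket_def vec4_eq_iff algebra_simps)
  define x0 where "x0 = snd c P"
  have x0: "x0 \<in> ?V" "?t x0 = 0" using c(2) P P0 by (auto simp: x0_def chart_image_def coord_rep_def pc(4))
  have x01: "x0 $ 1 \<noteq> 0" using c(3) x0(1) sub(1) by blast
  have X0: "fd ?t x0 (axis 2 1) = kfield p 0" "fd ?t x0 x0 = kfield q 0"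
    using B(4)[OF B(2)] B(5)[OF B(2)] rel[of X] rel[of Y] x0 by (auto simp: related_def X_def Y_def)
  have inv: "fd ?s 0 (fd ?t x0 v) = v" for v using pdiff_fd_inv[OF cc(1) x0(1), of v] x0(2) by simp
  have ls: "linear (fd ?s 0)" by (rule smooth_linear[OF pV(4)]) (use W(2) im in simp)
  have nz: "p $ 3 \<noteq> 0"
  proof
    assume "p $ 3 = 0"
    then have "kfield p 0 = 0" using p12 by (simp add: kfield_def vec2_eq_iff S0)
    then have "axis 2 1 = (0::real^2)" using inv[of "axis 2 1"] X0 linear_0[OF ls] by simp
    then show False by simp
  qed
  have q1: "q $ 1 = 0"
  proof (rule ccontr)
    assume q1: "q $ 1 \<noteq> 0"
    \<comment> \<open>The relations \<open>e1\<close> say that the matrix with rows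
      \<open>(0, 1)\<close> and \<open>(\<kappa>, 0)\<close>, multiplied by \<open>q $ 1\<close>,
      has the eigenvalue \<open>q $ 2 - 1\<close>. For \<open>\<kappa> < 0\<close> its eigenvalues
      are imaginary unless \<open>q $ 1 = 0\<close>.\<close>
    have "p $ 3 * ((q $ 2 - 1)\<^sup>2 - \<kappa> * (q $ 1)\<^sup>2) = 0"
      using e1 by algebra
    then have "(q $ 2 - 1)\<^sup>2 = \<kappa> * (q $ 1)\<^sup>2" using nz by simp
    moreover have "\<kappa> * (q $ 1)\<^sup>2 < 0" using neg q1 by (simp add: mult_neg_pos)
    ultimately show False using zero_le_power2[of "q $ 2 - 1"] by linarith
  qed
  \<comment> \<open>At \<open>P\<close> both fields are multiples of
    \<open>\<partial>\<^sub>1\<close> in the model chart. Pulled back, \<open>axis 2 1\<close> and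
    \<open>x0\<close> are multiples of one vector \<open>z\<close>, so \<open>x0 $ 1 = 0\<close>,
    which a Type B chart excludes.\<close>
  define z where "z = fd ?s 0 (axis 1 1)"
  have "kfield p 0 = p $ 3 *\<^sub>R axis 1 1" "kfield q 0 = q $ 3 *\<^sub>R axis 1 1"
    using p12 q1 by (simp_all add: kfield_def vec2_def C0 S0)
  then have "axis 2 1 = p $ 3 *\<^sub>R z" "x0 = q $ 3 *\<^sub>R z"
    using inv[of "axis 2 1"] inv[of x0] X0 by (simp_all add: z_def linear_cmul[OF ls])
  then have "(axis 2 1 :: real^2) $ 1 = (p $ 3 *\<^sub>R z) $ 1" "x0 $ 1 = (q $ 3 *\<^sub>R z) $ 1" by metis+
  then have "p $ 3 * z $ 1 = 0" "x0 $ 1 = q $ 3 * z $ 1" by (simp_all add: axis_def)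
  then show False using nz x01 by simp
qed

end

text \<open>For \<open>\<kappa> = r\<^sup>2\<close>, the Killing fields \<open>exp (r x\<^sup>2) \<partial>\<^sub>1\<close> and \<open>\<partial>\<^sub>2 + (r + 1) x\<^sup>1 \<partial>\<^sub>1\<close> become \<open>\<partial>\<^sub>2\<close> and
  \<open>x\<^sup>1 \<partial>\<^sub>1 + x\<^sup>2 \<partial>\<^sub>2\<close> in the coordinates \<open>(exp x\<^sup>2, exp (- r x\<^sup>2) x\<^sup>1)\<close>.\<close>

lemma model_to_type_B:
  fixes r d :: real
  obtains F H C where "pdiff UNIV F H" "\<And>i j. C $ i $ j = C $ j $ i" "\<And>x. F x $ 1 > 0"
    "\<And>W. transforms W F (model d (r * r)) (\<lambda>y. inverse (y $ 1) *\<^sub>R C)"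
proof -
  \<comment> \<open>The constants are read off the geodesic equations in the new coordinates. From
    \<open>y\<^sup>1 = exp x\<^sup>2\<close> and the symbol \<open>d\<close> of the model comes
    \<open>d - 1\<close>; the mixed coefficient \<open>r + d / 2\<close> collects the factor
    \<open>exp (- r x\<^sup>2)\<close> and the symbol \<open>d / 2\<close>.\<close>
  define C where "C = sym3 (vec2 (d - 1) 0) (vec2 0 (r + d / 2)) 0"
  define F where "F x = vec2 (exp (x $ 2)) (exp (- r * x $ 2) * x $ 1)" for x :: "real^2"
  define H where "H y = vec2 (exp (r * ln (y $ 1)) * y $ 2) (ln (y $ 1))" for y :: "real^2"
  let ?O = "{y::real^2. y $ 1 > 0}"
  have oO: "open ?O" by (intro open_Collect_less continuous_intros)
  have smF: "smooth_on UNIV F"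
    unfolding F_def[abs_def]
    by (intro smooth_vec2[OF open_UNIV] smooth_mult[OF open_UNIV] smooth_nth_real[OF open_UNIV smooth_exp]
        smooth_nth_real[OF open_UNIV smooth_affine_arg[OF smooth_exp]] smooth_vec_nth[OF open_UNIV smooth_ident])
  have ln: "smooth_on ?O (\<lambda>y. ln (y $ 1))"
    by (rule smooth_compose[OF oO open_greaterThan smooth_vec_nth[OF oO smooth_ident] smooth_ln]) auto
  have smH: "smooth_on ?O H"
    unfolding H_def[abs_def]
    by (intro smooth_vec2[OF oO] smooth_mult[OF oO] ln smooth_vec_nth[OF oO smooth_ident]
        smooth_compose[OF oO open_UNIV ln smooth_affine_arg[OF smooth_exp]]) auto
  have HF: "H (F x) = x" for x by (simp add: H_def F_def vec2_eq_iff flip: exp_add mult.assoc)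
  have FH: "F (H y) = y" if "y \<in> ?O" for y
    using that by (simp add: H_def F_def vec2_eq_iff flip: exp_add mult.assoc)
  have im: "F ` UNIV = ?O"
  proof
    show "F ` UNIV \<subseteq> ?O" by (auto simp: F_def)
    show "?O \<subseteq> F ` UNIV" using FH by (metis rangeI subsetI)
  qed
  have pF: "pdiff UNIV F H" unfolding pdiff_def im using smF smH oO HF by simp
  have Cs: "C $ i $ j = C $ j $ i" for i j by (simp add: C_def sym3_def)
  note n = bounded_linear.has_derivative[OF bounded_linear_vec_nth has_derivative_ident]
  have ex: "(exp has_real_derivative exp y) (at y)" for y :: real by (rule DERIV_exp)
  have er: "((\<lambda>y. exp (- r * y)) has_real_derivative - r * exp (- r * y)) (at y)" for y
    by (auto intro!: derivative_eq_intros)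
  have dF: "fd F x = (\<lambda>v. vec2 (exp (x $ 2) * v $ 2) (exp (- r * x $ 2) * v $ 1 + - r * exp (- r * x $ 2) * v $ 2 * x $ 1))" for x
    unfolding F_def[abs_def]
    by (rule fd_eqI) (intro has_derivative_vec2 has_derivative_mult has_derivative_nth_real[OF ex] has_derivative_nth_real[OF er] n)
  have d2F: "fd2 F x u v = vec2 (exp (x $ 2) * u $ 2 * v $ 2)
      (- r * exp (- r * x $ 2) * u $ 2 * v $ 1 + (- r * exp (- r * x $ 2) * v $ 2 * u $ 1
        + - r * (- r * exp (- r * x $ 2) * u $ 2) * v $ 2 * x $ 1))" for x u v
    unfolding dF
    by (rule fun_cong[OF fd_eqI]) (intro has_derivative_vec2 has_derivative_add has_derivative_mult
        has_derivative_mult_left has_derivative_mult_right has_derivative_nth_real[OF ex] has_derivative_nth_real[OF er] n)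
  have "transforms W F (model d (r * r)) (\<lambda>y. inverse (y $ 1) *\<^sub>R C)" for W
    unfolding transforms_def
  proof (intro ballI allI)
    fix x u v
    show "fd2 F x u v + christ (inverse (F x $ 1) *\<^sub>R C) (fd F x u) (fd F x v) = fd F x (christ (model d (r * r) x) u v)"
      unfolding d2F unfolding dF christ_simps C_def model_def christ_sym3
      by (simp add: vec2_eq_iff F_def field_simps)
  qed
  then show ?thesis using that[OF pF Cs] by (simp add: F_def)
qed

lemma type_B_from_model:
  assumes M: "affine_surface M" and A: "type_A M"
    and ch: "\<And>P. P \<in> points M \<Longrightarrow> \<exists>k\<in>charts M. P \<in> fst k \<and> (\<forall>x\<in>chart_image k UNIV. gam M k x = model d \<kappa> x)"
    and \<kappa>: "\<kappa> \<ge> 0"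
  shows "type_B M"
  unfolding type_B_def
proof (intro conjI ballI)
  show "locally_homogeneous M" "\<not> flat M" using A by (auto simp: type_A_def)
  fix P assume "P \<in> points M"
  then obtain k where k: "k \<in> charts M" "P \<in> fst k" "\<And>x. x \<in> chart_image k UNIV \<Longrightarrow> gam M k x = model d \<kappa> x"
    using ch by blast
  note pk = is_chartD[OF affine_surfaceD(1)[OF M k(1)]]
  let ?W = "chart_image k UNIV"
  have r: "\<kappa> = sqrt \<kappa> * sqrt \<kappa>" using \<kappa> by simp
  obtain F H C where F: "pdiff UNIV F H" "\<And>i j. C $ i $ j = C $ j $ i" "\<And>x. F x $ 1 > 0"
    "\<And>W. transforms W F (model d (sqrt \<kappa> * sqrt \<kappa>)) (\<lambda>y. inverse (y $ 1) *\<^sub>R C)"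
    using model_to_type_B[of d "sqrt \<kappa>"] by metis
  have pF: "pdiff ?W F H" by (rule pdiff_subset[OF F(1) pk(9)]) simp
  have tlF: "transforms ?W F (gam M k) (\<lambda>y. inverse (y $ 1) *\<^sub>R C)"
    using F(4)[of ?W] k(3) r unfolding transforms_def by simp
  obtain c where c: "c \<in> charts M" "fst c = chart_inv k ` ?W" "chart_image c UNIV = F ` ?W"
    "\<And>y. y \<in> F ` ?W \<Longrightarrow> gam M c y = inverse (y $ 1) *\<^sub>R C"
    using new_chart[OF M k(1) pF subset_refl tlF] by metis
  have "P \<in> fst c" unfolding c(2) using pk(4,8)[OF k(2)] by (metis UNIV_I image_eqI)
  moreover have "x $ 1 \<noteq> 0" if "x \<in> F ` ?W" for x using that F(3) by (metis imageE less_irrefl)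
  ultimately show "\<exists>c\<in>charts M. P \<in> fst c \<and> (\<exists>C. (\<forall>i j. C $ i $ j = C $ j $ i) \<and>
      (\<forall>x\<in>chart_image c UNIV. x $ 1 \<noteq> 0 \<and> gam M c x = inverse (x $ 1) *\<^sub>R C))"
    using c F(2) by (intro bexI[of _ c] conjI exI[of _ C]) auto
qed

theorem theorem3p8:
  fixes M :: "'a::{t2_space, second_countable_topology} surface"
    and N :: "'b::{t2_space, second_countable_topology} surface"
    and \<alpha> \<epsilon> :: real
  assumes "affine_surface M" and "affine_surface N"
    and "type_A M" and "type_A N"
    and "ricci_rank M 1" and "ricci_rank N 1"
    and "alpha_inv M = \<alpha>" and "alpha_inv N = \<alpha>"
    and "eps_inv M = \<epsilon>" and "eps_inv N = \<epsilon>"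
  shows
    "(\<alpha> = 16 \<longrightarrow>
        locally_affine_isomorphic M N \<and> killing_isomorphic M A4_9_0 \<and> type_B M) \<and>
     (\<alpha> \<in> {0<..<16} \<longrightarrow>
        locally_affine_isomorphic M N \<and> killing_isomorphic M A4_12 \<and> \<not> type_B M) \<and>
     (\<alpha> \<notin> {0..16} \<longrightarrow>
        locally_affine_isomorphic M N \<and> killing_isomorphic M A2_A2 \<and> type_B M) \<and>
     (\<alpha> = 0 \<longrightarrow>
        (\<epsilon> < 0 \<longrightarrow>
           locally_affine_isomorphic M N \<and> killing_isomorphic M A2_A2 \<and> type_B M) \<and>
        (\<epsilon> > 0 \<longrightarrow>
           locally_affine_isomorphic M N \<and> killing_isomorphic M A4_12 \<and> \<not> type_B M))"
proof -
  \<comment> \<open>These parameters depend on \<open>\<alpha>\<close> and \<open>\<epsilon>\<close>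
    alone, so \<open>M\<close> and \<open>N\<close> share one model.\<close>
  define d where "d = sqrt (\<alpha> * \<epsilon>) / 2"
  define \<kappa> where "\<kappa> = \<epsilon> * (\<alpha> - 16) / 16"
  have chM: "\<exists>k\<in>charts M. P \<in> fst k \<and> snd k P = 0 \<and> (\<forall>x\<in>chart_image k UNIV. gam M k x = model d \<kappa> x) \<and>
      (\<epsilon> = 1 \<or> \<epsilon> = - 1) \<and> \<alpha> * \<epsilon> \<ge> 0" if "P \<in> points M" for P
    using model_chart[OF assms(1,3,5) that] unfolding assms(7,9) d_def \<kappa>_def by (metis (lifting))
  have chN: "\<exists>k\<in>charts N. P \<in> fst k \<and> snd k P = 0 \<and> (\<forall>x\<in>chart_image k UNIV. gam N k x = model d \<kappa> x)"
    if "P \<in> points N" for P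
    using model_chart[OF assms(2,4,6) that] unfolding assms(8,10) d_def \<kappa>_def by (metis (lifting))
  have iso: "locally_affine_isomorphic M N"
    unfolding locally_affine_isomorphic_def
  proof (intro ballI)
    fix P Q assume "P \<in> points M" "Q \<in> points N"
    then obtain k l where k: "k \<in> charts M" "P \<in> fst k" "snd k P = 0" "\<And>x. x \<in> chart_image k UNIV \<Longrightarrow> gam M k x = model d \<kappa> x"
      and l: "l \<in> charts N" "Q \<in> fst l" "snd l Q = 0" "\<And>x. x \<in> chart_image l UNIV \<Longrightarrow> gam N l x = model d \<kappa> x"
      using chM chN by metis
    then show "\<exists>U f. P \<in> U \<and> affine_diffeo M N U f \<and> f P = Q"
      using affine_diffeo_from_charts[OF assms(1,2) k(1) l(1) k(2) l(2) _ k(4) l(4)] by simp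
  qed
  \<comment> \<open>A surface without points would be flat. A point is what yields
    \<open>\<epsilon> = \<plusminus>1\<close> and
    \<open>\<alpha> \<epsilon> \<ge> 0\<close>.\<close>
  have "points M \<noteq> {}"
  proof
    assume e: "points M = {}"
    then have "flat M" by (auto simp: flat_def chart_image_def points_def)
    then show False using assms(3) by (simp add: type_A_def)
  qed
  then obtain P0 where P0: "P0 \<in> points M" by blast
  then have \<epsilon>: "\<epsilon> = 1 \<or> \<epsilon> = - 1" and \<alpha>\<epsilon>: "\<alpha> * \<epsilon> \<ge> 0" using chM by blast+
  have "d\<^sup>2 = \<alpha> * \<epsilon> / 4" using \<alpha>\<epsilon> by (simp add: d_def power_divide)
  \<comment> \<open>The difference \<open>d\<^sup>2 / 4 - \<kappa>\<close> is precisely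
    \<open>\<epsilon>\<close>.\<close>
  then have nd: "\<kappa> \<noteq> d\<^sup>2 / 4" using \<epsilon> by (auto simp: \<kappa>_def)
  have ms: "\<exists>C S k. model_surface \<kappa> C S M k P d" if P: "P \<in> points M" for P
  proof -
    obtain C S where "oscillator \<kappa> C S" using oscillator_exists[of \<kappa>] unfolding oscillator_def by metis
    moreover obtain k where "k \<in> charts M" "P \<in> fst k" "snd k P = 0" "\<forall>x\<in>chart_image k UNIV. gam M k x = model d \<kappa> x"
      using chM[OF P] by blast
    ultimately have "model_surface \<kappa> C S M k P d"
      using assms(1) nd by (simp add: model_surface_def model_surface_axioms_def)
    then show ?thesis by blast
  qed
  have neg: "killing_isomorphic M A4_12 \<and> \<not> type_B M" if "\<kappa> < 0"
    unfolding killing_isomorphic_def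
    using ms ms[OF P0] model_surface.killing_A4_12[OF _ that] model_surface.not_type_B[OF _ that] by metis
  have B: "type_B M" if "\<kappa> \<ge> 0"
    by (rule type_B_from_model[OF assms(1,3) _ that, of d]) (use chM in blast)
  have zero: "killing_isomorphic M A4_9_0 \<and> type_B M" if "\<kappa> = 0"
    unfolding killing_isomorphic_def using ms model_surface.killing_A4_9_0[OF _ that] B that by (metis order_refl)
  have pos: "killing_isomorphic M A2_A2 \<and> type_B M" if "\<kappa> > 0"
    unfolding killing_isomorphic_def using ms model_surface.killing_A2_A2[OF _ that] B that by (metis less_imp_le)
  \<comment> \<open>Since \<open>\<alpha> \<epsilon> \<ge> 0\<close>, a nonzero
    \<open>\<alpha>\<close> has the sign \<open>\<epsilon>\<close>, which determines the sign of
    \<open>\<kappa>\<close>. Only at \<open>\<alpha> = 0\<close> do both values of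
    \<open>\<epsilon>\<close> remain, and there \<open>\<kappa> = - \<epsilon>\<close>.\<close>
  have "\<alpha> = 16 \<Longrightarrow> \<kappa> = 0" by (simp add: \<kappa>_def)
  moreover have "0 < \<alpha> \<Longrightarrow> \<alpha> < 16 \<Longrightarrow> \<kappa> < 0" using \<epsilon> \<alpha>\<epsilon> by (auto simp: \<kappa>_def)
  moreover have "\<alpha> < 0 \<or> 16 < \<alpha> \<Longrightarrow> \<kappa> > 0" using \<epsilon> \<alpha>\<epsilon> by (auto simp: \<kappa>_def)
  moreover have "\<alpha> = 0 \<Longrightarrow> \<epsilon> < 0 \<Longrightarrow> \<kappa> > 0" "\<alpha> = 0 \<Longrightarrow> \<epsilon> > 0 \<Longrightarrow> \<kappa> < 0" by (simp_all add: \<kappa>_def)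
  ultimately show ?thesis using iso neg zero pos by auto
qed

end
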